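(* Let $\lambda_0\in\mathbb{R}$. Assume that system (S$_\lambda$) of the context satisfies: (i) it is disconjugate on $\mathcal{I}$ with respect to $\lambda=\lambda_0$; (ii) it is identically normal on $\mathcal{I}$; (iii) the definiteness condition holds on $\mathcal{I}$. Let $\lambda<\lambda_0$ and let $d=d_+(H_0)=d_-(H_0)$. Then (S$_\lambda$) has $d$ linearly independent solutions $\tilde y_1,\dots,\tilde y_n,\hat y_1,\dots,\hat y_{d-n}$ in $l^2_W(\mathcal{I})$, and there are indices $i_1,\dots,i_{d-n}\in\{1,\dots,n\}$, such that (1) $\tilde Y(t)=[\tilde y_1(t),\dots,\tilde y_n(t)]$, $\tilde Y=(\tilde U;\tilde V)$, is a recessive solution of (S$_\lambda$) satisfying $\tilde U(1)=I_n$; (2) $\hat Y(t)=[\hat y_1(t),\dots,\hat y_{d-n}(t)]$, $\hat Y=(\hat U;\hat V)$, satisfies $\hat U(1)=0$ and the $i_1,\dots,i_{d-n}$-th rows of $\hat V(1)$ form $I_{d-n}$; (3) setting $\theta_j=\tilde y_{i_j}$ and $\theta_{d-n+j}=\hat y_j$ for $j=1,\dots,d-n$, the matrix $\Theta=\big((\theta_i,\theta_j)(t)\big)_{1\le i,j\le 2d-2n}$ (which is independent of $t$) has the form $$\Theta=\begin{pmatrix}0&I_{d-n}\\-I_{d-n}&0\end{pmatrix}.$$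
   Context: Setting. $\mathcal{I}=\{0,1,2,\dots\}$, $\Delta u(t)=u(t+1)-u(t)$, $M^*$ is the conjugate transpose. For $t\in\mathcal{I}$, $A(t)$ is an $n\times n$ complex matrix with $I_n-A(t)$ invertible, and $B(t),C(t),W(t)$ are $n\times n$ Hermitian matrices with $B(t)\ge 0$, $W(t)\ge 0$. For $\lambda\in\mathbb{C}$, (S$_\lambda$) is $$\Delta u(t)=A(t)u(t+1)+B(t)v(t),\qquad \Delta v(t)=(C(t)-\lambda W(t))u(t+1)-A^*(t)v(t),\quad t\in\mathcal{I}.$$ Vector solutions are written $y=(u;v)$, $u(t),v(t)\in\mathbb{C}^n$; matrix solutions $Y=(U;V)$. Put $\tilde A(t)=(I_n-A(t))^{-1}$, $J=\begin{pmatrix}0&-I_n\\ I_n&0\end{pmatrix}$, and $(y_1,y_2)(t)=y_2^*(t)Jy_1(t)$. Recessive solutions. A $2n\times n$ matrix solution $Y$ is prepared if $Y^*(t)JY(t)\equiv0$. A prepared solution $Y=(U;V)$ is recessive if, whenever $Y_1=(U_1;V_1)$ is a ($2n\times n$) solution with $Y^*(t)JY_1(t)\equiv C$ for a non-singular constant matrix $C$, there is $s_1\in\mathcal{I}$ such that $U_1(t)$ is non-singular for $t\ge s_1$ and $\lim_{t\to\infty}U_1^{-1}(t)U(t)=0$. Hypotheses. $B^\dagger$ is the Moore–Penrose inverse of $B$. A solution $y=(u;v)$ has a generalized zero at $t=0$ if $u(0)=0$, and at $t\ge 1$ if $u(t-1)\ne 0$, $u(t)\in\mathrm{Ran}(\tilde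 A(t-1)B(t-1))$ and $u^*(t-1)B^\dagger(t-1)(I_n-A(t-1))u(t)\le 0$. (S$_\lambda$) is disconjugate on $\mathcal{I}$ with respect to $\lambda=\lambda_0$ if every solution with $\lambda=\lambda_0$ has at most one generalized zero on $\mathcal{I}$. It is identically normal on $\mathcal{I}$ if on every subinterval $\mathcal{I}_1$ of $\mathcal{I}$ the only $\mathbb{C}^n$-valued $v$ with $\Delta v(t)=-A^*(t)v(t)$ and $B(t)v(t)=0$ on $\mathcal{I}_1$ is $v=0$. The definiteness condition holds on $\mathcal{I}$ if there is a finite subinterval $\mathcal{I}_0=[t_0,s_0]\cap\mathbb{Z}\subset\mathcal{I}$ such that for any $\lambda\in\mathbb{C}$ every non-trivial solution $y=(u;v)$ of (S$_\lambda$) satisfies $\sum_{t\in\mathcal{I}_0}u^*(t+1)W(t)u(t+1)>0$. Spaces and relations. $l^2_W(\mathcal{I})$ is the set of sequences $y=\{y(t)\}_{t\in\mathcal{I}}$, $y(t)=(u(t);v(t))\in\mathbb{C}^{2n}$, with $\sum_{t\in\mathcal{I}}u^*(t+1)W(t)u(t+1)<\infty$; $\langle y_1,y_2\rangle_W=\sum_{t\in\mathcal{I}}u_2^*(t+1)W(t)u_1(t+1)$; $L^2_W(\mathcal{I})=l^2_W(\mathcal{I})/\{\langle y,y\rangle_W=0\}$, a Hilbert space, with $[y]$ the class of $y$. $l^2_{W,0}(\mathcal{I})$ is the set of $y\in l^2_W(\mathcal{I})$ for which there is $s\in\mathcal{I}$ with $y(0)=0$ and $y(t)=0$ for $t\ge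 s$. The maximal relation $H$ is the set of $([y],[y'])\in (L^2_W(\mathcal{I}))^2$ such that for some representative $y=(u;v)\in[y]$ (and $y'=(u';v')$) $$\Delta u(t)=A(t)u(t+1)+B(t)v(t),\quad \Delta v(t)=C(t)u(t+1)-A^*(t)v(t)-W(t)u'(t+1),\quad t\in\mathcal{I}.$$ $H_{00}$ is the set of $([y],[y'])\in H$ for which such a representative can be chosen in $l^2_{W,0}(\mathcal{I})$; $H_0=\overline{H_{00}}$ is the minimal relation. For a linear relation $T$ (linear subspace of $\mathcal{X}\times\mathcal{X}$), $T-\lambda I=\{(x,x'-\lambda x):(x,x')\in T\}$, $\mathcal{R}(T)$ is the set of second components, and $d_\pm(T)=\dim\mathcal{R}(T\mp iI)^\perp$. Under hypotheses (i)–(iii), $d_+(H_0)=d_-(H_0)=d$ and $n\le d\le 2n$. *)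

theory Defs
  imports "HOL-Analysis.Analysis"
begin

section \<open>Complex vectors and matrices\<close>

text \<open>The product \<open>x\<^sup>* y\<close>; the library inner product on \<open>complex ^ 'n\<close> is only real-valued.\<close>

definition cdot :: "complex ^ 'n \<Rightarrow> complex ^ 'n \<Rightarrow> complex" where
  "cdot x y = (\<Sum>i\<in>UNIV. cnj (x $ i) * y $ i)"

definition ctrans :: "complex ^ 'n ^ 'm \<Rightarrow> complex ^ 'm ^ 'n" where
  "ctrans M = (\<chi> i j. cnj (M $ j $ i))"

definition hermitian :: "complex ^ 'n ^ 'n \<Rightarrow> bool" where
  "hermitian M \<longleftrightarrow> ctrans M = M"

definition nonneg_hermitian :: "complex ^ 'n ^ 'n \<Rightarrow> bool" where
  "nonneg_hermitian M \<longleftrightarrow> hermitian M \<and> (\<forall>x. 0 \<le> Re (cdot x (M *v x)))"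

text \<open>The Moore--Penrose inverse, as the unique solution of the four Penrose equations.\<close>

definition pinv :: "complex ^ 'n ^ 'm \<Rightarrow> complex ^ 'm ^ 'n" where
  "pinv M = (THE X. M ** X ** M = M \<and> X ** M ** X = X \<and>
                    ctrans (M ** X) = M ** X \<and> ctrans (X ** M) = X ** M)"


section \<open>The Hamiltonian system\<close>

text \<open>A sequence \<open>y(t) = (u(t); v(t))\<close> is encoded as a function into pairs, so that
  \<open>u(t) = fst (y t)\<close> and \<open>v(t) = snd (y t)\<close>.\<close>

type_synonym 'n cmat = "complex ^ 'n ^ 'n"
type_synonym 'n cpair = "(complex ^ 'n) \<times> (complex ^ 'n)"
type_synonym 'n cseq = "nat \<Rightarrow> 'n cpair"

definition pscale :: "complex \<Rightarrow> 'n::finite cpair \<Rightarrow> 'n cpair" where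
  "pscale c p = (c *s fst p, c *s snd p)"

definition pdot :: "'n::finite cpair \<Rightarrow> 'n cpair \<Rightarrow> complex" where
  "pdot p q = cdot (fst p) (fst q) + cdot (snd p) (snd q)"

definition Jmap :: "'n::finite cpair \<Rightarrow> 'n cpair" where
  "Jmap p = (- snd p, fst p)"

text \<open>\<open>(y\<^sub>1, y\<^sub>2)(t) = y\<^sub>2\<^sup>*(t) J y\<^sub>1(t)\<close>, as a form on the values.\<close>

definition bform :: "'n::finite cpair \<Rightarrow> 'n cpair \<Rightarrow> complex" where
  "bform p q = pdot q (Jmap p)"

definition fdiff :: "(nat \<Rightarrow> 'a::ab_group_add) \<Rightarrow> nat \<Rightarrow> 'a" where
  "fdiff u t = u (t + 1) - u t"

definition hamiltonian_coeffs ::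
  "(nat \<Rightarrow> 'n::finite cmat) \<Rightarrow> (nat \<Rightarrow> 'n cmat) \<Rightarrow> (nat \<Rightarrow> 'n cmat) \<Rightarrow> (nat \<Rightarrow> 'n cmat) \<Rightarrow> bool" where
  "hamiltonian_coeffs A B C W \<longleftrightarrow>
     (\<forall>t. invertible (mat 1 - A t) \<and> nonneg_hermitian (B t) \<and> hermitian (C t) \<and>
          nonneg_hermitian (W t))"

definition Atilde :: "(nat \<Rightarrow> 'n::finite cmat) \<Rightarrow> nat \<Rightarrow> 'n cmat" where
  "Atilde A t = matrix_inv (mat 1 - A t)"

text \<open>The scalar multiple \<open>\<lambda> M\<close> of a complex matrix is written \<open>mat \<lambda> ** M\<close>.\<close>

definition solution ::
  "(nat \<Rightarrow> 'n::finite cmat) \<Rightarrow> (nat \<Rightarrow> 'n cmat) \<Rightarrow> (nat \<Rightarrow> 'n cmat) \<Rightarrow> (nat \<Rightarrow> 'n cmat) \<Rightarrow>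
   complex \<Rightarrow> 'n cseq \<Rightarrow> bool" where
  "solution A B C W lam y \<longleftrightarrow>
     (let u = (\<lambda>t. fst (y t)); v = (\<lambda>t. snd (y t)) in
      \<forall>t. fdiff u t = A t *v u (t + 1) + B t *v v t \<and>
          fdiff v t = (C t - mat lam ** W t) *v u (t + 1) - ctrans (A t) *v v t)"

definition matrix_solution ::
  "(nat \<Rightarrow> 'n::finite cmat) \<Rightarrow> (nat \<Rightarrow> 'n cmat) \<Rightarrow> (nat \<Rightarrow> 'n cmat) \<Rightarrow> (nat \<Rightarrow> 'n cmat) \<Rightarrow>
   complex \<Rightarrow> (nat \<Rightarrow> 'n cmat) \<Rightarrow> (nat \<Rightarrow> 'n cmat) \<Rightarrow> bool" where
  "matrix_solution A B C W lam U V \<longleftrightarrow>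
     (\<forall>t. fdiff U t = A t ** U (t + 1) + B t ** V t \<and>
          fdiff V t = (C t - mat lam ** W t) ** U (t + 1) - ctrans (A t) ** V t)"

text \<open>\<open>Y\<^sup>* J Y\<^sub>1\<close> for \<open>Y = (U; V)\<close> and \<open>Y\<^sub>1 = (U\<^sub>1; V\<^sub>1)\<close>.\<close>

definition matrix_bform ::
  "'n::finite cmat \<Rightarrow> 'n cmat \<Rightarrow> 'n cmat \<Rightarrow> 'n cmat \<Rightarrow> 'n cmat" where
  "matrix_bform U V U1 V1 = ctrans V ** U1 - ctrans U ** V1"

definition prepared_solution where
  "prepared_solution A B C W lam U V \<longleftrightarrow>
     matrix_solution A B C W lam U V \<and> (\<forall>t. matrix_bform (U t) (V t) (U t) (V t) = 0)"

definition recessive_solution ::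
  "(nat \<Rightarrow> 'n::finite cmat) \<Rightarrow> (nat \<Rightarrow> 'n cmat) \<Rightarrow> (nat \<Rightarrow> 'n cmat) \<Rightarrow> (nat \<Rightarrow> 'n cmat) \<Rightarrow>
   complex \<Rightarrow> (nat \<Rightarrow> 'n cmat) \<Rightarrow> (nat \<Rightarrow> 'n cmat) \<Rightarrow> bool" where
  "recessive_solution A B C W lam U V \<longleftrightarrow>
     prepared_solution A B C W lam U V \<and>
     (\<forall>U1 V1. matrix_solution A B C W lam U1 V1 \<and>
        (\<exists>K. invertible K \<and> (\<forall>t. matrix_bform (U t) (V t) (U1 t) (V1 t) = K)) \<longrightarrow>
        (\<exists>s1. \<forall>t\<ge>s1. invertible (U1 t)) \<and>
        (\<lambda>t. matrix_inv (U1 t) ** U t) \<longlonglongrightarrow> 0)"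

text \<open>The \<open>n \<times> n\<close> blocks of the matrix whose columns are the vectors \<open>y\<^sub>j(t)\<close>.\<close>

definition col_upper :: "('n \<Rightarrow> 'n::finite cseq) \<Rightarrow> nat \<Rightarrow> 'n cmat" where
  "col_upper y t = (\<chi> i j. fst (y j t) $ i)"

definition col_lower :: "('n \<Rightarrow> 'n::finite cseq) \<Rightarrow> nat \<Rightarrow> 'n cmat" where
  "col_lower y t = (\<chi> i j. snd (y j t) $ i)"

definition lin_indep :: "'i set \<Rightarrow> ('i \<Rightarrow> 'n::finite cseq) \<Rightarrow> bool" where
  "lin_indep I y \<longleftrightarrow>
     (\<forall>c. (\<forall>t. (\<Sum>i\<in>I. pscale (c i) (y i t)) = 0) \<longrightarrow> (\<forall>i\<in>I. c i = 0))"


section \<open>Disconjugacy, identical normality, definiteness\<close>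

text \<open>For complex \<open>z\<close>, the condition \<open>z \<le> 0\<close> means that \<open>z\<close> is real and nonpositive.\<close>

definition generalized_zero ::
  "(nat \<Rightarrow> 'n::finite cmat) \<Rightarrow> (nat \<Rightarrow> 'n cmat) \<Rightarrow> 'n cseq \<Rightarrow> nat \<Rightarrow> bool" where
  "generalized_zero A B y t \<longleftrightarrow>
     (let u = (\<lambda>t. fst (y t)) in
      if t = 0 then u 0 = 0
      else u (t - 1) \<noteq> 0 \<and>
           u t \<in> range (\<lambda>w. (Atilde A (t - 1) ** B (t - 1)) *v w) \<and>
           cdot (u (t - 1)) ((pinv (B (t - 1)) ** (mat 1 - A (t - 1))) *v u t) \<in> \<real>\<^sub>\<le>\<^sub>0)"

definition disconjugate ::
  "(nat \<Rightarrow> 'n::finite cmat) \<Rightarrow> (nat \<Rightarrow> 'n cmat) \<Rightarrow> (nat \<Rightarrow> 'n cmat) \<Rightarrow> (nat \<Rightarrow> 'n cmat) \<Rightarrow>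
   complex \<Rightarrow> bool" where
  "disconjugate A B C W lam0 \<longleftrightarrow>
     (\<forall>y. solution A B C W lam0 y \<longrightarrow>
        (\<forall>s t. generalized_zero A B y s \<and> generalized_zero A B y t \<longrightarrow> s = t))"

text \<open>Subintervals are the order-convex subsets of \<open>\<nat>\<close>, singletons included.\<close>

definition identically_normal :: "(nat \<Rightarrow> 'n::finite cmat) \<Rightarrow> (nat \<Rightarrow> 'n cmat) \<Rightarrow> bool" where
  "identically_normal A B \<longleftrightarrow>
     (\<forall>I1 :: nat set. (\<forall>a\<in>I1. \<forall>b\<in>I1. {a..b} \<subseteq> I1) \<longrightarrow>
        (\<forall>v. (\<forall>t\<in>I1. fdiff v t = - (ctrans (A t) *v v t) \<and> B t *v v t = 0) \<longrightarrow>
             (\<forall>t\<in>I1. v t = 0)))"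

definition definiteness_condition ::
  "(nat \<Rightarrow> 'n::finite cmat) \<Rightarrow> (nat \<Rightarrow> 'n cmat) \<Rightarrow> (nat \<Rightarrow> 'n cmat) \<Rightarrow> (nat \<Rightarrow> 'n cmat) \<Rightarrow> bool" where
  "definiteness_condition A B C W \<longleftrightarrow>
     (\<exists>t0 s0. t0 \<le> s0 \<and>
        (\<forall>lam y. solution A B C W lam y \<and> (\<exists>t. y t \<noteq> 0) \<longrightarrow>
           (\<Sum>t\<in>{t0..s0}. Re (cdot (fst (y (t + 1))) (W t *v fst (y (t + 1))))) > 0))"


section \<open>The Hilbert space of classes of square-summable sequences\<close>

definition l2W :: "(nat \<Rightarrow> 'n::finite cmat) \<Rightarrow> 'n cseq set" where
  "l2W W = {y. summable (\<lambda>t. Re (cdot (fst (y (t + 1))) (W t *v fst (y (t + 1)))))}"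

definition seq_inner :: "(nat \<Rightarrow> 'n::finite cmat) \<Rightarrow> 'n cseq \<Rightarrow> 'n cseq \<Rightarrow> complex" where
  "seq_inner W y1 y2 = (\<Sum>t. cdot (fst (y2 (t + 1))) (W t *v fst (y1 (t + 1))))"

definition l2W0 :: "(nat \<Rightarrow> 'n::finite cmat) \<Rightarrow> 'n cseq set" where
  "l2W0 W = {y \<in> l2W W. y 0 = 0 \<and> (\<exists>s. \<forall>t\<ge>s. y t = 0)}"

definition l2W_rel :: "(nat \<Rightarrow> 'n::finite cmat) \<Rightarrow> 'n cseq rel" where
  "l2W_rel W = {(y, z). y \<in> l2W W \<and> z \<in> l2W W \<and>
                        seq_inner W (\<lambda>t. y t - z t) (\<lambda>t. y t - z t) = 0}"

type_synonym 'n cclass = "'n cseq set"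

definition L2W :: "(nat \<Rightarrow> 'n::finite cmat) \<Rightarrow> 'n cclass set" where
  "L2W W = l2W W // l2W_rel W"

definition cls :: "(nat \<Rightarrow> 'n::finite cmat) \<Rightarrow> 'n cseq \<Rightarrow> 'n cclass" where
  "cls W y = l2W_rel W `` {y}"

text \<open>The operations on classes are defined through chosen representatives, on which they do
  not depend.\<close>

definition rep :: "'n cclass \<Rightarrow> 'n cseq" where
  "rep X = (SOME y. y \<in> X)"

definition L2_inner :: "(nat \<Rightarrow> 'n::finite cmat) \<Rightarrow> 'n cclass \<Rightarrow> 'n cclass \<Rightarrow> complex" where
  "L2_inner W X Y = seq_inner W (rep X) (rep Y)"

definition L2_lincomb ::
  "(nat \<Rightarrow> 'n::finite cmat) \<Rightarrow> 'n cclass set \<Rightarrow> ('n cclass \<Rightarrow> complex) \<Rightarrow> 'n cclass" where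
  "L2_lincomb W b c = cls W (\<lambda>t. \<Sum>X\<in>b. pscale (c X) (rep X t))"

definition L2_diff_scale ::
  "(nat \<Rightarrow> 'n::finite cmat) \<Rightarrow> 'n cclass \<Rightarrow> complex \<Rightarrow> 'n cclass \<Rightarrow> 'n cclass" where
  "L2_diff_scale W X' c X = cls W (\<lambda>t. rep X' t - pscale c (rep X t))"

definition L2_dist :: "(nat \<Rightarrow> 'n::finite cmat) \<Rightarrow> 'n cclass \<Rightarrow> 'n cclass \<Rightarrow> real" where
  "L2_dist W X Y = (let Z = L2_diff_scale W X 1 Y in sqrt (Re (L2_inner W Z Z)))"

definition L2_orth :: "(nat \<Rightarrow> 'n::finite cmat) \<Rightarrow> 'n cclass set \<Rightarrow> 'n cclass set" where
  "L2_orth W S = {X \<in> L2W W. \<forall>Y\<in>S. L2_inner W X Y = 0}"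

definition L2_basis :: "(nat \<Rightarrow> 'n::finite cmat) \<Rightarrow> 'n cclass set \<Rightarrow> 'n cclass set \<Rightarrow> bool" where
  "L2_basis W S b \<longleftrightarrow> finite b \<and> b \<subseteq> S \<and>
     (\<forall>c. L2_lincomb W b c = cls W (\<lambda>_. 0) \<longrightarrow> (\<forall>X\<in>b. c X = 0)) \<and>
     (\<forall>X\<in>S. \<exists>c. X = L2_lincomb W b c)"

text \<open>The dimension of a subspace of \<open>L2W W\<close>; as for the library's dimension of vector spaces,
  the value is \<open>0\<close> when there is no finite basis.\<close>

definition L2_dim :: "(nat \<Rightarrow> 'n::finite cmat) \<Rightarrow> 'n cclass set \<Rightarrow> nat" where
  "L2_dim W S = (if \<exists>b. L2_basis W S b then card (SOME b. L2_basis W S b) else 0)"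


section \<open>Linear relations\<close>

definition relation_eq ::
  "(nat \<Rightarrow> 'n::finite cmat) \<Rightarrow> (nat \<Rightarrow> 'n cmat) \<Rightarrow> (nat \<Rightarrow> 'n cmat) \<Rightarrow> (nat \<Rightarrow> 'n cmat) \<Rightarrow>
   'n cseq \<Rightarrow> 'n cseq \<Rightarrow> bool" where
  "relation_eq A B C W y y' \<longleftrightarrow>
     (let u = (\<lambda>t. fst (y t)); v = (\<lambda>t. snd (y t)); u' = (\<lambda>t. fst (y' t)) in
      \<forall>t. fdiff u t = A t *v u (t + 1) + B t *v v t \<and>
          fdiff v t = C t *v u (t + 1) - ctrans (A t) *v v t - W t *v u' (t + 1))"

definition H_max ::
  "(nat \<Rightarrow> 'n::finite cmat) \<Rightarrow> (nat \<Rightarrow> 'n cmat) \<Rightarrow> (nat \<Rightarrow> 'n cmat) \<Rightarrow> (nat \<Rightarrow> 'n cmat) \<Rightarrow>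
   'n cclass rel" where
  "H_max A B C W = {(X, X'). X \<in> L2W W \<and> X' \<in> L2W W \<and>
                     (\<exists>y\<in>X. \<exists>y'\<in>X'. relation_eq A B C W y y')}"

definition H_00 ::
  "(nat \<Rightarrow> 'n::finite cmat) \<Rightarrow> (nat \<Rightarrow> 'n cmat) \<Rightarrow> (nat \<Rightarrow> 'n cmat) \<Rightarrow> (nat \<Rightarrow> 'n cmat) \<Rightarrow>
   'n cclass rel" where
  "H_00 A B C W = {(X, X') \<in> H_max A B C W.
                     \<exists>y \<in> X \<inter> l2W0 W. \<exists>y'\<in>X'. relation_eq A B C W y y'}"

definition relation_closure :: "(nat \<Rightarrow> 'n::finite cmat) \<Rightarrow> 'n cclass rel \<Rightarrow> 'n cclass rel" where
  "relation_closure W T = {(X, X'). X \<in> L2W W \<and> X' \<in> L2W W \<and>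
     (\<forall>e>0. \<exists>(Z, Z')\<in>T. L2_dist W X Z < e \<and> L2_dist W X' Z' < e)}"

definition H_min ::
  "(nat \<Rightarrow> 'n::finite cmat) \<Rightarrow> (nat \<Rightarrow> 'n cmat) \<Rightarrow> (nat \<Rightarrow> 'n cmat) \<Rightarrow> (nat \<Rightarrow> 'n cmat) \<Rightarrow>
   'n cclass rel" where
  "H_min A B C W = relation_closure W (H_00 A B C W)"

definition relation_shift ::
  "(nat \<Rightarrow> 'n::finite cmat) \<Rightarrow> 'n cclass rel \<Rightarrow> complex \<Rightarrow> 'n cclass rel" where
  "relation_shift W T lam = {(X, L2_diff_scale W X' lam X) | X X'. (X, X') \<in> T}"

definition defect_plus :: "(nat \<Rightarrow> 'n::finite cmat) \<Rightarrow> 'n cclass rel \<Rightarrow> nat" where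
  "defect_plus W T = L2_dim W (L2_orth W (Range (relation_shift W T \<i>)))"

definition defect_minus :: "(nat \<Rightarrow> 'n::finite cmat) \<Rightarrow> 'n cclass rel \<Rightarrow> nat" where
  "defect_minus W T = L2_dim W (L2_orth W (Range (relation_shift W T (- \<i>))))"

end

theory Submission
  imports Defs
begin

text \<open>Identical normality on singletons makes every \<open>B(t)\<close> positive definite, and disconjugacy at
  \<open>\<lambda>\<^sub>0\<close> yields, through the Picone identity, that the quadratic functional is positive on sequences
  vanishing at both ends; for \<open>\<lambda> < \<lambda>\<^sub>0\<close> it even dominates \<open>(\<lambda>\<^sub>0 - \<lambda>)\<close> times the \<open>W\<close>-norm.
  If \<open>Y\<^sub>N\<close> is the solution with \<open>U\<^sub>N(1) = I\<close> and \<open>U\<^sub>N(N) = 0\<close>, then \<open>V\<^sub>N(1)\<close> is Hermitian,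
  increasing and bounded, and its limit gives the initial value of the recessive solution, whose
  columns are square summable by the same energy bound.

  The defect index \<open>d\<close> is the dimension of the space of square-summable solutions at \<open>-\<i>\<close>.
  It is compared with the one at \<open>\<lambda>\<close> without selfadjoint extensions: to a square-summable solution
  \<open>p\<close> at \<open>\<nu>\<close> assign \<open>p - x\<close>, where \<open>x\<close> is a limit of solutions of the inhomogeneous problem at
  \<open>\<mu>\<close> with right-hand side \<open>(\<nu> - \<mu>) p\<close> and zero boundary values on finite intervals. An energy
  identity shows that \<open>x = p\<close> forces \<open>p = 0\<close>, so this map is injective, in both directions. The rest
  is row reduction of the values at \<open>t = 1\<close> and constancy of the form \<open>(y\<^sub>1, y\<^sub>2)(t)\<close>.\<close>

section \<open>Complex inner products and matrices\<close>

text \<open>Solutions of the truncated problems converge only pointwise in t, and part of their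
  \<open>W\<close>-norm may escape to infinity, so limits of norms give no direct conclusion. What
  does converge is the pairing with a fixed square-summable sequence, and the real and imaginary
  parts of the energy identity recover the missing information from it. The uniform bounds behind
  these limits have different origins at the two parameters: at \<open>lam\<close> the gap
  \<open>lam0 - lam\<close>, at \<open>-\<i>\<close> the imaginary part. The parameter
  \<open>-\<i>\<close> appears because the orthogonal complement of the range of T - zI consists of
  solutions at the conjugate of z. Solutions are normalised at t = 1, while the generalized zero at
  the left end is u(0) = 0. Invertibility of \<open>B 0\<close> bridges the two: every value u(1) is
  reached from u(0) = 0 by an admissible step. Definiteness turns bounds on \<open>W\<close>-sums
  into bounds on initial values and makes the passage from a solution to its class
  injective.\<close>

lemma cdot_add_left: "cdot (x + y) z = cdot x z + cdot y z"
  and cdot_add_right: "cdot x (y + z) = cdot x y + cdot x z"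
  and cdot_diff_left: "cdot (x - y) z = cdot x z - cdot y z"
  and cdot_diff_right: "cdot x (y - z) = cdot x y - cdot x z"
  and cdot_minus_left: "cdot (- x) y = - cdot x y"
  and cdot_minus_right: "cdot x (- y) = - cdot x y"
  and cdot_zero_left [simp]: "cdot 0 x = 0"
  and cdot_zero_right [simp]: "cdot x 0 = 0"
  and cdot_scale_left: "cdot (c *s x) y = cnj c * cdot x y"
  and cdot_scale_right: "cdot x (c *s y) = c * cdot x y"
  by (simp_all add: cdot_def sum.distrib sum_subtractf sum_negf sum_distrib_left algebra_simps)

lemmas cdot_linear = cdot_add_left cdot_add_right cdot_diff_left cdot_diff_right
  cdot_minus_left cdot_minus_right cdot_scale_left cdot_scale_right

lemma cnj_cdot: "cnj (cdot x y) = cdot y x"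
  by (simp add: cdot_def mult.commute)

lemma Re_cdot_commute: "Re (cdot x y) = Re (cdot y x)"
  by (subst cnj_cdot [symmetric]) simp

lemma Re_cdot: "Re (cdot x y) = x \<bullet> y"
  by (simp add: cdot_def inner_vec_def inner_complex_def)

lemma cdot_axis: "cdot (axis i 1) x = x $ i" "cdot x (axis i 1) = cnj (x $ i)"
  by (simp_all add: cdot_def axis_def if_distrib if_distribR cong: if_cong)

lemma cdot_eq_0_iff: "cdot x x = 0 \<longleftrightarrow> x = 0"
  by (metis Re_cdot cdot_zero_left inner_eq_zero_iff zero_complex.simps(1))

lemma cdot_all_eq_0: "(\<And>x. cdot x y = 0) \<Longrightarrow> y = 0"
  using cdot_eq_0_iff by blast

lemma cdot_matrix: "cdot x (M *v y) = cdot (ctrans M *v x) y"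
proof -
  have "cdot x (M *v y) = (\<Sum>i\<in>UNIV. \<Sum>j\<in>UNIV. cnj (x $ i) * (M $ i $ j * y $ j))"
    by (simp add: cdot_def matrix_vector_mult_def sum_distrib_left)
  also have "\<dots> = (\<Sum>j\<in>UNIV. \<Sum>i\<in>UNIV. cnj (x $ i) * (M $ i $ j * y $ j))"
    by (rule sum.swap)
  also have "\<dots> = cdot (ctrans M *v x) y"
    by (simp add: cdot_def matrix_vector_mult_def ctrans_def sum_distrib_left sum_distrib_right mult_ac)
  finally show ?thesis .
qed

lemma ctrans_ctrans [simp]: "ctrans (ctrans M) = M"
  by (simp add: ctrans_def vec_eq_iff)

lemma cdot_ctrans: "cdot x (ctrans M *v y) = cdot (M *v x) y"
  by (simp add: cdot_matrix)

lemma cdot_hermitian: "hermitian M \<Longrightarrow> cdot (M *v x) y = cdot x (M *v y)"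
  by (simp add: cdot_matrix hermitian_def)

lemma hermitian_Im_0: "hermitian M \<Longrightarrow> Im (cdot x (M *v x)) = 0"
proof -
  assume "hermitian M"
  then have "cnj (cdot x (M *v x)) = cdot x (M *v x)"
    by (simp add: cnj_cdot cdot_hermitian)
  then show ?thesis
    by (metis add.inverse_inverse cnj.simps(2) neg_equal_zero)
qed

lemma mat_mult_vec: "(mat k ** M) *v x = k *s (M *v x)"
proof -
  have "mat k *v y = k *s y" for y :: "'a ^ 'n"
    by (simp add: vec_eq_iff matrix_vector_mult_def mat_def if_distrib if_distribR cong: if_cong)
  then show ?thesis
    by (simp add: matrix_vector_mul_assoc [symmetric])
qed

text \<open>Expanding the form at sqrt(r) x - (w / sqrt(r)) y, with a unimodular w, gives this
  weighted form of the Cauchy-Schwarz inequality. The free weight r lets one factor be absorbed or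
  made small.\<close>

lemma hermitian_PSD_Cauchy:
  assumes "nonneg_hermitian M" and "r > 0"
  shows "cmod (cdot x (M *v y)) \<le> (r * Re (cdot x (M *v x)) + Re (cdot y (M *v y)) / r) / 2"
proof -
  have herm: "hermitian M" and pos: "\<And>z. 0 \<le> Re (cdot z (M *v z))"
    using assms(1) by (auto simp: nonneg_hermitian_def)
  \<comment> \<open>The phase w rotates the mixed term onto the nonnegative real axis; any
    unimodular number serves when that term is zero.\<close>
  obtain w where w: "cmod w = 1" "w * cdot x (M *v y) = of_real (cmod (cdot x (M *v y)))"
  proof (cases "cdot x (M *v y) = 0")
    case True then show ?thesis using that[of 1] by simp
  next
    case False
    then show ?thesis
      using that[of "of_real (cmod (cdot x (M *v y))) / cdot x (M *v y)"]
      by (simp add: norm_divide)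
  qed
  define s t where "s = complex_of_real (sqrt r)" and "t = complex_of_real (1 / sqrt r)"
  have st: "s * s = of_real r" "t * t = of_real (1 / r)" "s * t = 1" "cnj s = s" "cnj t = t"
    using assms(2) by (simp_all add: s_def t_def flip: of_real_mult)
  define z where "z = s *s x - (w * t) *s y"
  have ww: "cnj w * w = 1"
    using w(1) by (metis complex_norm_square mult.commute of_real_1 one_power2)
  have "cdot y (M *v x) = cnj (cdot x (M *v y))"
    using herm by (simp add: cnj_cdot cdot_hermitian)
  then have wy: "cnj w * cdot y (M *v x) = of_real (cmod (cdot x (M *v y)))"
    using w(2) by (metis complex_cnj_complex_of_real complex_cnj_mult)
  have "cdot z (M *v z) = (s * s) * cdot x (M *v x) - (s * t) * (w * cdot x (M *v y))
      - (s * t) * (cnj w * cdot y (M *v x)) + (cnj w * w) * (t * t) * cdot y (M *v y)"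
    by (simp add: z_def matrix_vector_mult_diff_distrib cdot_linear vector_scalar_commute st(4,5)
        algebra_simps)
  then have "Re (cdot z (M *v z)) = r * Re (cdot x (M *v x)) - 2 * cmod (cdot x (M *v y))
      + Re (cdot y (M *v y)) / r"
    unfolding st w(2) wy ww by (simp del: of_real_divide)
  with pos[of z] show ?thesis by simp
qed

lemma nonneg_hermitian_null:
  assumes "nonneg_hermitian M" and "Re (cdot x (M *v x)) = 0"
  shows "M *v x = 0"
proof -
  have "cdot y (M *v x) = 0" for y
  proof (rule ccontr)
    assume ne: "cdot y (M *v x) \<noteq> 0"
    have q: "0 \<le> Re (cdot y (M *v y))"
      using assms(1) by (simp add: nonneg_hermitian_def)
    \<comment> \<open>This r keeps r times the form at y below the modulus in question; the added 1
      avoids division by zero.\<close>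
    define r where "r = cmod (cdot y (M *v x)) / (Re (cdot y (M *v y)) + 1)"
    have "r > 0" using ne q by (simp add: r_def)
    from hermitian_PSD_Cauchy[OF assms(1) this, of y x]
    have "2 * cmod (cdot y (M *v x)) \<le> r * Re (cdot y (M *v y))" using assms(2) by simp
    also have "\<dots> \<le> cmod (cdot y (M *v x))"
      using q by (simp add: r_def field_simps)
    finally show False using ne by simp
  qed
  then show ?thesis by (rule cdot_all_eq_0)
qed

lemma pscale_simps [simp]: "fst (pscale c p) = c *s fst p" "snd (pscale c p) = c *s snd p"
  by (simp_all add: pscale_def)

text \<open>Links the complex scaling of pairs to their real vector space structure, so that results
  on real-linear maps apply.\<close>

lemma pscale_of_real: "pscale (of_real r) p = r *\<^sub>R p"
  by (simp add: prod_eq_iff vec_eq_iff) (simp add: scaleR_conv_of_real)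

text \<open>The defect index is a complex dimension, hence independence, span and dimension are
  taken over the complex scalars.\<close>

interpretation cpair: vector_space "pscale :: complex \<Rightarrow> 'n::finite cpair \<Rightarrow> 'n cpair"
  by unfold_locales (simp_all add: prod_eq_iff vec_eq_iff algebra_simps)

lemma bform_alt: "bform p q = cdot (snd q) (fst p) - cdot (fst q) (snd p)"
  by (simp add: bform_def pdot_def Jmap_def cdot_minus_right)

section \<open>The inhomogeneous system and the weighted form\<close>

lemma ctrans_mult: "ctrans (X ** Y) = ctrans Y ** ctrans X"
  by (simp add: ctrans_def matrix_matrix_mult_def vec_eq_iff mult.commute)

lemma ctrans_mat_1 [simp]: "ctrans (mat 1) = mat 1"
  by (simp add: ctrans_def mat_def vec_eq_iff eq_commute)

lemma ctrans_diff: "ctrans (X - Y) = ctrans X - ctrans Y"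
  by (simp add: ctrans_def vec_eq_iff)

lemma invertible_ctrans: "invertible M \<Longrightarrow> invertible (ctrans M)"
  unfolding invertible_def by (metis ctrans_mat_1 ctrans_mult)

lemma invertible_bij: "invertible M \<Longrightarrow> bij ((*v) M)" for M :: "complex ^ 'n ^ 'n"
  by (simp add: invertible_eq_bij)

lemma invertible_eq_iff: "invertible M \<Longrightarrow> M *v x = M *v y \<longleftrightarrow> x = y" for M :: "complex ^ 'n ^ 'n"
  by (metis invertible_bij bij_is_inj inj_eq)

lemma invertible_eq_0: "invertible M \<Longrightarrow> M *v x = 0 \<longleftrightarrow> x = 0" for M :: "complex ^ 'n ^ 'n"
  using invertible_eq_iff[of M x 0] by simp

lemma invertible_iff_kernel: "invertible M \<longleftrightarrow> (\<forall>x. M *v x = 0 \<longrightarrow> x = 0)" for M :: "complex ^ 'n ^ 'n"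
  by (simp add: invertible_left_inverse matrix_left_invertible_ker)

lemma matrix_inv_vec:
  fixes M :: "complex ^ 'n ^ 'n"
  assumes "invertible M"
  shows "M *v (matrix_inv M *v x) = x" "matrix_inv M *v (M *v x) = x"
proof -
  from assms have "M ** matrix_inv M = mat 1 \<and> matrix_inv M ** M = mat 1"
    unfolding invertible_def matrix_inv_def by (rule someI_ex)
  then show "M *v (matrix_inv M *v x) = x" "matrix_inv M *v (M *v x) = x"
    by (simp_all add: matrix_vector_mul_assoc)
qed

locale hamiltonian_system =
  fixes A B C W :: "nat \<Rightarrow> complex ^ 'n::finite ^ 'n"
  assumes coeffs: "hamiltonian_coeffs A B C W"
begin

definition P :: "nat \<Rightarrow> complex ^ 'n ^ 'n" where
  "P t = mat 1 - A t"

text \<open>The equation for u alone. It involves neither \<open>C\<close> nor the spectral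
  parameter, so it delimits the competitors in the quadratic functional.\<close>

definition admissible :: "'n cseq \<Rightarrow> nat \<Rightarrow> bool" where
  "admissible y t \<longleftrightarrow> P t *v fst (y (Suc t)) = fst (y t) + B t *v snd (y t)"

text \<open>The value \<open>f t\<close> is paired with u(t+1): the equation of the maximal relation
  is the case \<mu> = 0 with \<open>f t\<close> equal to u'(t+1).\<close>

definition inhom :: "complex \<Rightarrow> (nat \<Rightarrow> complex ^ 'n) \<Rightarrow> 'n cseq \<Rightarrow> nat \<Rightarrow> bool" where
  "inhom \<mu> f y t \<longleftrightarrow> admissible y t \<and>
     snd (y (Suc t)) = C t *v fst (y (Suc t)) - \<mu> *s (W t *v fst (y (Suc t)))
       + ctrans (P t) *v snd (y t) - W t *v f t"

lemma P_inv: "invertible (P t)"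
  and B_pos: "nonneg_hermitian (B t)"
  and C_herm: "hermitian (C t)"
  and W_pos: "nonneg_hermitian (W t)"
  using coeffs by (auto simp: hamiltonian_coeffs_def P_def)

lemma B_herm: "hermitian (B t)" and W_herm: "hermitian (W t)"
  using B_pos W_pos by (auto simp: nonneg_hermitian_def)

lemma A_vec: "A t *v x = x - P t *v x"
  by (simp add: P_def matrix_vector_mult_diff_rdistrib)

lemma A_star_vec: "ctrans (A t) *v x = x - ctrans (P t) *v x"
  by (simp add: P_def ctrans_diff matrix_vector_mult_diff_rdistrib)

lemma solution_iff: "solution A B C W \<mu> y \<longleftrightarrow> (\<forall>t. inhom \<mu> (\<lambda>_. 0) y t)"
  unfolding solution_def Let_def inhom_def admissible_def fdiff_def
  by (simp add: A_vec A_star_vec matrix_vector_mult_diff_rdistrib mat_mult_vec algebra_simps)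

lemma relation_eq_iff:
  "relation_eq A B C W y z \<longleftrightarrow> (\<forall>t. inhom 0 (\<lambda>t. fst (z (Suc t))) y t)"
  unfolding relation_eq_def Let_def inhom_def admissible_def fdiff_def
  by (simp add: A_vec A_star_vec algebra_simps)

text \<open>A change of parameter is absorbed into the right-hand side; a homogeneous solution at
  one parameter thereby becomes an inhomogeneous one at any other.\<close>

lemma inhom_shift:
  "inhom \<mu> f y t \<longleftrightarrow> inhom \<nu> (\<lambda>t. f t + (\<mu> - \<nu>) *s fst (y (Suc t))) y t"
  by (simp add: inhom_def matrix_vector_right_distrib matrix_vector_mult_diff_distrib vector_scalar_commute vector_sub_rdistrib algebra_simps)

lemma inhom_add:
  "inhom \<mu> f y t \<Longrightarrow> inhom \<mu> g z t \<Longrightarrow> inhom \<mu> (\<lambda>t. f t + g t) (\<lambda>t. y t + z t) t"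
  by (simp add: inhom_def admissible_def matrix_vector_right_distrib vector_add_ldistrib)

lemma inhom_pscale:
  "inhom \<mu> f y t \<Longrightarrow> inhom \<mu> (\<lambda>t. c *s f t) (\<lambda>t. pscale c (y t)) t"
  by (simp add: inhom_def admissible_def vector_scalar_commute vector_add_ldistrib
      vector_ssub_ldistrib mult.commute)

lemma inhom_diff:
  "inhom \<mu> f y t \<Longrightarrow> inhom \<mu> g z t \<Longrightarrow> inhom \<mu> (\<lambda>t. f t - g t) (\<lambda>t. y t - z t) t"
  by (simp add: inhom_def admissible_def matrix_vector_mult_diff_distrib vector_ssub_ldistrib)

lemma inhom_zero: "inhom \<mu> (\<lambda>_. 0) (\<lambda>_. 0) t"
  by (simp add: inhom_def admissible_def)

lemma inhom_sum:
  "finite S \<Longrightarrow> (\<And>i. i \<in> S \<Longrightarrow> inhom \<mu> (f i) (y i) t) \<Longrightarrow>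
    inhom \<mu> (\<lambda>t. \<Sum>i\<in>S. c i *s f i t) (\<lambda>t. \<Sum>i\<in>S. pscale (c i) (y i t)) t"
  by (induction S rule: finite_induct)
    (simp_all add: inhom_zero inhom_add inhom_pscale)

lemma inhom_forward:
  assumes "inhom \<mu> f y t" "inhom \<mu> f z t" "y t = z t"
  shows "y (Suc t) = z (Suc t)"
proof -
  have "fst (y (Suc t)) = fst (z (Suc t))"
    using assms invertible_eq_iff[OF P_inv] by (metis admissible_def inhom_def)
  then show ?thesis
    using assms by (simp add: inhom_def prod_eq_iff)
qed

lemma inhom_backward:
  assumes "inhom \<mu> f y t" "inhom \<mu> f z t" "y (Suc t) = z (Suc t)"
  shows "y t = z t"
proof -
  have "ctrans (P t) *v snd (y t) = ctrans (P t) *v snd (z t)"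
    using assms by (simp add: inhom_def)
  then have "snd (y t) = snd (z t)"
    using invertible_eq_iff[OF invertible_ctrans[OF P_inv]] by metis
  moreover from this have "fst (y t) = fst (z t)"
    using assms by (metis add_right_cancel admissible_def inhom_def)
  ultimately show ?thesis by (simp add: prod_eq_iff)
qed

text \<open>Both \<open>P t\<close> and its adjoint are invertible, so the recursion runs in both
  directions. This permits data at 0, at 1 and at a right endpoint alike.\<close>

lemma inhom_unique:
  assumes "\<forall>t. inhom \<mu> f y t" "\<forall>t. inhom \<mu> f z t" "y s = z s"
  shows "y = z"
proof -
  have "y (s + k) = z (s + k)" for k
    by (induction k) (use assms(3) inhom_forward[OF assms(1)[rule_format] assms(2)[rule_format]] in auto)
  moreover have "y (s - k) = z (s - k)" for k
  proof (induction k)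
    case (Suc k)
    show ?case
    proof (cases "k < s")
      case True
      then have "Suc (s - Suc k) = s - k" by simp
      then show ?thesis using Suc inhom_backward assms(1,2) by metis
    qed (use Suc in simp)
  qed (use assms in simp)
  ultimately have "y t = z t" for t
    by (metis diff_diff_cancel le_add_diff_inverse nat_le_linear)
  then show ?thesis by blast
qed

lemma inhom_exists_0: "\<exists>y. y 0 = a \<and> (\<forall>t. inhom \<mu> f y t)"
proof -
  define nu where "nu t p = matrix_inv (P t) *v (fst p + B t *v snd p)" for t and p :: "'n cpair"
  define y where "y = rec_nat a (\<lambda>t p. (nu t p, C t *v nu t p - \<mu> *s (W t *v nu t p)
       + ctrans (P t) *v snd p - W t *v f t))"
  have "inhom \<mu> f y t" for t
    by (simp add: y_def inhom_def admissible_def nu_def matrix_inv_vec[OF P_inv])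
  moreover have "y 0 = a" by (simp add: y_def)
  ultimately show ?thesis by blast
qed

lemma inhom_exists_1: "\<exists>y. y 1 = a \<and> (\<forall>t. inhom \<mu> f y t)"
proof -
  \<comment> \<open>The second equation at t = 0, solved backwards for v(0); the first one then
    gives u(0).\<close>
  define v where "v = matrix_inv (ctrans (P 0)) *v
    (snd a - C 0 *v fst a + \<mu> *s (W 0 *v fst a) + W 0 *v f 0)"
  define b where "b = (P 0 *v fst a - B 0 *v v, v)"
  obtain y where y: "y 0 = b" "\<forall>t. inhom \<mu> f y t"
    using inhom_exists_0 by blast
  \<comment> \<open>The auxiliary sequence has to satisfy only the step from 0 to 1; comparison with
    the true solution identifies its value at 1.\<close>
  have "inhom \<mu> f (\<lambda>t. if t = 0 then b else a) 0"
    by (simp add: inhom_def admissible_def b_def v_def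
        matrix_inv_vec[OF invertible_ctrans[OF P_inv]])
  then have "y 1 = a"
    using inhom_forward[of \<mu> f y 0] y by force
  then show ?thesis using y by blast
qed

text \<open>One step of the Lagrange identity: the terms with \<open>B\<close> and \<open>C\<close>
  cancel by Hermitian symmetry and only \<open>W\<close>-terms survive.\<close>

lemma bform_step:
  assumes "inhom \<mu> f y t" "inhom \<nu> g z t"
  shows "bform (y (Suc t)) (z (Suc t)) = bform (y t) (z t)
    + (\<mu> - cnj \<nu>) * cdot (fst (z (Suc t))) (W t *v fst (y (Suc t)))
    + cdot (fst (z (Suc t))) (W t *v f t) - cdot (g t) (W t *v fst (y (Suc t)))"
proof -
  obtain a b a' b' p q p' q' where
    [simp]: "y t = (a, b)" "y (Suc t) = (a', b')" "z t = (p, q)" "z (Suc t) = (p', q')"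
    by (meson surj_pair)
  have 1: "P t *v a' = a + B t *v b" "P t *v p' = p + B t *v q"
    and 2: "b' = C t *v a' - \<mu> *s (W t *v a') + ctrans (P t) *v b - W t *v f t"
    "q' = C t *v p' - \<nu> *s (W t *v p') + ctrans (P t) *v q - W t *v g t"
    using assms by (auto simp: inhom_def admissible_def)
  have "cdot p' (ctrans (P t) *v b) = cdot p b + cdot (B t *v q) b"
    by (simp add: cdot_ctrans 1 cdot_linear)
  moreover have "cdot (ctrans (P t) *v q) a' = cdot q a + cdot q (B t *v b)"
    by (metis 1(1) cdot_add_right cdot_matrix ctrans_ctrans)
  ultimately show ?thesis
    by (simp add: bform_alt 2 cdot_linear cdot_hermitian B_herm C_herm W_herm algebra_simps)
qed

text \<open>Summation by parts for one step. Only admissibility is asked of \<open>z\<close>, so the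
  identity serves both for the energy of \<open>y\<close> itself and for cross terms with
  variations.\<close>

lemma energy_step:
  assumes "inhom \<mu> f y t" "admissible z t"
  shows "cdot (snd (z t)) (B t *v snd (y t)) + cdot (fst (z (Suc t))) (C t *v fst (y (Suc t)))
    = cdot (fst (z (Suc t))) (snd (y (Suc t))) - cdot (fst (z t)) (snd (y t))
    + \<mu> * cdot (fst (z (Suc t))) (W t *v fst (y (Suc t)))
    + cdot (fst (z (Suc t))) (W t *v f t)"
proof -
  obtain a b a' b' p q p' q' where
    [simp]: "y t = (a, b)" "y (Suc t) = (a', b')" "z t = (p, q)" "z (Suc t) = (p', q')"
    by (meson surj_pair)
  have 1: "P t *v p' = p + B t *v q"
    and 2: "b' = C t *v a' - \<mu> *s (W t *v a') + ctrans (P t) *v b - W t *v f t"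
    using assms by (auto simp: inhom_def admissible_def)
  have "cdot p' (ctrans (P t) *v b) = cdot p b + cdot q (B t *v b)"
    by (simp add: cdot_ctrans 1 cdot_linear cdot_hermitian B_herm)
  then show ?thesis
    by (simp add: 2 cdot_linear algebra_simps)
qed

section \<open>Solutions with prescribed data at 0 and at 1\<close>

definition psi :: "complex \<Rightarrow> complex ^ 'n \<Rightarrow> 'n cseq" where
  "psi \<mu> c = (SOME y. y 0 = (0, c) \<and> (\<forall>t. inhom \<mu> (\<lambda>_. 0) y t))"

lemma psi_0: "psi \<mu> c 0 = (0, c)" and psi_sol: "inhom \<mu> (\<lambda>_. 0) (psi \<mu> c) t"
  using someI_ex[OF inhom_exists_0[of "(0, c)" "\<mu>" "\<lambda>_. 0"]]
  by (auto simp: psi_def)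

lemma psi_diff: "psi \<mu> (c - d) t = psi \<mu> c t - psi \<mu> d t"
proof -
  have "psi \<mu> (c - d) = (\<lambda>t. psi \<mu> c t - psi \<mu> d t)"
  proof (rule inhom_unique[where s = 0])
    show "\<forall>t. inhom \<mu> (\<lambda>_. 0) (\<lambda>t. psi \<mu> c t - psi \<mu> d t) t"
      using inhom_diff[OF psi_sol psi_sol] by simp
  qed (simp_all add: psi_sol psi_0)
  then show ?thesis by metis
qed

lemma psi_scaleR: "psi \<mu> (r *\<^sub>R c) t = r *\<^sub>R psi \<mu> c t"
proof -
  have "psi \<mu> (r *\<^sub>R c) = (\<lambda>t. pscale (of_real r) (psi \<mu> c t))"
  proof (rule inhom_unique[where s = 0])
    show "\<forall>t. inhom \<mu> (\<lambda>_. 0) (\<lambda>t. pscale (of_real r) (psi \<mu> c t)) t"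
      using inhom_pscale[OF psi_sol] by simp
  qed (simp_all add: psi_sol psi_0 pscale_of_real)
  then show ?thesis by (metis pscale_of_real)
qed

lemma psi_add: "psi \<mu> (c + d) t = psi \<mu> c t + psi \<mu> d t"
  using psi_diff[of \<mu> "c + d" d t] by (simp add: algebra_simps)

lemma psi_linear: "linear (\<lambda>c. fst (psi \<mu> c t))"
  by (intro linearI) (simp_all add: psi_scaleR psi_add)

definition sol :: "complex \<Rightarrow> 'n cpair \<Rightarrow> 'n cseq" where
  "sol \<mu> a = (SOME y. y 1 = a \<and> (\<forall>t. inhom \<mu> (\<lambda>_. 0) y t))"

lemma sol_1 [simp]: "sol \<mu> a 1 = a" "sol \<mu> a (Suc 0) = a"
  and sol_inhom: "inhom \<mu> (\<lambda>_. 0) (sol \<mu> a) t"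
  using someI_ex[OF inhom_exists_1[of a \<mu> "\<lambda>_. 0"]] by (auto simp: sol_def)

lemma sol_unique: "\<forall>t. inhom \<mu> (\<lambda>_. 0) y t \<Longrightarrow> y = sol \<mu> (y 1)"
  by (rule inhom_unique[where s = 1]) (auto simp: sol_inhom)

lemma sol_add: "sol \<mu> (a + b) t = sol \<mu> a t + sol \<mu> b t"
  using sol_unique[of \<mu> "\<lambda>t. sol \<mu> a t + sol \<mu> b t"] inhom_add[OF sol_inhom[of \<mu> a] sol_inhom[of \<mu> b]]
  by (simp add: fun_eq_iff)

lemma sol_pscale: "sol \<mu> (pscale c a) t = pscale c (sol \<mu> a t)"
  using sol_unique[of \<mu> "\<lambda>t. pscale c (sol \<mu> a t)"] inhom_pscale[OF sol_inhom[of \<mu> a], where c = c]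
  by (simp add: fun_eq_iff)

lemma sol_zero: "sol \<mu> 0 t = 0"
  using sol_add[of \<mu> 0 0 t] by simp

lemma sol_sum: "finite S \<Longrightarrow> sol \<mu> (\<Sum>i\<in>S. pscale (c i) (a i)) t = (\<Sum>i\<in>S. pscale (c i) (sol \<mu> (a i) t))"
  by (induction S rule: finite_induct) (simp_all add: sol_zero sol_add sol_pscale)

text \<open>\<open>Up\<close> and \<open>Uq\<close> are the u-blocks of the fundamental system whose
  values at t = 1 are (0; I) and (I; 0).\<close>

definition Up :: "complex \<Rightarrow> nat \<Rightarrow> complex ^ 'n ^ 'n" where
  "Up \<mu> t = matrix (\<lambda>c. fst (sol \<mu> (0, c) t))"

definition Uq :: "complex \<Rightarrow> nat \<Rightarrow> complex ^ 'n ^ 'n" where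
  "Uq \<mu> t = matrix (\<lambda>c. fst (sol \<mu> (c, 0) t))"

lemma fst_sol: "fst (sol \<mu> (a, b) t) = Uq \<mu> t *v a + Up \<mu> t *v b"
proof -
  have "sol \<mu> (0, c + d) t = sol \<mu> (0, c) t + sol \<mu> (0, d) t"
    "sol \<mu> (c + d, 0) t = sol \<mu> (c, 0) t + sol \<mu> (d, 0) t" for c d
    by (simp_all flip: sol_add)
  moreover have "sol \<mu> (0, r *s c) t = pscale r (sol \<mu> (0, c) t)"
    "sol \<mu> (r *s c, 0) t = pscale r (sol \<mu> (c, 0) t)" for c r
    using sol_pscale[of \<mu> r "(0, c)" t] sol_pscale[of \<mu> r "(c, 0)" t] by (simp_all add: pscale_def)
  ultimately have "Vector_Spaces.linear (*s) (*s) (\<lambda>c. fst (sol \<mu> (0, c) t))"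
    "Vector_Spaces.linear (*s) (*s) (\<lambda>c. fst (sol \<mu> (c, 0) t))"
    by (auto simp: Vector_Spaces.linear_iff vec.vector_space_axioms)
  then show ?thesis
    by (simp add: Up_def Uq_def matrix_works flip: fst_add sol_add)
qed

section \<open>The seminorm of \<open>W\<close> and square summability\<close>

definition qW :: "nat \<Rightarrow> complex ^ 'n \<Rightarrow> real" where
  "qW t x = Re (cdot x (W t *v x))"

lemma qW_nonneg: "0 \<le> qW t x"
  using W_pos by (simp add: qW_def nonneg_hermitian_def)

lemma W_form_le:
  "r > 0 \<Longrightarrow> cmod (cdot x (W t *v y)) \<le> (r * qW t x + qW t y / r) / 2"
  unfolding qW_def by (rule hermitian_PSD_Cauchy[OF W_pos])

lemma of_real_qW: "complex_of_real (qW t x) = cdot x (W t *v x)"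
  by (simp add: qW_def complex_eq_iff hermitian_Im_0 W_herm)

lemma qW_0_iff: "qW t x = 0 \<longleftrightarrow> W t *v x = 0"
  unfolding qW_def using nonneg_hermitian_null[OF W_pos] by auto

lemma qW_scale: "qW t (c *s x) = (cmod c)\<^sup>2 * qW t x"
proof -
  have "complex_of_real (qW t (c *s x)) = of_real ((cmod c)\<^sup>2 * qW t x)"
    using complex_norm_square[of c] by (simp add: of_real_qW vector_scalar_commute cdot_linear)
  then show ?thesis using of_real_eq_iff by blast
qed

lemma qW_add_le: "qW t (x + y) \<le> 2 * qW t x + 2 * qW t y"
proof -
  have "qW t (x + y) = qW t x + qW t y + Re (cdot x (W t *v y)) + Re (cdot y (W t *v x))"
    by (simp add: qW_def matrix_vector_right_distrib cdot_linear)
  also have "\<dots> \<le> 2 * qW t x + 2 * qW t y"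
    using W_form_le[of 1 x t y] W_form_le[of 1 y t x]
      complex_Re_le_cmod[of "cdot x (W t *v y)"] complex_Re_le_cmod[of "cdot y (W t *v x)"]
    by simp
  finally show ?thesis .
qed

lemma qW_diff_le: "qW t (x - y) \<le> 2 * qW t x + 2 * qW t y"
proof -
  have "x - y = x + (- 1) *s y" by (simp add: vec_eq_iff)
  moreover have "qW t ((- 1) *s y) = qW t y"
    unfolding qW_scale by simp
  ultimately show ?thesis using qW_add_le[of t x "(- 1) *s y"] by metis
qed

lemma l2W_iff: "y \<in> l2W W \<longleftrightarrow> summable (\<lambda>t. qW t (fst (y (Suc t))))"
  by (simp add: l2W_def qW_def)

lemma l2W_add:
  assumes "y \<in> l2W W" "z \<in> l2W W"
  shows "(\<lambda>t. y t + z t) \<in> l2W W"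
proof -
  have "summable (\<lambda>t. 2 * qW t (fst (y (Suc t))) + 2 * qW t (fst (z (Suc t))))"
    using assms by (intro summable_add summable_mult) (simp_all add: l2W_iff)
  then show ?thesis
    unfolding l2W_iff by (rule summable_comparison_test') (simp add: qW_nonneg qW_add_le)
qed

lemma l2W_pscale: "y \<in> l2W W \<Longrightarrow> (\<lambda>t. pscale c (y t)) \<in> l2W W"
  by (simp add: l2W_iff qW_scale summable_mult)

lemma l2W_zero: "(\<lambda>_. 0) \<in> l2W W"
  by (simp add: l2W_iff qW_def)

lemma l2W_diff:
  assumes "y \<in> l2W W" "z \<in> l2W W"
  shows "(\<lambda>t. y t - z t) \<in> l2W W"
proof -
  have "pscale (- 1) p = - p" for p :: "'n cpair"
    by (simp add: prod_eq_iff vec_eq_iff)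
  then show ?thesis
    using l2W_add[OF assms(1) l2W_pscale[OF assms(2), of "- 1"]] by simp
qed

lemma l2W_sum:
  "finite S \<Longrightarrow> (\<And>i. i \<in> S \<Longrightarrow> y i \<in> l2W W) \<Longrightarrow> (\<lambda>t. \<Sum>i\<in>S. pscale (c i) (y i t)) \<in> l2W W"
  by (induction S rule: finite_induct) (simp_all add: l2W_zero l2W_add l2W_pscale)

end

section \<open>Disconjugacy and the Picone identity\<close>

text \<open>The first Penrose equation alone forces the inverse. Since every \<open>B t\<close>
  turns out to be invertible, generalized zeros can be expressed by ordinary inverses.\<close>

lemma pinv_invertible:
  fixes M :: "complex ^ 'n ^ 'n"
  assumes "invertible M"
  shows "pinv M = matrix_inv M"
proof -
  have inv: "M ** matrix_inv M = mat 1" "matrix_inv M ** M = mat 1"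
    using matrix_inv_vec[OF assms] by (simp_all add: matrix_eq flip: matrix_vector_mul_assoc)
  have "X = matrix_inv M" if "M ** X ** M = M" for X
  proof -
    have "matrix_inv M ** (M ** X ** M) ** matrix_inv M = matrix_inv M ** M ** matrix_inv M"
      using that by simp
    then show ?thesis
      by (metis inv matrix_mul_assoc matrix_mul_lid matrix_mul_rid)
  qed
  moreover have "M ** matrix_inv M ** M = M" "matrix_inv M ** M ** matrix_inv M = matrix_inv M"
    by (simp_all add: inv)
  ultimately show ?thesis
    unfolding pinv_def by (intro the_equality) (auto simp: inv)
qed

lemma hermitian_matrix_inv:
  fixes M :: "complex ^ 'n ^ 'n"
  assumes "invertible M" "hermitian M"
  shows "cdot (matrix_inv M *v x) y = cdot x (matrix_inv M *v y)"
  by (metis assms cdot_hermitian matrix_inv_vec(1))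

locale disconjugate_system = hamiltonian_system A B C W
  for A B C W :: "nat \<Rightarrow> complex ^ 'n::finite ^ 'n" +
  fixes lam0 lam :: real
  assumes disconj: "disconjugate A B C W (complex_of_real lam0)"
    and normal: "identically_normal A B"
    and definite: "definiteness_condition A B C W"
    and lam_less: "lam < lam0"
begin

abbreviation (input) Bi :: "nat \<Rightarrow> complex ^ 'n ^ 'n" where
  "Bi t \<equiv> matrix_inv (B t)"

lemma B_inv: "invertible (B t)"
proof -
  have "w = 0" if "B t *v w = 0" for w
  proof -
    \<comment> \<open>The difference at t also reads the value at t + 1, which lies outside the
      singleton; that value is chosen so that the equation holds.\<close>
    let ?v = "\<lambda>s. if s = t then w else w - ctrans (A t) *v w"
    have "\<forall>a\<in>{t}. \<forall>b\<in>{t}. {a..b} \<subseteq> {t}" by simp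
    moreover have "\<forall>s\<in>{t}. fdiff ?v s = - (ctrans (A s) *v ?v s) \<and> B s *v ?v s = 0"
      using that by (simp add: fdiff_def)
    ultimately have "\<forall>s\<in>{t}. ?v s = 0"
      using normal unfolding identically_normal_def by blast
    then show ?thesis by simp
  qed
  then show ?thesis by (simp add: invertible_iff_kernel)
qed

lemma Bi_cancel [simp]: "B t *v (Bi t *v x) = x" "Bi t *v (B t *v x) = x"
  by (rule matrix_inv_vec[OF B_inv])+

lemma cdot_Bi: "cdot (Bi t *v x) y = cdot x (Bi t *v y)"
  by (rule hermitian_matrix_inv[OF B_inv B_herm])

text \<open>For a real parameter the factor \<open>\<mu> - cnj \<nu>\<close> in the Lagrange
  identity vanishes.\<close>

lemma bform_const:
  assumes "\<forall>t. inhom (complex_of_real l) (\<lambda>_. 0) y t" "\<forall>t. inhom (complex_of_real l) (\<lambda>_. 0) z t"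
  shows "bform (y t) (z t) = bform (y s) (z s)"
proof -
  have "bform (y t) (z t) = bform (y 0) (z 0)" for t
    by (induction t) (use bform_step[OF assms(1)[rule_format] assms(2)[rule_format]] in auto)
  then show ?thesis by metis
qed

text \<open>Such a solution already has its generalized zero at 0, so every later index must violate
  one of the defining conditions. The range condition always holds, as \<open>B t\<close> and
  \<open>P t\<close> are invertible; hence nonvanishing of u(t) forces the sign.\<close>

lemma disconjugate_positive:
  assumes sol: "\<forall>t. inhom (complex_of_real lam0) (\<lambda>_. 0) y t" and y0: "fst (y 0) = 0" "snd (y 0) \<noteq> 0"
  shows "fst (y (Suc t)) \<noteq> 0"
    and "0 < Re (cdot (fst (y (Suc t))) (Bi (Suc t) *v fst (y (Suc t))))
           + Re (cdot (fst (y (Suc t))) (snd (y (Suc t))))"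
proof -
  have P_step: "P t *v fst (y (Suc t)) = fst (y t) + B t *v snd (y t)" for t
    using sol by (auto simp: inhom_def admissible_def)
  have pos: "0 < Re (cdot (fst (y t)) (Bi t *v fst (y t))) + Re (cdot (fst (y t)) (snd (y t)))"
    if ne: "fst (y t) \<noteq> 0" for t
  proof (rule ccontr)
    assume neg: "\<not> ?thesis"
    have e: "cdot (fst (y t)) ((pinv (B t) ** (mat 1 - A t)) *v fst (y (Suc t)))
        = cdot (fst (y t)) (Bi t *v fst (y t)) + cdot (fst (y t)) (snd (y t))"
    proof -
      have "(pinv (B t) ** (mat 1 - A t)) *v fst (y (Suc t)) = Bi t *v (P t *v fst (y (Suc t)))"
        by (simp add: pinv_invertible B_inv P_def matrix_vector_mul_assoc)
      then show ?thesis
        by (simp add: P_step matrix_vector_right_distrib cdot_linear)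
    qed
    \<comment> \<open>Vanishing of u(0) makes the constant form zero. This yields the reality that
      membership in the nonpositive reals demands.\<close>
    have "bform (y t) (y t) = 0"
      using bform_const[OF sol sol, of t 0] y0 by (simp add: bform_alt)
    then have "Im (cdot (fst (y t)) (snd (y t))) = 0"
      by (metis bform_alt cnj_cdot cnj.simps(2) eq_iff_diff_eq_0 neg_equal_zero)
    moreover have "Im (cdot (fst (y t)) (Bi t *v fst (y t))) = 0"
      by (metis cdot_Bi cnj_cdot cnj.simps(2) neg_equal_zero)
    ultimately have "cdot (fst (y t)) ((pinv (B t) ** (mat 1 - A t)) *v fst (y (Suc t))) \<in> \<real>\<^sub>\<le>\<^sub>0"
      using neg by (simp add: e complex_nonpos_Reals_iff)
    moreover have "fst (y (Suc t)) \<in> range (\<lambda>w. (Atilde A t ** B t) *v w)"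
    proof (rule range_eqI)
      show "fst (y (Suc t)) = (Atilde A t ** B t) *v (Bi t *v (P t *v fst (y (Suc t))))"
        using matrix_inv_vec[OF P_inv, of t]
        by (simp add: Atilde_def P_def flip: matrix_vector_mul_assoc)
    qed
    ultimately have "generalized_zero A B y (Suc t)"
      using ne by (simp add: generalized_zero_def)
    moreover have "generalized_zero A B y 0"
      using y0 by (simp add: generalized_zero_def)
    ultimately show False
      using disconj sol by (auto simp: disconjugate_def solution_iff)
  qed
  have nonzero: "fst (y (Suc t)) \<noteq> 0" for t
  proof (induction t)
    case 0
    show ?case
    proof
      assume "fst (y (Suc 0)) = 0"
      then have "B 0 *v snd (y 0) = 0"
        using P_step[of 0] y0 by simp
      then show False using y0 B_inv by (metis invertible_iff_kernel)
    qed
  next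
    case (Suc t)
    show ?case
    proof
      assume "fst (y (Suc (Suc t))) = 0"
      \<comment> \<open>If the next u-value were zero, the quantity just shown to be positive would
        be zero.\<close>
      then have "Bi (Suc t) *v (fst (y (Suc t)) + B (Suc t) *v snd (y (Suc t))) = 0"
        by (simp flip: P_step)
      then have "cdot (fst (y (Suc t))) (Bi (Suc t) *v fst (y (Suc t)))
          + cdot (fst (y (Suc t))) (snd (y (Suc t))) = 0"
        by (simp add: matrix_vector_right_distrib flip: cdot_add_right)
      then show False
        using pos[OF Suc] by (metis less_irrefl plus_complex.simps(1) zero_complex.simps(1))
    qed
  qed
  show "fst (y (Suc t)) \<noteq> 0" by (rule nonzero)
  show "0 < Re (cdot (fst (y (Suc t))) (Bi (Suc t) *v fst (y (Suc t))))
           + Re (cdot (fst (y (Suc t))) (snd (y (Suc t))))"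
    by (rule pos[OF nonzero])
qed

abbreviation (input) psi0 :: "complex ^ 'n \<Rightarrow> 'n cseq" where
  "psi0 \<equiv> psi (complex_of_real lam0)"

lemma psi_surj: "\<exists>c. fst (psi0 c (Suc t)) = u"
proof -
  have lin: "linear (\<lambda>c. fst (psi0 c (Suc t)))"
    by (rule psi_linear)
  have "inj (\<lambda>c. fst (psi0 c (Suc t)))"
    unfolding linear_injective_0[OF lin]
  proof (intro allI impI)
    fix c assume "fst (psi0 c (Suc t)) = 0"
    moreover have "\<forall>t. inhom (complex_of_real lam0) (\<lambda>_. 0) (psi0 c) t" by (simp add: psi_sol)
    ultimately show "c = 0"
      using disconjugate_positive(1)[of "psi0 c" t] psi_0[of _ c] by (metis fst_conv snd_conv)
  qed
  with lin have "surj (\<lambda>c. fst (psi0 c (Suc t)))"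
    by (rule linear_inj_imp_surj)
  then obtain c where "u = fst (psi0 c (Suc t))" by (rule surjE)
  then show ?thesis by blast
qed

text \<open>The integrand of the quadratic functional without its spectral term, so that one notion
  serves all parameters.\<close>

definition energy :: "'n cseq \<Rightarrow> nat \<Rightarrow> real" where
  "energy y t = Re (cdot (snd (y t)) (B t *v snd (y t)))
     + Re (cdot (fst (y (Suc t))) (C t *v fst (y (Suc t))))"

text \<open>Discrete Picone identity with the coefficient c in place of a Riccati variable: u is
  written as the value of a principal solution with varying c. The last two terms form the
  remainder, which \<open>disconjugate_positive\<close> controls through the change
  \<open>c' - c\<close>.\<close>

lemma Picone_step:
  assumes adm: "admissible y t" and c: "fst (y t) = fst (psi0 c t)" "fst (y (Suc t)) = fst (psi0 c' (Suc t))"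
  shows "energy y t - lam0 * qW t (fst (y (Suc t)))
    = Re (cdot (fst (y (Suc t))) (snd (psi0 c' (Suc t)))) - Re (cdot (fst (y t)) (snd (psi0 c t)))
      + Re (cdot (fst (psi0 (c' - c) t)) (Bi t *v fst (psi0 (c' - c) t)))
      + Re (cdot (fst (psi0 (c' - c) t)) (snd (psi0 (c' - c) t)))"
proof -
  obtain a b a' b' p q v where
    [simp]: "psi0 c' t = (a, b)" "psi0 c' (Suc t) = (a', b')" "psi0 (c' - c) t = (p, q)" "snd (y t) = v"
    by (meson surj_pair)
  have [simp]: "psi0 c t = (a - p, b - q)"
    using psi_diff[of "complex_of_real lam0" c' c t] by (simp add: prod_eq_iff algebra_simps)
  have [simp]: "fst (y t) = a - p" "fst (y (Suc t)) = a'"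
    using c by auto
  have Pa: "P t *v a' = a + B t *v b"
    and b': "b' = C t *v a' - complex_of_real lam0 *s (W t *v a') + ctrans (P t) *v b"
    using psi_sol[of "complex_of_real lam0" c' t] by (auto simp: inhom_def admissible_def)
  \<comment> \<open>Both sequences have the same u(t+1), so the gap p between their u(t) must be
    compensated by the v-parts.\<close>
  have "B t *v v = B t *v b + p"
    using adm Pa by (simp add: admissible_def algebra_simps)
  then have Bv: "B t *v v = B t *v b + p" and v: "v = b + Bi t *v p"
    using Bi_cancel(2)[of t v] by (simp_all add: matrix_vector_right_distrib)
  have aPb: "cdot a' (ctrans (P t) *v b) = cdot a b + cdot b (B t *v b)"
    by (simp add: cdot_ctrans Pa cdot_linear cdot_hermitian B_herm)
  \<comment> \<open>All principal solutions have u(0) = 0 and are mutually isotropic; this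
    symmetrises the mixed term.\<close>
  have "bform (psi0 c' t) (psi0 (c' - c) t) = 0"
    using bform_const[of lam0 "psi0 c'" "psi0 (c' - c)" t 0] psi_sol by (simp add: psi_0 bform_alt)
  then have aq: "Re (cdot a q) = Re (cdot p b)"
    by (simp add: bform_alt) (metis Re_cdot_commute)
  have "cdot a' (C t *v a') - lam0 * cdot a' (W t *v a') = cdot a' b' - cdot a b - cdot b (B t *v b)"
    by (simp add: b' cdot_linear aPb)
  then have 1: "Re (cdot a' (C t *v a')) - lam0 * qW t a'
      = Re (cdot a' b') - Re (cdot a b) - Re (cdot b (B t *v b))"
    unfolding qW_def by (auto simp: complex_eq_iff)
  have "cdot v (B t *v v) = cdot b (B t *v b) + cdot b p + cdot p b + cdot p (Bi t *v p)"
    by (simp add: Bv) (simp add: v cdot_linear cdot_Bi)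
  then have 2: "Re (cdot v (B t *v v)) = Re (cdot b (B t *v b)) + 2 * Re (cdot p b) + Re (cdot p (Bi t *v p))"
    using Re_cdot_commute[of b p] by simp
  show ?thesis
    using 1 2 aq by (simp add: energy_def cdot_linear)
qed

text \<open>Summing the Picone identity leaves only nonnegative remainders. If they all vanish, the
  coefficient is constant; u(N) = 0 then forces it to be zero, since a nontrivial principal solution
  does not vanish after 0.\<close>

lemma key_inequality:
  assumes adm: "\<And>t. admissible y t" and bc: "fst (y 0) = 0" "fst (y N) = 0"
  shows "lam0 * (\<Sum>t<N. qW t (fst (y (Suc t)))) \<le> (\<Sum>t<N. energy y t)"
    and "(\<Sum>t<N. energy y t) \<le> lam0 * (\<Sum>t<N. qW t (fst (y (Suc t)))) \<Longrightarrow> t \<le> N \<Longrightarrow> fst (y t) = 0"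
proof -
  have "\<forall>t. \<exists>c. fst (psi0 c (Suc t)) = fst (y (Suc t))"
    using psi_surj by blast
  then obtain c0 where c0: "\<And>t. fst (psi0 (c0 t) (Suc t)) = fst (y (Suc t))"
    by (auto dest!: choice)
  \<comment> \<open>Truncated subtraction gives \<open>c 0 = c 1\<close>. This is legitimate because
    every principal solution has u(0) = 0, and it removes the remainder at 0.\<close>
  define c where "c t = c0 (t - 1)" for t
  have c: "fst (psi0 (c t) t) = fst (y t)" for t
    using c0[of "t - 1"] bc by (cases t) (auto simp: c_def psi_0)
  define d where "d t = psi0 (c (Suc t) - c t) t" for t
  define g where "g t = Re (cdot (fst (d t)) (Bi t *v fst (d t))) + Re (cdot (fst (d t)) (snd (d t)))" for t
  have sum: "(\<Sum>t<n. energy y t - lam0 * qW t (fst (y (Suc t))))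
      = Re (cdot (fst (y n)) (snd (psi0 (c n) n))) + (\<Sum>t<n. g t)" for n
    by (induction n) (use Picone_step[OF adm c[symmetric] c[symmetric]] bc in \<open>auto simp: d_def g_def\<close>)
  have g0: "g 0 = 0"
    by (simp add: g_def d_def psi_0 c_def)
  have gpos: "0 < g (Suc t)" if "c (Suc (Suc t)) \<noteq> c (Suc t)" for t
    unfolding g_def d_def
    by (rule disconjugate_positive(2)) (use that in \<open>auto simp: psi_0 psi_sol\<close>)
  have gz: "g t = 0" if "c (Suc t) = c t" for t
    using that psi_diff[of _ "c t" "c t" t] by (simp add: g_def d_def)
  have gnn: "0 \<le> g t" for t
    using g0 gpos gz by (metis less_eq_real_def not0_implies_Suc)
  have eq: "(\<Sum>t<N. energy y t) - lam0 * (\<Sum>t<N. qW t (fst (y (Suc t)))) = (\<Sum>t<N. g t)"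
    using sum[of N] bc by (simp add: sum_subtractf sum_distrib_left)
  show "lam0 * (\<Sum>t<N. qW t (fst (y (Suc t)))) \<le> (\<Sum>t<N. energy y t)"
    using eq sum_nonneg[of "{..<N}" g] gnn by simp
  assume "(\<Sum>t<N. energy y t) \<le> lam0 * (\<Sum>t<N. qW t (fst (y (Suc t))))" "t \<le> N"
  then have "(\<Sum>t<N. g t) = 0"
    using eq sum_nonneg[of "{..<N}" g] gnn by simp
  then have "g t = 0" if "t < N" for t
    using that gnn by (simp add: sum_nonneg_eq_0_iff)
  then have step: "c (Suc t) = c t" if "t < N" for t
    using that gpos by (cases t) (force simp: c_def)+
  have c_0: "c t = c 0" if "t \<le> N" for t
    using that by (induction t) (auto simp: step)
  have c_eq: "c t = c N" if "t \<le> N" for t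
    by (simp only: c_0[OF that] c_0[OF order_refl])
  show "fst (y t) = 0"
  proof (cases "t = 0")
    case False
    then have "N > 0" using \<open>t \<le> N\<close> by simp
    then obtain k where "N = Suc k" by (cases N) auto
    have "c N = 0"
    proof (rule ccontr)
      assume "c N \<noteq> 0"
      then have "fst (psi0 (c N) (Suc k)) \<noteq> 0"
        by (intro disconjugate_positive(1)) (auto simp: psi_sol psi_0)
      then show False using c[of N] bc \<open>N = Suc k\<close> by simp
    qed
    moreover have "psi0 0 t = 0"
      using psi_diff[of "complex_of_real lam0" 0 0 t] by simp
    ultimately show ?thesis
      using c[of t] c_eq[OF \<open>t \<le> N\<close>] by simp
  qed (use bc in simp)
qed

end

section \<open>The recessive solution\<close>

lemma tendsto_matrix_vector_mult:
  fixes X :: "'b \<Rightarrow> complex ^ 'n ^ 'm"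
  assumes "(X \<longlongrightarrow> X') F" "(y \<longlongrightarrow> y') F"
  shows "((\<lambda>t. X t *v y t) \<longlongrightarrow> X' *v y') F"
  unfolding matrix_vector_mult_def
  by (intro vec_tendstoI) (simp, intro tendsto_intros tendsto_vec_nth assms)

lemma tendsto_cdot:
  assumes "(x \<longlongrightarrow> x') F" "(y \<longlongrightarrow> y') F"
  shows "((\<lambda>t. cdot (x t) (y t)) \<longlongrightarrow> cdot x' y') F"
  unfolding cdot_def
  by (intro tendsto_intros tendsto_vec_nth assms)

text \<open>A crude bound for the operator norm, chosen because it depends continuously on the
  entries.\<close>

definition entry_sum :: "complex ^ 'n ^ 'm \<Rightarrow> real" where
  "entry_sum M = (\<Sum>i\<in>UNIV. \<Sum>j\<in>UNIV. cmod (M $ i $ j))"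

lemma norm_matrix_vector_le: "norm (M *v x) \<le> entry_sum M * norm x"
proof -
  have "norm (M *v x) \<le> (\<Sum>i\<in>UNIV. norm ((M *v x) $ i))"
    by (simp add: norm_vec_def L2_set_le_sum)
  also have "\<dots> \<le> (\<Sum>i\<in>UNIV. \<Sum>j\<in>UNIV. cmod (M $ i $ j) * norm x)"
  proof (rule sum_mono)
    fix i
    have "norm ((M *v x) $ i) \<le> (\<Sum>j\<in>UNIV. norm (M $ i $ j * x $ j))"
      by (simp add: matrix_vector_mult_def norm_sum)
    also have "\<dots> \<le> (\<Sum>j\<in>UNIV. cmod (M $ i $ j) * norm x)"
      by (intro sum_mono) (simp add: norm_mult mult_left_mono Finite_Cartesian_Product.norm_nth_le)
    finally show "norm ((M *v x) $ i) \<le> (\<Sum>j\<in>UNIV. cmod (M $ i $ j) * norm x)" .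
  qed
  finally show ?thesis
    by (simp add: entry_sum_def sum_distrib_right)
qed

lemma tendsto_entry_sum_0:
  fixes X :: "'b \<Rightarrow> complex ^ 'n ^ 'm"
  assumes "(X \<longlongrightarrow> 0) F"
  shows "((\<lambda>t. entry_sum (X t)) \<longlongrightarrow> 0) F"
proof -
  have "((\<lambda>t. entry_sum (X t)) \<longlongrightarrow> entry_sum (0 :: complex ^ 'n ^ 'm)) F"
    unfolding entry_sum_def by (intro tendsto_intros tendsto_vec_nth assms)
  then show ?thesis by (simp add: entry_sum_def)
qed

lemma tendsto_matrix_mult_right:
  fixes X :: "'b \<Rightarrow> complex ^ 'n ^ 'm" and Y :: "complex ^ 'm ^ 'k"
  assumes "(X \<longlongrightarrow> X') F"
  shows "((\<lambda>t. Y ** X t) \<longlongrightarrow> Y ** X') F"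
  unfolding matrix_matrix_mult_def
  by (intro vec_tendstoI) (simp, intro tendsto_intros tendsto_vec_nth assms)

lemma matrix_vector_axis: "(M *v axis j 1) $ i = M $ i $ j" for M :: "complex ^ 'n ^ 'm"
  by (simp add: matrix_vector_mult_def axis_def if_distrib cong: if_cong)

lemma minus_matrix_vector: "(- M) *v x = - (M *v x)" for M :: "complex ^ 'n ^ 'm"
  by (simp add: matrix_vector_mult_def vec_eq_iff sum_negf)

lemma matrix_vector_minus: "M *v (- x) = - (M *v x)" for M :: "complex ^ 'n ^ 'm"
  by (simp add: matrix_vector_mult_def vec_eq_iff sum_negf)

lemma matrix_nth_cdot: "M $ i $ j = cdot (axis i 1) (M *v axis j 1)"
  for M :: "complex ^ 'n ^ 'm"
  by (simp add: cdot_axis matrix_vector_axis)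

text \<open>Reduces convergence of matrix entries to convergence of quadratic forms. The sign before
  \<open>\<i>\<close> reflects conjugate linearity in the first argument.\<close>

lemma cdot_polarization:
  fixes M :: "complex ^ 'n ^ 'n"
  shows "4 * cdot x (M *v y) = cdot (x + y) (M *v (x + y)) - cdot (x - y) (M *v (x - y))
    - \<i> * (cdot (x + \<i> *s y) (M *v (x + \<i> *s y)) - cdot (x - \<i> *s y) (M *v (x - \<i> *s y)))"
  by (simp add: cdot_linear matrix_vector_right_distrib matrix_vector_mult_diff_distrib
      vector_scalar_commute algebra_simps)

context disconjugate_system
begin

section \<open>The quadratic functional on truncated solutions\<close>

abbreviation (input) Lam :: complex where
  "Lam \<equiv> complex_of_real lam"

text \<open>The value at \<open>0\<close> is the admissible extension to \<open>u(0) = 0\<close>; it exists because \<open>B(0)\<close> is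
  invertible.\<close>

definition cut :: "'n cseq \<Rightarrow> nat \<Rightarrow> 'n cseq" where
  "cut y N t = (if t = 0 then (0, Bi 0 *v (P 0 *v fst (y 1))) else if t < N then y t else 0)"

text \<open>Contribution of the step from 0 to 1 when u(0) = 0 and u(1) = e. It depends on e alone
  and hence bounds all truncations at once.\<close>

definition kappa :: "complex ^ 'n \<Rightarrow> real" where
  "kappa e = Re (cdot (Bi 0 *v (P 0 *v e)) (P 0 *v e)) + Re (cdot e (C 0 *v e)) - lam * qW 0 e"

definition action :: "'n cseq \<Rightarrow> nat \<Rightarrow> real" where
  "action y N = (\<Sum>t<N. energy y t - lam * qW t (fst (y (Suc t))))"

text \<open>Replacing the value at N by zero discards v(N), but the step into N reads only u(N),
  which is zero already.\<close>

lemma cut_admissible: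
  assumes "\<forall>t. inhom Lam (\<lambda>_. 0) y t" "2 \<le> N" "fst (y N) = 0"
  shows "admissible (cut y N) t"
proof -
  have adm: "admissible y t" for t using assms(1) by (simp add: inhom_def)
  consider "t = 0" | "t \<noteq> 0" "Suc t < N" | "t \<noteq> 0" "Suc t = N" | "N \<le> t"
    by linarith
  then show ?thesis
  proof cases
    case 3
    then show ?thesis using adm[of t] assms by (auto simp: admissible_def cut_def)
  qed (use adm[of t] assms in \<open>auto simp: admissible_def cut_def\<close>)
qed

lemma fst_cut:
  assumes "fst (y N) = 0" "t < N"
  shows "fst (cut y N (Suc t)) = fst (y (Suc t))"
proof (cases "Suc t < N")
  case False
  then have "N = Suc t" using assms by simp
  then show ?thesis using assms by (simp add: cut_def)
qed (simp add: cut_def)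

text \<open>From index 1 on, the summands are differences of u*(t) v(t) and telescope; u(N) = 0
  removes the right boundary term, and the step at 0 gives \<open>kappa\<close>.\<close>

lemma cut_action:
  assumes sol: "\<forall>t. inhom Lam (\<lambda>_. 0) y t" and "2 \<le> N" "fst (y N) = 0"
  shows "action (cut y N) N = kappa (fst (y 1)) - Re (cdot (fst (y 1)) (snd (y 1)))"
proof -
  let ?g = "\<lambda>t. energy (cut y N) t - lam * qW t (fst (cut y N (Suc t)))"
  let ?b = "\<lambda>t. Re (cdot (fst (y t)) (snd (y t)))"
  obtain n where n: "N = Suc n" "1 \<le> n" using assms(2) by (cases N) auto
  have g0: "?g 0 = kappa (fst (y 1))"
    using assms fst_cut[of y N 0] by (simp add: energy_def cut_def kappa_def)
  have g: "?g (Suc t) = ?b (Suc (Suc t)) - ?b (Suc t)" if "Suc t < N" for t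
  proof -
    have "inhom Lam (\<lambda>_. 0) y (Suc t)" using sol by blast
    then have "admissible y (Suc t)" by (simp add: inhom_def)
    from energy_step[OF \<open>inhom Lam (\<lambda>_. 0) y (Suc t)\<close> this]
    have "energy y (Suc t) - lam * qW (Suc t) (fst (y (Suc (Suc t)))) = ?b (Suc (Suc t)) - ?b (Suc t)"
      unfolding energy_def qW_def by (auto simp: complex_eq_iff)
    then show ?thesis
      using fst_cut[of y N "Suc t", OF assms(3) that] that by (simp add: energy_def cut_def)
  qed
  have "action (cut y N) N = ?g 0 + (\<Sum>t<n. ?g (Suc t))"
    unfolding action_def n(1) by (rule sum.lessThan_Suc_shift)
  also have "(\<Sum>t<n. ?g (Suc t)) = (\<Sum>t<n. ?b (Suc (Suc t)) - ?b (Suc t))"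
    by (intro sum.cong refl g) (simp add: n)
  also have "\<dots> = ?b N - ?b 1"
    using sum_lessThan_telescope[of "\<lambda>t. ?b (Suc t)" n] by (simp add: n)
  finally show ?thesis
    using assms(3) g0 by simp
qed

lemma action_bound:
  assumes "\<And>t. admissible y t" "fst (y 0) = 0" "fst (y N) = 0"
  shows "(lam0 - lam) * (\<Sum>t<N. qW t (fst (y (Suc t)))) \<le> action y N"
  using key_inequality(1)[OF assms]
  by (simp add: action_def sum_subtractf left_diff_distrib flip: sum_distrib_left)

lemma action_nonneg:
  assumes "\<And>t. admissible y t" "fst (y 0) = 0" "fst (y N) = 0"
  shows "0 \<le> action y N"
proof -
  have "0 \<le> (lam0 - lam) * (\<Sum>t<N. qW t (fst (y (Suc t))))"
    using lam_less by (intro mult_nonneg_nonneg sum_nonneg qW_nonneg) simp_all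
  then show ?thesis using action_bound[OF assms] by simp
qed

text \<open>Zero action forces the \<open>W\<close>-sum to vanish because of the gap
  \<open>lam0 - lam\<close>; this is the equality case of \<open>key_inequality\<close>.\<close>

lemma action_0:
  assumes "\<And>t. admissible y t" "fst (y 0) = 0" "fst (y N) = 0" "action y N = 0" "t \<le> N"
  shows "fst (y t) = 0"
proof (rule key_inequality(2)[OF assms(1-3) _ assms(5)])
  have "(lam0 - lam) * (\<Sum>t<N. qW t (fst (y (Suc t)))) \<le> 0"
    using action_bound[OF assms(1-3)] assms(4) by simp
  then have "(\<Sum>t<N. qW t (fst (y (Suc t)))) \<le> 0"
    using lam_less by (simp add: mult_le_0_iff)
  then have "(\<Sum>t<N. qW t (fst (y (Suc t)))) = 0"
    using sum_nonneg[of "{..<N}" "\<lambda>t. qW t (fst (y (Suc t)))"] qW_nonneg by fastforce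
  then show "(\<Sum>t<N. energy y t) \<le> lam0 * (\<Sum>t<N. qW t (fst (y (Suc t))))"
    using assms(4) by (simp add: action_def sum_subtractf flip: sum_distrib_left)
qed

text \<open>A kernel vector gives a solution vanishing at 1 and at N, whose truncation has zero
  action and therefore vanishes.\<close>

lemma Up_invertible:
  assumes "2 \<le> N"
  shows "invertible (Up Lam N)"
proof -
  have "c = 0" if "Up Lam N *v c = 0" for c
  proof -
    let ?y = "sol Lam (0, c)"
    have sol: "\<forall>t. inhom Lam (\<lambda>_. 0) ?y t" by (simp add: sol_inhom)
    have N: "fst (?y N) = 0" using that by (simp add: fst_sol)
    have "action (cut ?y N) N = 0"
      using cut_action[OF sol assms N] by (simp add: kappa_def qW_def)
    moreover have "fst (cut ?y N 0) = 0" "fst (cut ?y N N) = 0" "Suc 1 \<le> N"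
      using assms by (simp_all add: cut_def)
    ultimately have "fst (cut ?y N (Suc 1)) = 0"
      using action_0[OF cut_admissible[OF sol assms N]] by blast
    \<comment> \<open>Index 2 carries the information: u(1) = u(2) = 0 leaves \<open>B 1\<close>
      applied to c equal to zero.\<close>
    then have "fst (?y (Suc 1)) = 0"
      using fst_cut[of ?y N 1, OF N] assms by simp
    moreover have "admissible ?y 1" using sol by (simp add: inhom_def)
    ultimately have "B 1 *v c = 0" by (simp add: admissible_def)
    then show "c = 0" using B_inv by (metis invertible_iff_kernel)
  qed
  then show ?thesis by (simp add: invertible_iff_kernel)
qed

text \<open>The matrix M solving Uq(N) + Up(N) M = 0, that is, the v-block at 1 of the solution
  equal to I at 1 and vanishing at N. It has this meaning for N at least 2.\<close>

definition M_approx :: "nat \<Rightarrow> complex ^ 'n ^ 'n" where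
  "M_approx N = - (matrix_inv (Up Lam N) ** Uq Lam N)"

lemma Uq_eq: "2 \<le> N \<Longrightarrow> Uq Lam N *v e = - (Up Lam N *v (M_approx N *v e))"
proof -
  assume "2 \<le> N"
  have "M_approx N *v e = - (matrix_inv (Up Lam N) *v (Uq Lam N *v e))"
    by (simp add: M_approx_def minus_matrix_vector matrix_vector_mul_assoc)
  then show ?thesis
    using matrix_inv_vec(1)[OF Up_invertible[OF \<open>2 \<le> N\<close>]]
    by (simp add: matrix_vector_minus)
qed

section \<open>Monotone approximation of the recessive initial value\<close>

abbreviation (input) yN :: "nat \<Rightarrow> complex ^ 'n \<Rightarrow> 'n cseq" where
  "yN N e \<equiv> sol Lam (e, M_approx N *v e)"

lemma yN_N: "2 \<le> N \<Longrightarrow> fst (yN N e N) = 0"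
  by (simp add: fst_sol Uq_eq)

lemma yN_inhom: "\<forall>t. inhom Lam (\<lambda>_. 0) (yN N e) t"
  by (simp add: sol_inhom)

text \<open>The constant form of two such solutions is zero at N, where both u-parts vanish;
  evaluated at 1 it is the asymmetry of \<open>M_approx N\<close>.\<close>

lemma M_approx_symmetric:
  assumes "2 \<le> N"
  shows "cdot (M_approx N *v x) y = cdot x (M_approx N *v y)"
proof -
  have "bform (yN N y N) (yN N x N) = 0"
    by (simp add: bform_alt yN_N assms)
  then have "bform (yN N y 1) (yN N x 1) = 0"
    using bform_const[OF yN_inhom yN_inhom] by metis
  then show ?thesis by (simp add: bform_alt)
qed

lemma action_yN:
  assumes "2 \<le> N"
  shows "action (cut (yN N e) N) N = kappa e - Re (cdot e (M_approx N *v e))"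
  using cut_action[OF yN_inhom assms yN_N[OF assms], of e] by simp

lemma cut_yN_admissible: "2 \<le> N \<Longrightarrow> admissible (cut (yN N e) N) t"
  by (intro cut_admissible yN_inhom yN_N)

lemma cut_beyond: "2 \<le> N \<Longrightarrow> N \<le> t \<Longrightarrow> cut y N t = 0"
  by (simp add: cut_def)

lemma action_extend:
  assumes "2 \<le> N"
  shows "action (cut y N) (Suc N) = action (cut y N) N"
  using assms by (simp add: action_def energy_def cut_beyond qW_def)

text \<open>The truncation at N competes with the one at N + 1 and has the same u(1). The latter
  minimises the action, and the action is \<open>kappa\<close> minus the quadratic form, so the form
  grows with N.\<close>

lemma M_approx_mono:
  assumes N: "2 \<le> N"
  shows "Re (cdot e (M_approx N *v e)) \<le> Re (cdot e (M_approx (Suc N) *v e))"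
proof -
  let ?N = "Suc N"
  define y where "y = yN ?N e"
  define z1 where "z1 = cut (yN N e) N"
  define z2 where "z2 = cut y ?N"
  define w where "w t = z1 t - z2 t" for t
  have yN': "fst (y ?N) = 0" using N yN_N[of ?N e] by (simp add: y_def)
  have adm1: "admissible z1 t" and adm2: "admissible z2 t" for t
    using N cut_yN_admissible[of N e] cut_yN_admissible[of ?N e] by (simp_all add: z1_def z2_def y_def)
  have adm: "admissible w t" for t
    using adm1[of t] adm2[of t] by (simp add: admissible_def w_def matrix_vector_mult_diff_distrib)
  have w0: "w 0 = 0" and w1: "fst (w 1) = 0" and wN: "fst (w ?N) = 0"
    using N by (simp_all add: w_def z1_def z2_def cut_def y_def)
  \<comment> \<open>Expansion about the minimiser: the excess is the action of the variation
    \<open>w\<close> plus twice a cross term.\<close>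
  have expand: "energy z1 t - lam * qW t (fst (z1 (Suc t)))
     = (energy z2 t - lam * qW t (fst (z2 (Suc t)))) + (energy w t - lam * qW t (fst (w (Suc t))))
       + 2 * Re (cdot (snd (w t)) (B t *v snd (z2 t)) + cdot (fst (w (Suc t))) (C t *v fst (z2 (Suc t)))
            - Lam * cdot (fst (w (Suc t))) (W t *v fst (z2 (Suc t))))" for t
  proof -
    have q: "Re (cdot (x + v) (X *v (x + v))) = Re (cdot x (X *v x)) + Re (cdot v (X *v v))
        + 2 * Re (cdot v (X *v x))" if "hermitian X" for X x v
    proof -
      have "Re (cdot x (X *v v)) = Re (cdot v (X *v x))"
        using that by (metis Re_cdot_commute cdot_hermitian)
      then show ?thesis by (simp add: matrix_vector_right_distrib cdot_linear)
    qed
    have z1: "fst (z1 t) = fst (z2 t) + fst (w t)" "snd (z1 t) = snd (z2 t) + snd (w t)" for t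
      by (simp_all add: w_def)
    show ?thesis
      unfolding energy_def qW_def z1 q[OF B_herm] q[OF C_herm] q[OF W_herm]
      by (simp add: algebra_simps)
  qed
  let ?b = "\<lambda>t. Re (cdot (fst (w t)) (snd (y t)))"
  \<comment> \<open>At t = 0 the variation has v(0) = 0 and u(1) = 0; afterwards the cut-off
    sequence has the relevant parts of the true solution, and the term becomes a telescoping
    difference.\<close>
  have cross: "Re (cdot (snd (w t)) (B t *v snd (z2 t)) + cdot (fst (w (Suc t))) (C t *v fst (z2 (Suc t)))
            - Lam * cdot (fst (w (Suc t))) (W t *v fst (z2 (Suc t))))
            = (if t = 0 then 0 else ?b (Suc t) - ?b t)" if "t < ?N" for t
  proof (cases "t = 0")
    case True
    then show ?thesis using w0 w1 by simp
  next
    case False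
    have "inhom Lam (\<lambda>_. 0) y t" by (simp add: y_def sol_inhom)
    from energy_step[OF this adm] False that fst_cut[of y ?N t, OF yN' that]
    show ?thesis by (simp add: z2_def cut_def)
  qed
  define X where "X t = Re (cdot (snd (w t)) (B t *v snd (z2 t)) + cdot (fst (w (Suc t))) (C t *v fst (z2 (Suc t)))
            - Lam * cdot (fst (w (Suc t))) (W t *v fst (z2 (Suc t))))" for t
  have "action z1 ?N = action z2 ?N + action w ?N + 2 * (\<Sum>t<?N. X t)"
    unfolding action_def expand X_def[symmetric] sum.distrib sum_distrib_left by simp
  also have "(\<Sum>t<?N. X t) = (\<Sum>t<?N. if t = 0 then 0 else ?b (Suc t) - ?b t)"
    by (intro sum.cong refl) (unfold X_def, rule cross, simp)
  also have "(\<Sum>t<?N. if t = 0 then 0 else ?b (Suc t) - ?b t) = (\<Sum>t<N. ?b (Suc (Suc t)) - ?b (Suc t))"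
    by (subst sum.lessThan_Suc_shift) simp
  also have "\<dots> = 0"
    using sum_lessThan_telescope[of "\<lambda>t. ?b (Suc t)" N] w1 wN by simp
  finally have "action z1 N = action z2 ?N + action w ?N"
    using action_extend[OF N] by (simp add: z1_def)
  moreover have "0 \<le> action w ?N"
    by (intro action_nonneg adm) (simp_all add: w0 wN)
  ultimately show ?thesis
    using action_yN[of N e] action_yN[of ?N e] N by (simp add: z1_def z2_def y_def)
qed

lemma M_approx_bound:
  assumes "2 \<le> N"
  shows "(lam0 - lam) * (\<Sum>t<N. qW t (fst (yN N e (Suc t)))) \<le> kappa e - Re (cdot e (M_approx N *v e))"
proof -
  have "(lam0 - lam) * (\<Sum>t<N. qW t (fst (cut (yN N e) N (Suc t)))) \<le> action (cut (yN N e) N) N"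
    using assms by (intro action_bound cut_yN_admissible) (simp_all add: cut_def)
  moreover have "(\<Sum>t<N. qW t (fst (cut (yN N e) N (Suc t)))) = (\<Sum>t<N. qW t (fst (yN N e (Suc t))))"
    by (intro sum.cong) (simp_all add: fst_cut[of "yN N e" N, OF yN_N[OF assms]])
  ultimately show ?thesis
    by (simp add: action_yN assms)
qed

lemma M_approx_le_kappa: "2 \<le> N \<Longrightarrow> Re (cdot e (M_approx N *v e)) \<le> kappa e"
  using action_yN[of N e] action_nonneg[of "cut (yN N e) N" N] cut_yN_admissible[of N e]
  by (simp add: cut_def)

text \<open>Bounded monotone real quadratic forms converge; polarization transfers this to the
  entries. The shift by 2 skips the indices where \<open>M_approx\<close> has no meaning.\<close>

lemma M_approx_convergent: "\<exists>M. M_approx \<longlonglongrightarrow> M"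
proof -
  have quad: "\<exists>l. (\<lambda>N. cdot x (M_approx (N + 2) *v x)) \<longlonglongrightarrow> l" for x
  proof -
    have "incseq (\<lambda>N. Re (cdot x (M_approx (N + 2) *v x)))"
      using M_approx_mono by (intro incseq_SucI) simp
    moreover have "\<forall>N. Re (cdot x (M_approx (N + 2) *v x)) \<le> kappa x"
      by (simp add: M_approx_le_kappa)
    ultimately obtain l where "(\<lambda>N. Re (cdot x (M_approx (N + 2) *v x))) \<longlonglongrightarrow> l"
      by (rule incseq_convergent)
    then have "(\<lambda>N. complex_of_real (Re (cdot x (M_approx (N + 2) *v x)))) \<longlonglongrightarrow> of_real l"
      by (rule tendsto_of_real)
    moreover have "complex_of_real (Re (cdot x (M_approx (N + 2) *v x))) = cdot x (M_approx (N + 2) *v x)" for N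
      using M_approx_symmetric[of "N + 2" x x]
      by (metis cnj.simps(2) cnj_cdot complex_eq_iff complex_of_real_def complex.sel le_add2 neg_equal_zero)
    ultimately show ?thesis by auto
  qed
  have "\<exists>l. (\<lambda>N. M_approx (N + 2) $ i $ j) \<longlonglongrightarrow> l" for i j
  proof -
    let ?x = "axis i 1 :: complex ^ 'n" and ?y = "axis j 1 :: complex ^ 'n"
    obtain l1 l2 l3 l4 where l:
      "(\<lambda>N. cdot (?x + ?y) (M_approx (N + 2) *v (?x + ?y))) \<longlonglongrightarrow> l1"
      "(\<lambda>N. cdot (?x - ?y) (M_approx (N + 2) *v (?x - ?y))) \<longlonglongrightarrow> l2"
      "(\<lambda>N. cdot (?x + \<i> *s ?y) (M_approx (N + 2) *v (?x + \<i> *s ?y))) \<longlonglongrightarrow> l3"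
      "(\<lambda>N. cdot (?x - \<i> *s ?y) (M_approx (N + 2) *v (?x - \<i> *s ?y))) \<longlonglongrightarrow> l4"
      using quad by metis
    have "(\<lambda>N. (cdot (?x + ?y) (M_approx (N + 2) *v (?x + ?y)) - cdot (?x - ?y) (M_approx (N + 2) *v (?x - ?y))
      - \<i> * (cdot (?x + \<i> *s ?y) (M_approx (N + 2) *v (?x + \<i> *s ?y))
          - cdot (?x - \<i> *s ?y) (M_approx (N + 2) *v (?x - \<i> *s ?y)))) / 4) \<longlonglongrightarrow> (l1 - l2 - \<i> * (l3 - l4)) / 4"
      by (intro tendsto_intros l) simp
    then show ?thesis
      unfolding cdot_polarization[symmetric] by (auto simp: matrix_nth_cdot)
  qed
  then obtain l where "\<And>i j. (\<lambda>N. M_approx (N + 2) $ i $ j) \<longlonglongrightarrow> l i j" by metis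
  then have "(\<lambda>N. M_approx (N + 2)) \<longlonglongrightarrow> (\<chi> i j. l i j)"
    by (intro vec_tendstoI) simp
  then show ?thesis using LIMSEQ_offset by blast
qed

definition M_lim :: "complex ^ 'n ^ 'n" where
  "M_lim = lim M_approx"

lemma M_lim: "M_approx \<longlonglongrightarrow> M_lim"
  using M_approx_convergent unfolding M_lim_def by (metis limI)

lemma M_lim_symmetric: "cdot (M_lim *v x) y = cdot x (M_lim *v y)"
proof (rule tendsto_unique[OF sequentially_bot])
  show "(\<lambda>N. cdot (M_approx N *v x) y) \<longlonglongrightarrow> cdot (M_lim *v x) y"
    by (intro tendsto_cdot tendsto_matrix_vector_mult M_lim tendsto_const)
  have "(\<lambda>N. cdot x (M_approx N *v y)) \<longlonglongrightarrow> cdot x (M_lim *v y)"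
    by (intro tendsto_cdot tendsto_matrix_vector_mult M_lim tendsto_const)
  moreover have "\<forall>\<^sub>F N in sequentially. cdot x (M_approx N *v y) = cdot (M_approx N *v x) y"
    using eventually_ge_at_top[of 2] by eventually_elim (simp add: M_approx_symmetric)
  ultimately show "(\<lambda>N. cdot (M_approx N *v x) y) \<longlonglongrightarrow> cdot x (M_lim *v y)"
    by (rule Lim_transform_eventually)
qed

lemma recessive_l2W: "sol Lam (e, M_lim *v e) \<in> l2W W"
proof -
  let ?y = "sol Lam (e, M_lim *v e)"
  \<comment> \<open>Monotonicity bounds the form of \<open>M_approx N\<close> below by its value at
    N = 2, so that \<open>K\<close> is independent of N.\<close>
  define K where "K = (kappa e - Re (cdot e (M_approx 2 *v e))) / (lam0 - lam)"
  have "(\<Sum>t<T. qW t (fst (?y (Suc t)))) \<le> K" for T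
  proof (rule tendsto_upperbound)
    have "(\<lambda>N. fst (yN N e t)) \<longlonglongrightarrow> fst (?y t)" for t
      unfolding fst_sol by (intro tendsto_intros tendsto_matrix_vector_mult M_lim)
    then show "(\<lambda>N. \<Sum>t<T. qW t (fst (yN N e (Suc t)))) \<longlonglongrightarrow> (\<Sum>t<T. qW t (fst (?y (Suc t))))"
      unfolding qW_def
      by (intro tendsto_sum tendsto_Re tendsto_cdot tendsto_matrix_vector_mult tendsto_const)
    show "\<forall>\<^sub>F N in sequentially. (\<Sum>t<T. qW t (fst (yN N e (Suc t)))) \<le> K"
      using eventually_ge_at_top[of "max 2 T"]
    proof eventually_elim
      case (elim N)
      then have N: "2 \<le> N" "T \<le> N" by auto
      have mono: "Re (cdot e (M_approx 2 *v e)) \<le> Re (cdot e (M_approx N *v e))"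
        using N(1) by (induction rule: dec_induct) (auto intro: order_trans M_approx_mono)
      have "(\<Sum>t<T. qW t (fst (yN N e (Suc t)))) \<le> (\<Sum>t<N. qW t (fst (yN N e (Suc t))))"
        using N by (intro sum_mono2) (auto simp: qW_nonneg)
      then have "(lam0 - lam) * (\<Sum>t<T. qW t (fst (yN N e (Suc t))))
          \<le> (lam0 - lam) * (\<Sum>t<N. qW t (fst (yN N e (Suc t))))"
        using lam_less by (intro mult_left_mono) simp_all
      then have "(lam0 - lam) * (\<Sum>t<T. qW t (fst (yN N e (Suc t)))) \<le> kappa e - Re (cdot e (M_approx 2 *v e))"
        using M_approx_bound[OF N(1), of e] mono by simp
      then show ?case
        using lam_less by (simp add: K_def pos_le_divide_eq mult.commute)
    qed
  qed simp
  then have "summable (\<lambda>t. qW t (fst (?y (Suc t))))"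
    by (intro summableI_nonneg_bounded qW_nonneg)
  then show ?thesis by (simp add: l2W_def qW_def)
qed

section \<open>Matrix solutions and recessiveness\<close>

lemma matrix_solution_iff:
  "matrix_solution A B C W \<mu> U V \<longleftrightarrow> (\<forall>c. solution A B C W \<mu> (\<lambda>t. (U t *v c, V t *v c)))"
  unfolding matrix_solution_def solution_def Let_def fdiff_def matrix_eq
  by (auto simp: matrix_vector_mult_diff_rdistrib matrix_vector_mult_add_rdistrib
      simp flip: matrix_vector_mul_assoc)

lemma cdot_matrix_bform:
  "cdot x (matrix_bform U V U1 V1 *v y) = bform (U1 *v y, V1 *v y) (U *v x, V *v x)"
  by (simp add: matrix_bform_def bform_alt matrix_vector_mult_diff_rdistrib cdot_linear cdot_ctrans
      flip: matrix_vector_mul_assoc)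

text \<open>At time t one has U = Up (M - M_t) and U1 = Up B1 (I + D U1(1)), with D = B1^{-1} (M -
  M_t) tending to zero. Thus U1 is eventually invertible, and U1^{-1} U = (I + D U1(1))^{-1} D tends
  to zero.\<close>

lemma recessive:
  assumes Y: "\<And>t c. (U t *v c, V t *v c) = sol Lam (c, M_lim *v c) t"
  shows "recessive_solution A B C W Lam U V"
proof -
  have sol: "\<forall>t. inhom Lam (\<lambda>_. 0) (\<lambda>t. (U t *v c, V t *v c)) t" for c
    by (simp add: Y sol_inhom)
  have prep: "matrix_bform (U t) (V t) (U t) (V t) = 0" for t
  proof -
    have "cdot x (matrix_bform (U t) (V t) (U t) (V t) *v y) = 0" for x y
      using bform_const[of lam "sol Lam (y, M_lim *v y)" "sol Lam (x, M_lim *v x)" t 1]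
      by (simp add: cdot_matrix_bform Y sol_inhom) (simp add: bform_alt M_lim_symmetric)
    then show ?thesis by (auto simp: matrix_eq intro: cdot_all_eq_0)
  qed
  have "(\<exists>s1. \<forall>t\<ge>s1. invertible (U1 t)) \<and> (\<lambda>t. matrix_inv (U1 t) ** U t) \<longlonglongrightarrow> 0"
    if S1: "matrix_solution A B C W Lam U1 V1" and K: "invertible K"
      "\<forall>t. matrix_bform (U t) (V t) (U1 t) (V1 t) = K" for U1 V1 K
  proof -
    \<comment> \<open>The coordinate of Y1 along the solution with value (0; I) at 1; it equals -K
      and inherits its invertibility.\<close>
    define B1 where "B1 = V1 1 - M_lim ** U1 1"
    have "cdot x (B1 *v y) = - cdot x (K *v y)" for x y
    proof -
      have "cdot x (K *v y) = bform (U1 1 *v y, V1 1 *v y) (x, M_lim *v x)"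
        using K(2) Y[of 1 x] by (metis cdot_matrix_bform sol_1(1))
      then show ?thesis
        by (simp add: B1_def bform_alt matrix_vector_mult_diff_rdistrib cdot_linear M_lim_symmetric
            flip: matrix_vector_mul_assoc)
    qed
    then have B1: "B1 *v y = - (K *v y)" for y
      by (metis (no_types) cdot_all_eq_0 cdot_add_right add.right_inverse add_eq_0_iff neg_eq_iff_add_eq_0)
    have B1_inv: "invertible B1"
      using K(1) unfolding invertible_iff_kernel B1 by simp
    \<comment> \<open>The approximant with endpoint t vanishes there and has the same u(1), so only
      the difference of the v(1)-values contributes.\<close>
    have UG: "U t *v c = Up Lam t *v ((M_lim - M_approx t) *v c)" if "2 \<le> t" for t c
    proof -
      have "U t *v c = fst (sol Lam (c, M_lim *v c) t)"
        using arg_cong[OF Y[of t c], of fst] by simp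
      then show ?thesis
        using that by (simp add: fst_sol Uq_eq matrix_vector_mult_diff_rdistrib matrix_vector_mult_diff_distrib)
    qed
    have U1: "U1 t *v c = U t *v (U1 1 *v c) + Up Lam t *v (B1 *v c)" for t c
    proof -
      have "(\<lambda>t. (U1 t *v c, V1 t *v c)) = sol Lam (U1 1 *v c, V1 1 *v c)"
        using S1 by (subst sol_unique[of Lam "\<lambda>t. (U1 t *v c, V1 t *v c)"])
          (auto simp: matrix_solution_iff solution_iff)
      from arg_cong[OF fun_cong[OF this, of t], of fst]
      have "U1 t *v c = fst (sol Lam (U1 1 *v c, V1 1 *v c) t)" by simp
      moreover have "U t *v (U1 1 *v c) = fst (sol Lam (U1 1 *v c, M_lim *v (U1 1 *v c)) t)"
        using arg_cong[OF Y[of t "U1 1 *v c"], of fst] by simp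
      ultimately show ?thesis
        by (simp add: fst_sol B1_def matrix_vector_mult_diff_rdistrib matrix_vector_mult_diff_distrib
            flip: matrix_vector_mul_assoc)
    qed
    define D where "D t = matrix_inv B1 ** (M_lim - M_approx t)" for t
    have "(\<lambda>t. M_lim - M_approx t) \<longlonglongrightarrow> M_lim - M_lim"
      by (intro tendsto_intros M_lim)
    from tendsto_matrix_mult_right[OF this, of "matrix_inv B1"] have "D \<longlonglongrightarrow> 0"
      by (simp add: D_def[abs_def])
    then have D0: "(\<lambda>t. entry_sum (D t)) \<longlonglongrightarrow> 0" by (rule tendsto_entry_sum_0)
    have BD: "B1 *v (D t *v c) = (M_lim - M_approx t) *v c" for t c
      using matrix_inv_vec(1)[OF B1_inv] by (simp add: D_def flip: matrix_vector_mul_assoc)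
    let ?a = "entry_sum (U1 1)"
    have "0 \<le> ?a" by (simp add: entry_sum_def sum_nonneg)
    have "\<forall>\<^sub>F t in sequentially. entry_sum (D t) < 1 / (2 * (?a + 1))"
      using D0 \<open>0 \<le> ?a\<close> by (intro order_tendstoD(2)) auto
    \<comment> \<open>Past \<open>s\<close> the map D U1(1) contracts by one half; the 1 added to
      \<open>?a\<close> covers the case U1(1) = 0.\<close>
    then obtain s where s: "\<And>t. s \<le> t \<Longrightarrow> entry_sum (D t) < 1 / (2 * (?a + 1))"
      by (auto simp: eventually_sequentially)
    have half: "norm (D t *v (U1 1 *v c)) \<le> norm c / 2" if "s \<le> t" for t c
    proof -
      have Dn: "0 \<le> entry_sum (D t)" by (simp add: entry_sum_def sum_nonneg)
      have "norm (D t *v (U1 1 *v c)) \<le> entry_sum (D t) * (?a * norm c)"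
        using norm_matrix_vector_le[of "D t" "U1 1 *v c"] norm_matrix_vector_le[of "U1 1" c] Dn
        by (meson mult_left_mono order_trans)
      also have "\<dots> \<le> 1 / (2 * (?a + 1)) * ((?a + 1) * norm c)"
        using s[OF that] Dn \<open>0 \<le> ?a\<close> by (intro mult_mono) (auto intro: mult_right_mono)
      also have "\<dots> = norm c / 2" using \<open>0 \<le> ?a\<close> by (simp add: field_simps)
      finally show ?thesis .
    qed
    have U1': "U1 t *v c = Up Lam t *v (B1 *v (D t *v (U1 1 *v c) + c))" if "2 \<le> t" for t c
      by (subst U1) (simp add: UG[OF that] BD matrix_vector_right_distrib)
    have inv: "invertible (U1 t)" if t: "max s 2 \<le> t" for t
      unfolding invertible_iff_kernel
    proof (intro allI impI)
      fix c assume "U1 t *v c = 0"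
      then have "Up Lam t *v (B1 *v (D t *v (U1 1 *v c) + c)) = 0"
        using U1'[of t c] t by simp
      then have "D t *v (U1 1 *v c) + c = 0"
        using t by (simp add: invertible_eq_0 Up_invertible B1_inv)
      then have "norm c = norm (D t *v (U1 1 *v c))"
        by (metis add_eq_0_iff norm_minus_cancel)
      then show "c = 0" using half[of t c] t by simp
    qed
    define X where "X t = matrix_inv (U1 t) ** U t" for t
    \<comment> \<open>The term with D U1(1) is absorbed into the left-hand side, which costs the
      factor 2.\<close>
    have X: "norm (X t *v c) \<le> 2 * entry_sum (D t) * norm c" if t: "max s 2 \<le> t" for t c
    proof -
      have "U1 t *v (X t *v c) = U t *v c"
        using matrix_inv_vec(1)[OF inv[OF t]] by (simp add: X_def flip: matrix_vector_mul_assoc)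
      then have "Up Lam t *v (B1 *v (D t *v (U1 1 *v (X t *v c)) + X t *v c)) = Up Lam t *v (B1 *v (D t *v c))"
        using U1'[of t "X t *v c"] UG[of t c] BD[of t c] t by simp
      then have "D t *v (U1 1 *v (X t *v c)) + X t *v c = D t *v c"
        using t Up_invertible[of t] B1_inv by (simp add: invertible_eq_iff)
      then have "X t *v c = D t *v c - D t *v (U1 1 *v (X t *v c))" by (simp add: algebra_simps)
      then have "norm (X t *v c) \<le> norm (D t *v c) + norm (D t *v (U1 1 *v (X t *v c)))"
        by (metis norm_triangle_ineq4)
      also have "\<dots> \<le> entry_sum (D t) * norm c + norm (X t *v c) / 2"
        using half[of t "X t *v c"] norm_matrix_vector_le[of "D t" c] t by simp
      finally show ?thesis by simp
    qed
    have "(\<lambda>t. X t $ i $ j) \<longlonglongrightarrow> 0" for i j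
    proof (rule Lim_null_comparison)
      show "\<forall>\<^sub>F t in sequentially. norm (X t $ i $ j) \<le> 2 * entry_sum (D t)"
        using eventually_ge_at_top[of "max s 2"]
      proof eventually_elim
        case (elim t)
        have "norm (X t $ i $ j) = norm ((X t *v axis j 1) $ i)"
          by (simp add: matrix_vector_axis)
        also have "\<dots> \<le> norm (X t *v axis j 1)" by (rule Finite_Cartesian_Product.norm_nth_le)
        also have "\<dots> \<le> 2 * entry_sum (D t)" using X[OF elim, of "axis j 1"] by simp
        finally show ?case .
      qed
      show "(\<lambda>t. 2 * entry_sum (D t)) \<longlonglongrightarrow> 0" using tendsto_mult_right_zero[OF D0] by simp
    qed
    then have "X \<longlonglongrightarrow> 0" by (intro vec_tendstoI) simp
    moreover have "\<exists>s1. \<forall>t\<ge>s1. invertible (U1 t)" using inv by blast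
    ultimately show ?thesis by (simp add: X_def[abs_def])
  qed
  moreover have "matrix_solution A B C W Lam U V"
    using sol by (simp add: matrix_solution_iff solution_iff)
  ultimately show ?thesis
    unfolding recessive_solution_def prepared_solution_def using prep by blast
qed

end

section \<open>Truncated boundary value problems\<close>

text \<open>Independence of an indexed family also excludes repetitions, so that the image keeps the
  cardinality of the index set.\<close>

lemma (in vector_space) family_independent:
  assumes "finite b" and indep: "\<And>c. (\<Sum>a\<in>b. scale (c a) (T a)) = 0 \<Longrightarrow> \<forall>a\<in>b. c a = 0"
  shows "inj_on T b" "independent (T ` b)"
proof -
  show inj: "inj_on T b"
  proof (intro inj_onI, rule ccontr)
    fix x y assume xy: "x \<in> b" "y \<in> b" "T x = T y" "x \<noteq> y"
    let ?c = "\<lambda>a. if a = x then 1 else if a = y then - 1 else (0 :: 'a)"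
    have "(\<Sum>a\<in>b. scale (?c a) (T a)) = (\<Sum>a\<in>{x, y}. scale (?c a) (T a))"
      using assms(1) xy by (intro sum.mono_neutral_right) auto
    also have "\<dots> = 0" using xy by simp
    finally have "?c x = 0" using indep[of ?c] xy(1) by blast
    then show False by simp
  qed
  show "independent (T ` b)"
  proof
    assume "dependent (T ` b)"
    then obtain u v where u: "v \<in> T ` b" "u v \<noteq> 0" "(\<Sum>v\<in>T ` b. scale (u v) v) = 0"
      using assms(1) by (auto simp: dependent_finite)
    then have "(\<Sum>a\<in>b. scale (u (T a)) (T a)) = 0"
      by (simp add: sum.reindex[OF inj])
    then show False using indep[of "\<lambda>a. u (T a)"] u(1,2) by auto
  qed
qed

text \<open>Bolzano-Weierstrass applied successively; refining a subsequence preserves the limits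
  already obtained.\<close>

lemma common_convergent_subsequence:
  fixes X :: "'a \<Rightarrow> nat \<Rightarrow> 'b::heine_borel"
  assumes "finite S" "\<And>a. a \<in> S \<Longrightarrow> bounded (range (X a))"
  shows "\<exists>r l. strict_mono (r :: nat \<Rightarrow> nat) \<and> (\<forall>a\<in>S. (X a \<circ> r) \<longlonglongrightarrow> l a)"
  using assms
proof (induction S rule: finite_induct)
  case empty
  show ?case by (rule exI[of _ id]) (auto simp: strict_mono_def)
next
  case (insert a S)
  then obtain r l where r: "strict_mono r" "\<forall>a\<in>S. (X a \<circ> r) \<longlonglongrightarrow> l a"
    by (metis insert_iff)
  have "bounded (range (X a \<circ> r))"
    using insert.prems[of a] by (rule bounded_subset) auto
  then obtain l' r' where r': "strict_mono r'" "((X a \<circ> r) \<circ> r') \<longlonglongrightarrow> l'"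
    using bounded_imp_convergent_subsequence by blast
  have "(X c \<circ> (r \<circ> r')) \<longlonglongrightarrow> (l(a := l')) c" if "c \<in> insert a S" for c
  proof (cases "c = a")
    case False
    then have "(X c \<circ> r) \<longlonglongrightarrow> l c" using r(2) that by auto
    from LIMSEQ_subseq_LIMSEQ[OF this r'(1)] False show ?thesis by (simp add: comp_assoc)
  qed (use r' in \<open>simp add: comp_assoc\<close>)
  then show ?case using strict_mono_o[OF r(1) r'(1)] by blast
qed

text \<open>The minimum over the compact unit sphere is positive, and homogeneity extends the bound
  to all vectors.\<close>

lemma pos_def_quadratic_bound:
  fixes q :: "'a::euclidean_space \<Rightarrow> real"
  assumes "continuous_on UNIV q" "\<And>x. x \<noteq> 0 \<Longrightarrow> 0 < q x" "\<And>r x. q (r *\<^sub>R x) = r\<^sup>2 * q x"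
  shows "\<exists>m>0. \<forall>x. m * (norm x)\<^sup>2 \<le> q x"
proof -
  have "sphere (0::'a) 1 \<noteq> {}" by simp
  then obtain z where z: "z \<in> sphere 0 1" "\<And>x. x \<in> sphere 0 1 \<Longrightarrow> q z \<le> q x"
    using continuous_attains_inf[of "sphere (0::'a) 1" q] assms(1)
    by (meson compact_sphere continuous_on_subset subset_UNIV)
  have "q z * (norm x)\<^sup>2 \<le> q x" for x
  proof (cases "x = 0")
    case True
    then show ?thesis using assms(3)[of 0 x] by simp
  next
    case False
    then have "q z \<le> q ((1 / norm x) *\<^sub>R x)" by (intro z) simp
    then show ?thesis using False assms(3)[of "1 / norm x" x]
      by (simp add: power_divide field_simps)
  qed
  moreover have "z \<noteq> 0" using z(1) by auto
  ultimately show ?thesis using assms(2) by blast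
qed

context disconjugate_system
begin

text \<open>The summands are nonnegative, so enlarging the interval of definiteness keeps the strict
  sign. One threshold works for every parameter; it is \<open>Suc s0\<close> because the sum stops
  before N.\<close>

lemma definite_sum:
  "\<exists>s. \<forall>\<mu> y N. (\<forall>t. inhom \<mu> (\<lambda>_. 0) y t) \<longrightarrow> s \<le> N \<longrightarrow>
     (\<Sum>t<N. qW t (fst (y (Suc t)))) \<le> 0 \<longrightarrow> y = (\<lambda>_. 0)"
proof -
  obtain t0 s0 where s: "\<forall>\<mu> y. solution A B C W \<mu> y \<and> (\<exists>t. y t \<noteq> 0) \<longrightarrow>
      0 < (\<Sum>t\<in>{t0..s0}. qW t (fst (y (Suc t))))"
    using definite unfolding definiteness_condition_def qW_def Suc_eq_plus1 by blast
  have "y = (\<lambda>_. 0)" if "\<forall>t. inhom \<mu> (\<lambda>_. 0) y t" "Suc s0 \<le> N"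
    "(\<Sum>t<N. qW t (fst (y (Suc t)))) \<le> 0" for \<mu> y N
  proof (rule ccontr)
    assume "y \<noteq> (\<lambda>_. 0)"
    then have "\<exists>t. y t \<noteq> 0" by (auto simp: fun_eq_iff)
    then have "0 < (\<Sum>t\<in>{t0..s0}. qW t (fst (y (Suc t))))"
      using s that(1) by (auto simp: solution_iff)
    also have "\<dots> \<le> (\<Sum>t<N. qW t (fst (y (Suc t))))"
      using that(2) by (intro sum_mono2) (auto simp: qW_nonneg)
    finally show False using that(3) by simp
  qed
  then show ?thesis by blast
qed

section \<open>Uniform definiteness and Dirichlet problems\<close>

definition section_end :: nat where
  "section_end = (SOME s. \<forall>\<mu> y N. (\<forall>t. inhom \<mu> (\<lambda>_. 0) y t) \<longrightarrow> s \<le> N \<longrightarrow>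
     (\<Sum>t<N. qW t (fst (y (Suc t)))) \<le> 0 \<longrightarrow> y = (\<lambda>_. 0))"

lemma definite_zero:
  assumes "\<forall>t. inhom \<mu> (\<lambda>_. 0) y t" "section_end \<le> N" "(\<Sum>t<N. qW t (fst (y (Suc t)))) \<le> 0"
  shows "y = (\<lambda>_. 0)"
  using someI_ex[OF definite_sum] assms unfolding section_end_def by blast

text \<open>The equation is imposed at every t; N enters only through the boundary
  condition.\<close>

definition dirichlet :: "complex \<Rightarrow> (nat \<Rightarrow> complex ^ 'n) \<Rightarrow> 'n cseq \<Rightarrow> nat \<Rightarrow> bool" where
  "dirichlet \<mu> f y N \<longleftrightarrow> (\<forall>t. inhom \<mu> f y t) \<and> fst (y 0) = 0 \<and> fst (y N) = 0"

text \<open>The left-hand side is real although \<mu> may be complex, hence the identity carries two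
  real relations.\<close>

lemma energy_sum:
  assumes "dirichlet \<mu> f y N"
  shows "complex_of_real (\<Sum>t<N. energy y t) = \<mu> * of_real (\<Sum>t<N. qW t (fst (y (Suc t))))
    + (\<Sum>t<N. cdot (fst (y (Suc t))) (W t *v f t))"
proof -
  let ?b = "\<lambda>t. cdot (fst (y t)) (snd (y t))"
  have "complex_of_real (energy y t) = (?b (Suc t) - ?b t) + \<mu> * of_real (qW t (fst (y (Suc t))))
      + cdot (fst (y (Suc t))) (W t *v f t)" for t
  proof -
    have i: "inhom \<mu> f y t" and a: "admissible y t"
      using assms by (auto simp: dirichlet_def inhom_def)
    have "complex_of_real (energy y t) = cdot (snd (y t)) (B t *v snd (y t))
        + cdot (fst (y (Suc t))) (C t *v fst (y (Suc t)))"
      by (simp add: energy_def complex_eq_iff hermitian_Im_0 B_herm C_herm)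
    then show ?thesis by (simp add: energy_step[OF i a] of_real_qW)
  qed
  then have "complex_of_real (\<Sum>t<N. energy y t) = (\<Sum>t<N. ?b (Suc t) - ?b t)
      + \<mu> * (\<Sum>t<N. of_real (qW t (fst (y (Suc t))))) + (\<Sum>t<N. cdot (fst (y (Suc t))) (W t *v f t))"
    by (simp add: sum.distrib sum_distrib_left)
  also have "(\<Sum>t<N. ?b (Suc t) - ?b t) = 0"
    using assms sum_lessThan_telescope[of ?b N] by (simp add: dirichlet_def)
  finally show ?thesis by simp
qed

text \<open>An a priori bound uniform in N: \<open>c\<close> plays the role of a distance from \<mu>
  to the spectra of all truncated Dirichlet problems.\<close>

definition coercive :: "complex \<Rightarrow> real \<Rightarrow> bool" where
  "coercive \<mu> c \<longleftrightarrow> c > 0 \<and> (\<forall>f y N. dirichlet \<mu> f y N \<longrightarrow>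
     c * (\<Sum>t<N. qW t (fst (y (Suc t)))) \<le> cmod (\<Sum>t<N. cdot (fst (y (Suc t))) (W t *v f t)))"

lemma key_dirichlet:
  assumes "dirichlet \<mu> f y N"
  shows "lam0 * (\<Sum>t<N. qW t (fst (y (Suc t)))) \<le> (\<Sum>t<N. energy y t)"
  using assms by (intro key_inequality(1)) (auto simp: dirichlet_def inhom_def)

text \<open>The real part of the energy identity, set against the lower bound \<open>lam0\<close> of
  the functional, leaves the gap.\<close>

lemma coercive_real: "coercive Lam (lam0 - lam)"
  unfolding coercive_def
proof (intro conjI allI impI)
  fix f y N assume d: "dirichlet Lam f y N"
  have "(\<Sum>t<N. energy y t) = lam * (\<Sum>t<N. qW t (fst (y (Suc t))))
     + Re (\<Sum>t<N. cdot (fst (y (Suc t))) (W t *v f t))"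
    using arg_cong[OF energy_sum[OF d], of Re] by simp
  then show "(lam0 - lam) * (\<Sum>t<N. qW t (fst (y (Suc t))))
      \<le> cmod (\<Sum>t<N. cdot (fst (y (Suc t))) (W t *v f t))"
    using key_dirichlet[OF d] complex_Re_le_cmod[of "\<Sum>t<N. cdot (fst (y (Suc t))) (W t *v f t)"]
    by (simp add: left_diff_distrib)
qed (use lam_less in simp)

text \<open>The energy drops out of the imaginary part, which expresses the \<open>W\<close>-sum by
  the pairing alone; the constant is the modulus of the imaginary part of
  \<open>-\<i>\<close>.\<close>

lemma coercive_imaginary: "coercive (- \<i>) 1"
  unfolding coercive_def
proof (intro conjI allI impI)
  fix f y N assume d: "dirichlet (- \<i>) f y N"
  have "0 = - (\<Sum>t<N. qW t (fst (y (Suc t)))) + Im (\<Sum>t<N. cdot (fst (y (Suc t))) (W t *v f t))"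
    using arg_cong[OF energy_sum[OF d], of Im] by simp
  then show "1 * (\<Sum>t<N. qW t (fst (y (Suc t)))) \<le> cmod (\<Sum>t<N. cdot (fst (y (Suc t))) (W t *v f t))"
    using abs_Im_le_cmod[of "\<Sum>t<N. cdot (fst (y (Suc t))) (W t *v f t)"] by simp
qed simp

lemma coercive_bound:
  assumes "coercive \<mu> c" "dirichlet \<mu> f y N"
  shows "(\<Sum>t<N. qW t (fst (y (Suc t)))) \<le> (\<Sum>t<N. qW t (f t)) / c\<^sup>2"
proof -
  let ?S = "\<Sum>t<N. qW t (fst (y (Suc t)))" and ?F = "\<Sum>t<N. qW t (f t)"
  have c: "c > 0" using assms(1) by (simp add: coercive_def)
  have "c * ?S \<le> cmod (\<Sum>t<N. cdot (fst (y (Suc t))) (W t *v f t))"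
    using assms by (auto simp: coercive_def)
  \<comment> \<open>With weight \<open>c\<close>, half of the left-hand side is absorbed.\<close>
  also have "\<dots> \<le> (\<Sum>t<N. (c * qW t (fst (y (Suc t))) + qW t (f t) / c) / 2)"
    by (intro sum_norm_le W_form_le c)
  also have "\<dots> = (c * ?S + ?F / c) / 2"
    by (simp add: sum.distrib sum_distrib_left flip: sum_divide_distrib)
  finally have "c * ?S \<le> ?F / c" by simp
  then show ?thesis using c by (simp add: field_simps power2_eq_square)
qed

text \<open>Coercivity and definiteness give uniqueness, and uniqueness gives existence by finite
  dimension: a particular solution is corrected by a principal one to vanish at N.\<close>

lemma dirichlet_exists:
  assumes "coercive \<mu> c" "section_end \<le> N"
  shows "\<exists>y. dirichlet \<mu> f y N"
proof -
  have "c = 0" if "fst (psi \<mu> c N) = 0" for c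
  proof -
    have "dirichlet \<mu> (\<lambda>_. 0) (psi \<mu> c) N"
      using that by (simp add: dirichlet_def psi_sol psi_0)
    from coercive_bound[OF assms(1) this]
    have "(\<Sum>t<N. qW t (fst (psi \<mu> c (Suc t)))) \<le> 0" by (simp add: qW_def)
    then have "psi \<mu> c = (\<lambda>_. 0)"
      using definite_zero psi_sol assms(2) by blast
    then show ?thesis using psi_0[of \<mu> c] by (simp add: prod_eq_iff)
  qed
  then have "inj (\<lambda>c. fst (psi \<mu> c N))"
    by (simp add: linear_injective_0[OF psi_linear])
  with psi_linear have surj: "surj (\<lambda>c. fst (psi \<mu> c N))" by (rule linear_inj_imp_surj)
  obtain z where z: "z 0 = 0" "\<forall>t. inhom \<mu> f z t"
    using inhom_exists_0 by blast
  obtain c where c: "fst (z N) = fst (psi \<mu> c N)"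
    using surj by (rule surjE)
  have "\<forall>t. inhom \<mu> (\<lambda>t. f t - 0) (\<lambda>t. z t - psi \<mu> c t) t"
    using inhom_diff z(2) psi_sol by blast
  then have "dirichlet \<mu> f (\<lambda>t. z t - psi \<mu> c t) N"
    by (simp add: dirichlet_def z(1) c psi_0)
  then show ?thesis by blast
qed

text \<open>Definiteness makes the \<open>W\<close>-sum a positive definite form in v(0), so bounded
  sums keep initial values in a compact set.\<close>

lemma psi_norm_bound: "\<exists>m>0. \<forall>c. m * (norm c)\<^sup>2 \<le> (\<Sum>t<section_end. qW t (fst (psi \<mu> c (Suc t))))"
proof (rule pos_def_quadratic_bound)
  have "continuous_on UNIV (\<lambda>c. fst (psi \<mu> c (Suc t)))" for t
    by (rule linear_continuous_on) (simp add: psi_linear linear_conv_bounded_linear[symmetric])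
  then have "continuous_on UNIV (\<lambda>c. qW t (fst (psi \<mu> c (Suc t))))" for t
    unfolding qW_def continuous_on_def
    by (intro ballI tendsto_Re tendsto_cdot tendsto_matrix_vector_mult tendsto_const) auto
  then show "continuous_on UNIV (\<lambda>c. \<Sum>t<section_end. qW t (fst (psi \<mu> c (Suc t))))"
    by (intro continuous_on_sum)
  show "0 < (\<Sum>t<section_end. qW t (fst (psi \<mu> c (Suc t))))" if "c \<noteq> 0" for c
  proof (rule ccontr)
    assume "\<not> ?thesis"
    then have "psi \<mu> c = (\<lambda>_. 0)"
      using definite_zero[of \<mu> "psi \<mu> c" section_end] psi_sol by simp
    then show False using psi_0[of \<mu> c] that by (simp add: prod_eq_iff)
  qed
  fix r :: real and c
  have "fst (psi \<mu> (r *\<^sub>R c) t) = of_real r *s fst (psi \<mu> c t)" for t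
    by (simp add: psi_scaleR vec_eq_iff) (simp add: scaleR_conv_of_real)
  then show "(\<Sum>t<section_end. qW t (fst (psi \<mu> (r *\<^sub>R c) (Suc t))))
      = r\<^sup>2 * (\<Sum>t<section_end. qW t (fst (psi \<mu> c (Suc t))))"
    by (simp add: qW_scale sum_distrib_left)
qed

text \<open>A common sequence of truncations for all right-hand sides makes the limits depend linearly
  on them.\<close>

lemma dirichlet_limits:
  assumes co: "coercive \<mu> c" and "finite S" and f: "\<And>a. a \<in> S \<Longrightarrow> summable (\<lambda>t. qW t (f a t))"
  shows "\<exists>r X x. strict_mono (r :: nat \<Rightarrow> nat) \<and> (\<forall>a\<in>S. (\<forall>k. dirichlet \<mu> (f a) (X a k) (r k)) \<and>
    (\<forall>t. (\<lambda>k. X a k t) \<longlonglongrightarrow> x a t) \<and> (\<forall>t. inhom \<mu> (f a) (x a) t) \<and> x a \<in> l2W W)"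
proof -
  let ?s = section_end
  have "\<forall>a k. \<exists>y. dirichlet \<mu> (f a) y (k + ?s)"
    using dirichlet_exists[OF co] by auto
  then obtain Y where Y: "\<And>a k. dirichlet \<mu> (f a) (Y a k) (k + ?s)" by metis
  have "\<forall>a. \<exists>z. z 0 = 0 \<and> (\<forall>t. inhom \<mu> (f a) z t)"
    using inhom_exists_0 by blast
  then obtain z where z: "\<And>a. z a 0 = 0" "\<And>a t. inhom \<mu> (f a) (z a) t" by metis
  \<comment> \<open>With \<open>z\<close> fixed, v(0) is the only free parameter of the truncated
    solutions; compactness is needed for it alone.\<close>
  define e where "e a k = snd (Y a k 0)" for a k
  have Ye: "Y a k t = z a t + psi \<mu> (e a k) t" for a k t
  proof -
    have "\<forall>t. inhom \<mu> (f a) (\<lambda>t. z a t + psi \<mu> (e a k) t) t"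
      using inhom_add[OF z(2) psi_sol] by simp
    moreover have "\<forall>t. inhom \<mu> (f a) (Y a k) t" "Y a k 0 = z a 0 + psi \<mu> (e a k) 0"
      using Y[of a k] by (auto simp: dirichlet_def z(1) psi_0 e_def prod_eq_iff)
    ultimately have "Y a k = (\<lambda>t. z a t + psi \<mu> (e a k) t)"
      by (intro inhom_unique[where s = 0])
    then show ?thesis by (rule fun_cong)
  qed
  have c: "c > 0" using co by (simp add: coercive_def)
  define F where "F a = (\<Sum>t. qW t (f a t)) / c\<^sup>2" for a
  have YF: "(\<Sum>t<n. qW t (fst (Y a k (Suc t)))) \<le> F a" if "a \<in> S" "n \<le> k + ?s" for a k n
  proof -
    have "(\<Sum>t<n. qW t (fst (Y a k (Suc t)))) \<le> (\<Sum>t<k + ?s. qW t (fst (Y a k (Suc t))))"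
      using that by (intro sum_mono2) (auto simp: qW_nonneg)
    also have "\<dots> \<le> (\<Sum>t<k + ?s. qW t (f a t)) / c\<^sup>2"
      by (rule coercive_bound[OF co Y])
    also have "\<dots> \<le> F a"
      unfolding F_def using f[OF that(1)]
      by (intro divide_right_mono sum_le_suminf) (auto simp: qW_nonneg)
    finally show ?thesis .
  qed
  obtain m where m: "m > 0" "\<And>c. m * (norm c)\<^sup>2 \<le> (\<Sum>t<?s. qW t (fst (psi \<mu> c (Suc t))))"
    using psi_norm_bound by blast
  have "bounded (range (e a))" if "a \<in> S" for a
  proof -
    define G where "G = 2 * F a + 2 * (\<Sum>t<?s. qW t (fst (z a (Suc t))))"
    have "(norm (e a k))\<^sup>2 \<le> G / m" for k
    proof -
      have q: "qW t (fst (psi \<mu> (e a k) (Suc t))) \<le> 2 * qW t (fst (Y a k (Suc t))) + 2 * qW t (fst (z a (Suc t)))" for t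
      proof -
        have "fst (psi \<mu> (e a k) (Suc t)) = fst (Y a k (Suc t)) - fst (z a (Suc t))"
          by (simp add: Ye)
        then show ?thesis by (simp only: qW_diff_le)
      qed
      have "m * (norm (e a k))\<^sup>2 \<le> (\<Sum>t<?s. qW t (fst (psi \<mu> (e a k) (Suc t))))" by (rule m)
      also have "\<dots> \<le> (\<Sum>t<?s. 2 * qW t (fst (Y a k (Suc t))) + 2 * qW t (fst (z a (Suc t))))"
        by (intro sum_mono q)
      also have "\<dots> \<le> G"
        using YF[OF that, of ?s k] by (simp add: G_def sum.distrib flip: sum_distrib_left)
      finally show ?thesis using m(1) by (simp add: field_simps)
    qed
    then have "norm (e a k) \<le> sqrt (G / m)" for k
      by (simp add: real_le_rsqrt)
    then show ?thesis by (auto simp: bounded_iff)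
  qed
  then obtain r l where r: "strict_mono r" "\<And>a. a \<in> S \<Longrightarrow> (e a \<circ> r) \<longlonglongrightarrow> l a"
    using common_convergent_subsequence[OF \<open>finite S\<close>, of e] by blast
  define x where "x a t = z a t + psi \<mu> (l a) t" for a t
  have lim: "(\<lambda>k. Y a (r k) t) \<longlonglongrightarrow> x a t" if "a \<in> S" for a t
  proof -
    have "linear (\<lambda>c. psi \<mu> c t)" by (intro linearI) (simp_all add: psi_add psi_scaleR)
    then have "bounded_linear (\<lambda>c. psi \<mu> c t)" by (simp add: linear_conv_bounded_linear)
    from bounded_linear.tendsto[OF this r(2)[OF that]]
    show ?thesis unfolding Ye x_def by (intro tendsto_intros) (simp add: comp_def)
  qed
  have "x a \<in> l2W W" if "a \<in> S" for a
  proof -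
    have "(\<Sum>t<n. qW t (fst (x a (Suc t)))) \<le> F a" for n
    proof (rule tendsto_upperbound)
      show "(\<lambda>k. \<Sum>t<n. qW t (fst (Y a (r k) (Suc t)))) \<longlonglongrightarrow> (\<Sum>t<n. qW t (fst (x a (Suc t))))"
        unfolding qW_def
        by (intro tendsto_sum tendsto_Re tendsto_cdot tendsto_matrix_vector_mult tendsto_const
            tendsto_fst lim that)
      show "\<forall>\<^sub>F k in sequentially. (\<Sum>t<n. qW t (fst (Y a (r k) (Suc t)))) \<le> F a"
        using eventually_ge_at_top[of n]
      proof eventually_elim
        case (elim k)
        then have "n \<le> r k + ?s" using seq_suble[OF r(1), of k] by linarith
        then show ?case by (rule YF[OF that])
      qed
    qed simp
    then show ?thesis unfolding l2W_iff by (intro summableI_nonneg_bounded qW_nonneg)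
  qed
  moreover have "inhom \<mu> (f a) (x a) t" for a t
    using inhom_add[OF z(2)[of a] psi_sol] by (simp add: x_def[abs_def])
  \<comment> \<open>The problem with index k ends at k plus \<open>section_end\<close>, so the right
    endpoints carry this shift.\<close>
  moreover have "strict_mono (\<lambda>k. r k + ?s)" using r(1) by (simp add: strict_mono_def)
  ultimately show ?thesis
    using Y lim by (intro exI[of _ "\<lambda>k. r k + ?s"] exI[of _ "\<lambda>a k. Y a (r k)"] exI[of _ x]) auto
qed

end

section \<open>Dimension of the space of square-summable solutions\<close>

lemma cpair_span_finite:
  "\<exists>B :: 'n::finite cpair set. finite B \<and> cpair.span B = UNIV"
proof -
  let ?B = "range (\<lambda>i. (axis i 1, 0)) \<union> range (\<lambda>i. (0, axis i 1)) :: 'n cpair set"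
  have "p \<in> cpair.span ?B" for p
  proof -
    have "p = (\<Sum>i\<in>UNIV. pscale (fst p $ i) (axis i 1, 0)) + (\<Sum>i\<in>UNIV. pscale (snd p $ i) (0, axis i 1))"
      by (simp add: prod_eq_iff fst_sum snd_sum basis_expansion)
    also have "\<dots> \<in> cpair.span ?B"
      by (intro cpair.span_add cpair.span_sum cpair.span_scale cpair.span_base) auto
    finally show ?thesis .
  qed
  then show ?thesis by (intro exI[of _ ?B]) auto
qed

lemma cpair_independent_finite: "cpair.independent B \<Longrightarrow> finite B"
  using cpair_span_finite cpair.independent_span_bound by (metis subset_UNIV)

lemma cpair_card_le_dim:
  assumes "cpair.independent B" "B \<subseteq> V"
  shows "card B \<le> cpair.dim V"
proof -
  obtain B' where "B' \<subseteq> V" "cpair.independent B'" "V \<subseteq> cpair.span B'" "card B' = cpair.dim V"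
    using cpair.basis_exists by blast
  then show ?thesis
    using cpair.independent_span_bound[of B' B] cpair_independent_finite[of B'] assms by auto
qed

text \<open>Summands and summation range vary together. The bounded family \<open>qq\<close> need
  not have small tails: a small weight \<rho> makes its share small, and the tail of the fixed
  series \<open>pp\<close> is then taken small relative to \<rho>.\<close>

lemma tendsto_sum_dominated:
  fixes g :: "nat \<Rightarrow> nat \<Rightarrow> complex" and qq :: "nat \<Rightarrow> nat \<Rightarrow> real"
  assumes r: "strict_mono r" and lim: "\<And>t. (\<lambda>k. g k t) \<longlonglongrightarrow> h t"
    and b: "\<And>k t \<rho>. \<rho> > 0 \<Longrightarrow> cmod (g k t) \<le> (\<rho> * qq k t + pp t / \<rho>) / 2"
    and q: "\<And>k t. 0 \<le> qq k t" "\<And>k. (\<Sum>t<r k. qq k t) \<le> K"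
    and p: "summable pp" "\<And>t. 0 \<le> pp t" and h: "summable h"
  shows "(\<lambda>k. \<Sum>t<r k. g k t) \<longlonglongrightarrow> (\<Sum>t. h t)"
proof (rule LIMSEQ_I)
  fix e :: real assume "e > 0"
  have K: "0 \<le> K" using q(2)[of 0] sum_nonneg[of "{..<r 0}" "qq 0"] q(1) by fastforce
  \<comment> \<open>The tail contributes at most (e/2 + e/4)/2 = 3e/8, which leaves room for two
    errors below e/4.\<close>
  define \<rho> where "\<rho> = e / (2 * (K + 1))"
  have \<rho>: "\<rho> > 0" "\<rho> * K \<le> e / 2"
    using \<open>e > 0\<close> K by (auto simp: \<rho>_def field_simps)
  have "(\<lambda>T. (\<Sum>t. pp t) - (\<Sum>t<T. pp t)) \<longlonglongrightarrow> (\<Sum>t. pp t) - (\<Sum>t. pp t)"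
    by (intro tendsto_intros summable_LIMSEQ p)
  then have "\<forall>\<^sub>F T in sequentially. (\<Sum>t. pp t) - (\<Sum>t<T. pp t) < \<rho> * (e / 4)"
    using \<rho>(1) \<open>e > 0\<close> by (intro order_tendstoD(2)) auto
  moreover have "\<forall>\<^sub>F T in sequentially. norm ((\<Sum>t<T. h t) - (\<Sum>t. h t)) < e / 4"
    unfolding dist_norm[symmetric] using \<open>e > 0\<close> by (intro tendstoD summable_LIMSEQ h) simp
  ultimately have "\<forall>\<^sub>F T in sequentially. (\<Sum>t. pp t) - (\<Sum>t<T. pp t) < \<rho> * (e / 4) \<and>
      norm ((\<Sum>t<T. h t) - (\<Sum>t. h t)) < e / 4"
    by (rule eventually_conj)
  then obtain T where T: "(\<Sum>t. pp t) - (\<Sum>t<T. pp t) < \<rho> * (e / 4)"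
      "norm ((\<Sum>t<T. h t) - (\<Sum>t. h t)) < e / 4"
    by (auto simp: eventually_sequentially)
  have "(\<lambda>k. \<Sum>t<T. g k t) \<longlonglongrightarrow> (\<Sum>t<T. h t)"
    by (intro tendsto_sum lim)
  then have "\<forall>\<^sub>F k in sequentially. norm ((\<Sum>t<T. g k t) - (\<Sum>t<T. h t)) < e / 4"
    unfolding dist_norm[symmetric] using \<open>e > 0\<close> by (intro tendstoD) simp_all
  then obtain k0 where k0: "\<And>k. k0 \<le> k \<Longrightarrow> norm ((\<Sum>t<T. g k t) - (\<Sum>t<T. h t)) < e / 4"
    by (auto simp: eventually_sequentially)
  have "norm ((\<Sum>t<r k. g k t) - (\<Sum>t. h t)) < e" if k: "max k0 T \<le> k" for k
  proof -
    have Tr: "T \<le> r k" using seq_suble[OF r, of k] k by linarith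
    have split: "(\<Sum>t<r k. f t) = (\<Sum>t<T. f t) + (\<Sum>t\<in>{T..<r k}. f t)" for f :: "nat \<Rightarrow> 'z::comm_monoid_add"
      using Tr sum.atLeastLessThan_concat[of 0 T "r k" f] by (simp add: atLeast0LessThan)
    have "norm (\<Sum>t\<in>{T..<r k}. g k t) \<le> (\<Sum>t\<in>{T..<r k}. (\<rho> * qq k t + pp t / \<rho>) / 2)"
      by (intro sum_norm_le b \<rho>)
    also have "\<dots> = (\<rho> * (\<Sum>t\<in>{T..<r k}. qq k t) + (\<Sum>t\<in>{T..<r k}. pp t) / \<rho>) / 2"
      by (simp add: sum.distrib sum_distrib_left flip: sum_divide_distrib)
    also have "\<dots> \<le> (\<rho> * K + e / 4) / 2"
    proof -
      have "(\<Sum>t\<in>{T..<r k}. qq k t) \<le> K"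
        using split[of "qq k"] q(2)[of k] sum_nonneg[of "{..<T}" "qq k"] q(1) by fastforce
      moreover have "(\<Sum>t<r k. pp t) \<le> (\<Sum>t. pp t)"
        using p by (intro sum_le_suminf) auto
      then have "(\<Sum>t\<in>{T..<r k}. pp t) \<le> \<rho> * (e / 4)"
        using split[of pp] T(1) by linarith
      ultimately show ?thesis
        using \<rho>(1) by (intro divide_right_mono add_mono mult_left_mono) (auto simp: field_simps)
    qed
    also have "\<dots> \<le> 3 * e / 8" using \<rho>(2) by (simp add: mult_ac)
    finally have tail: "norm (\<Sum>t\<in>{T..<r k}. g k t) \<le> 3 * e / 8" .
    have "(\<Sum>t<r k. g k t) - (\<Sum>t. h t) = ((\<Sum>t<T. g k t) - (\<Sum>t<T. h t))
        + ((\<Sum>t<T. h t) - (\<Sum>t. h t)) + (\<Sum>t\<in>{T..<r k}. g k t)"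
      by (simp add: split)
    then have "norm ((\<Sum>t<r k. g k t) - (\<Sum>t. h t)) \<le> norm ((\<Sum>t<T. g k t) - (\<Sum>t<T. h t))
        + norm ((\<Sum>t<T. h t) - (\<Sum>t. h t)) + norm (\<Sum>t\<in>{T..<r k}. g k t)"
      by (metis norm_triangle_le norm_triangle_ineq add_mono order_refl)
    also have "\<dots> < e" using k0[of k] k T(2) tail \<open>e > 0\<close> by linarith
    finally show ?thesis .
  qed
  then show "\<exists>k0. \<forall>k\<ge>k0. norm ((\<Sum>t<r k. g k t) - (\<Sum>t. h t)) < e" by blast
qed

context disconjugate_system
begin

text \<open>Solutions are represented by their values at 1, which places them in a fixed
  finite-dimensional space for every parameter.\<close>

definition l2_solutions :: "complex \<Rightarrow> 'n cpair set" where
  "l2_solutions \<mu> = {a. sol \<mu> a \<in> l2W W}"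

lemma sol_eq_0: "sol \<mu> a = (\<lambda>_. 0) \<Longrightarrow> a = 0"
  using sol_1(1)[of \<mu> a] by simp

text \<open>The norms \<open>s k\<close> might lose mass in the limit, but the pairing
  \<open>a k\<close> with p tends to the squared norm \<open>n\<close> of p. The energy identity
  expresses what is needed through \<open>a k\<close>.\<close>

lemma dirichlet_limit_trivial:
  assumes co: "coercive \<mu> c" and p: "\<forall>t. inhom \<nu> (\<lambda>_. 0) p t" "p \<in> l2W W"
    and X: "\<And>k. dirichlet \<mu> (\<lambda>t. (\<nu> - \<mu>) *s fst (p (Suc t))) (X k) (r k)"
    and r: "strict_mono r" and lim: "\<And>t. (\<lambda>k. X k t) \<longlonglongrightarrow> p t"
    and cases: "\<nu> = - \<i> \<and> \<mu> = Lam \<or> \<nu> = Lam \<and> \<mu> = - \<i>"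
  shows "p = (\<lambda>_. 0)"
proof -
  define a where "a k = (\<Sum>t<r k. cdot (fst (X k (Suc t))) (W t *v fst (p (Suc t))))" for k
  define s where "s k = (\<Sum>t<r k. qW t (fst (X k (Suc t))))" for k
  define e where "e k = (\<Sum>t<r k. energy (X k) t)" for k
  define n where "n = (\<Sum>t. qW t (fst (p (Suc t))))"
  have psum: "summable (\<lambda>t. qW t (fst (p (Suc t))))"
    using p(2) by (simp add: l2W_iff)
  have cpos: "c > 0" using co by (simp add: coercive_def)
  have sK: "s k \<le> (cmod (\<nu> - \<mu>))\<^sup>2 * n / c\<^sup>2" for k
  proof -
    have "s k \<le> (\<Sum>t<r k. qW t ((\<nu> - \<mu>) *s fst (p (Suc t)))) / c\<^sup>2"
      unfolding s_def by (rule coercive_bound[OF co X])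
    also have "\<dots> = (cmod (\<nu> - \<mu>))\<^sup>2 * (\<Sum>t<r k. qW t (fst (p (Suc t)))) / c\<^sup>2"
      unfolding qW_scale by (simp add: sum_distrib_left)
    also have "\<dots> \<le> (cmod (\<nu> - \<mu>))\<^sup>2 * n / c\<^sup>2"
      unfolding n_def using psum
      by (intro divide_right_mono mult_left_mono sum_le_suminf) (auto simp: qW_nonneg)
    finally show ?thesis .
  qed
  have "a \<longlonglongrightarrow> (\<Sum>t. complex_of_real (qW t (fst (p (Suc t)))))"
    unfolding a_def
  proof (rule tendsto_sum_dominated[OF r, where qq = "\<lambda>k t. qW t (fst (X k (Suc t)))"
        and pp = "\<lambda>t. qW t (fst (p (Suc t)))"])
    show "(\<lambda>k. cdot (fst (X k (Suc t))) (W t *v fst (p (Suc t)))) \<longlonglongrightarrow> complex_of_real (qW t (fst (p (Suc t))))" for t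
      unfolding of_real_qW by (intro tendsto_cdot tendsto_fst lim tendsto_const)
  qed (use W_form_le qW_nonneg sK psum in \<open>auto simp: s_def intro: summable_of_real\<close>)
  also have "(\<Sum>t. complex_of_real (qW t (fst (p (Suc t))))) = of_real n"
    unfolding n_def by (rule suminf_of_real[OF psum, symmetric])
  finally have a: "a \<longlonglongrightarrow> of_real n" .
  have id: "complex_of_real (e k) = \<mu> * of_real (s k) + (\<nu> - \<mu>) * a k" for k
    using energy_sum[OF X[of k]] unfolding vector_scalar_commute cdot_scale_right
    by (simp add: e_def s_def a_def sum_distrib_left)
  have le: "lam0 * s k \<le> e k" for k
    unfolding s_def e_def by (rule key_dirichlet[OF X])
  have Rea: "(\<lambda>k. Re (a k)) \<longlonglongrightarrow> n" and Ima: "(\<lambda>k. Im (a k)) \<longlonglongrightarrow> 0"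
    using tendsto_Re[OF a] tendsto_Im[OF a] by auto
  have "n \<le> 0"
    using cases
  proof
    assume c: "\<nu> = - \<i> \<and> \<mu> = Lam"
    \<comment> \<open>Here \<open>s k\<close> has a real coefficient and leaves the imaginary part,
      so \<open>n\<close> is a multiple of the limit 0.\<close>
    have "Re (a k) = - lam * Im (a k)" for k
      using arg_cong[OF id[of k], of Im] c by simp
    then have "(\<lambda>k. Re (a k)) \<longlonglongrightarrow> - lam * 0"
      using tendsto_mult_left[OF Ima, of "- lam"] by simp
    with Rea show ?thesis using LIMSEQ_unique by fastforce
  next
    assume c: "\<nu> = Lam \<and> \<mu> = - \<i>"
    \<comment> \<open>Now the imaginary part yields convergence of \<open>s\<close> to
      \<open>n\<close> and the real part that of the energy to \<open>lam * n\<close>; this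
      contradicts the lower bound \<open>lam0\<close> unless \<open>n\<close> vanishes.\<close>
    have "s = (\<lambda>k. Re (a k) + lam * Im (a k))"
      using arg_cong[OF id, of Im] c by (intro ext) (simp add: add.commute)
    then have s: "s \<longlonglongrightarrow> n"
      using tendsto_add[OF Rea tendsto_mult_left[OF Ima, of lam]] by simp
    have "e = (\<lambda>k. lam * Re (a k) - Im (a k))"
      using arg_cong[OF id, of Re] c by (intro ext) simp
    then have e: "e \<longlonglongrightarrow> lam * n"
      using tendsto_diff[OF tendsto_mult_left[OF Rea, of lam] Ima] by simp
    have "lam0 * n \<le> lam * n"
      by (rule LIMSEQ_le[OF tendsto_mult_left[OF s] e]) (use le in blast)
    then have "(lam0 - lam) * n \<le> 0" by (simp add: left_diff_distrib)
    then show ?thesis using lam_less by (simp add: mult_le_0_iff)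
  qed
  then have "(\<Sum>t<section_end. qW t (fst (p (Suc t)))) \<le> 0"
    using sum_le_suminf[OF psum, of "{..<section_end}"] by (auto simp: n_def qW_nonneg)
  then show ?thesis using definite_zero[OF p(1)] by blast
qed

text \<open>The map is fixed on a basis only. A relation among the images says that the same
  combination of limits equals a solution at \<nu>, which \<open>dirichlet_limit_trivial\<close>
  forces to be zero.\<close>

lemma dim_l2_solutions_le:
  assumes co: "coercive \<mu> c" and cases: "\<nu> = - \<i> \<and> \<mu> = Lam \<or> \<nu> = Lam \<and> \<mu> = - \<i>"
  shows "cpair.dim (l2_solutions \<nu>) \<le> cpair.dim (l2_solutions \<mu>)"
proof -
  obtain b where b: "b \<subseteq> l2_solutions \<nu>" "cpair.independent b" "card b = cpair.dim (l2_solutions \<nu>)"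
    by (rule cpair.basis_exists)
  have fin: "finite b" using b(2) by (rule cpair_independent_finite)
  define f where "f a t = (\<nu> - \<mu>) *s fst (sol \<nu> a (Suc t))" for a t
  have "summable (\<lambda>t. qW t (f a t))" if "a \<in> b" for a
    using that b(1) unfolding f_def qW_scale l2_solutions_def l2W_iff by (intro summable_mult) auto
  then obtain r X x where r: "strict_mono r"
    and X: "\<And>a k. a \<in> b \<Longrightarrow> dirichlet \<mu> (f a) (X a k) (r k)"
    and lim: "\<And>a t. a \<in> b \<Longrightarrow> (\<lambda>k. X a k t) \<longlonglongrightarrow> x a t"
    and x: "\<And>a t. a \<in> b \<Longrightarrow> inhom \<mu> (f a) (x a) t" "\<And>a. a \<in> b \<Longrightarrow> x a \<in> l2W W"
    using dirichlet_limits[OF co fin, of f] by blast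
  define T where "T a = a - x a 1" for a
  have solT: "sol \<mu> (T a) = (\<lambda>t. sol \<nu> a t - x a t)" if "a \<in> b" for a
  proof -
    have "inhom \<mu> (\<lambda>t. 0 + (\<nu> - \<mu>) *s fst (sol \<nu> a (Suc t))) (sol \<nu> a) t" for t
      using inhom_shift[of \<nu> "\<lambda>_. 0" "sol \<nu> a" t \<mu>] sol_inhom[of \<nu> a t] by blast
    then have "inhom \<mu> (\<lambda>t. f a t - f a t) (\<lambda>t. sol \<nu> a t - x a t) t" for t
      using x(1)[OF that] unfolding f_def by (intro inhom_diff) simp_all
    then have "\<forall>t. inhom \<mu> (\<lambda>_. 0) (\<lambda>t. sol \<nu> a t - x a t) t" by simp
    from sol_unique[OF this] show ?thesis by (simp add: T_def)
  qed
  have "T a \<in> l2_solutions \<mu>" if "a \<in> b" for a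
    using that b(1) x(2)[OF that] l2W_diff[of "sol \<nu> a" "x a"]
    unfolding l2_solutions_def by (auto simp: solT)
  then have Tb: "T ` b \<subseteq> l2_solutions \<mu>" by blast
  have "\<forall>a\<in>b. d a = 0" if d: "(\<Sum>a\<in>b. pscale (d a) (T a)) = 0" for d
  proof -
    define p where "p t = (\<Sum>a\<in>b. pscale (d a) (sol \<nu> a t))" for t
    have "(\<Sum>a\<in>b. pscale (d a) (sol \<nu> a t) - pscale (d a) (x a t)) = 0" for t
    proof -
      have "(\<Sum>a\<in>b. pscale (d a) (sol \<mu> (T a) t)) = 0"
        using sol_sum[OF fin, of \<mu> d T t] d by (simp add: sol_zero)
      then show ?thesis by (simp add: solT cpair.scale_right_diff_distrib cong: sum.cong)
    qed
    then have px: "p t = (\<Sum>a\<in>b. pscale (d a) (x a t))" for t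
      by (simp add: p_def sum_subtractf)
    have psol: "p = sol \<nu> (\<Sum>a\<in>b. pscale (d a) a)"
      by (simp add: fun_eq_iff p_def sol_sum[OF fin])
    have "p = (\<lambda>_. 0)"
    proof (rule dirichlet_limit_trivial[OF co _ _ _ r _ cases])
      show "\<forall>t. inhom \<nu> (\<lambda>_. 0) p t" by (simp add: psol sol_inhom)
      show "p \<in> l2W W"
        unfolding p_def[abs_def] using b(1) by (intro l2W_sum fin) (auto simp: l2_solutions_def)
      have fp: "(\<Sum>a\<in>b. d a *s f a t) = (\<nu> - \<mu>) *s fst (p (Suc t))" for t
        by (simp add: p_def f_def fst_sum vec_eq_iff sum_distrib_left sum_subtractf algebra_simps)
      show "dirichlet \<mu> (\<lambda>t. (\<nu> - \<mu>) *s fst (p (Suc t))) (\<lambda>t. \<Sum>a\<in>b. pscale (d a) (X a k t)) (r k)" for k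
        unfolding dirichlet_def fp[symmetric]
        using X by (auto simp: dirichlet_def fst_sum intro!: inhom_sum[OF fin])
      show "(\<lambda>k. \<Sum>a\<in>b. pscale (d a) (X a k t)) \<longlonglongrightarrow> p t" for t
        unfolding px
      proof (intro tendsto_sum)
        fix a assume "a \<in> b"
        have "linear (\<lambda>q :: 'n cpair. pscale (d a) q)"
          by (intro linearI) (simp_all add: prod_eq_iff vec_eq_iff algebra_simps)
        then have "bounded_linear (\<lambda>q :: 'n cpair. pscale (d a) q)" by (simp add: linear_conv_bounded_linear)
        then show "(\<lambda>k. pscale (d a) (X a k t)) \<longlonglongrightarrow> pscale (d a) (x a t)"
          by (rule bounded_linear.tendsto) (rule lim[OF \<open>a \<in> b\<close>])
      qed
    qed
    then have "(\<Sum>a\<in>b. pscale (d a) a) = 0"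
      unfolding psol by (rule sol_eq_0)
    then show ?thesis using b(2) unfolding cpair.dependent_finite[OF fin] by blast
  qed
  then have "inj_on T b" "cpair.independent (T ` b)"
    using cpair.family_independent[OF fin, of T] by blast+
  then have "card b \<le> cpair.dim (l2_solutions \<mu>)"
    using cpair_card_le_dim[OF _ Tb] by (simp add: card_image)
  then show ?thesis using b(3) by simp
qed

lemma dim_l2_solutions_eq:
  "cpair.dim (l2_solutions (- \<i>)) = cpair.dim (l2_solutions Lam)"
  using dim_l2_solutions_le[OF coercive_real] dim_l2_solutions_le[OF coercive_imaginary]
  by (intro antisym) auto

end

section \<open>Classes of sequences and the minimal relation\<close>

text \<open>The map sending a to the functional \<beta>(a, .) is injective by testing with a itself,
  hence surjective by dimension.\<close>

lemma Riesz_bilinear: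
  fixes \<beta> :: "'a::euclidean_space \<Rightarrow> 'a \<Rightarrow> real"
  assumes "bilinear \<beta>" "\<And>a. \<beta> a a = 0 \<Longrightarrow> a = 0" "linear \<phi>"
  shows "\<exists>a. \<forall>q. \<beta> a q = \<phi> q"
proof -
  define L where "L a = (\<Sum>e\<in>Basis. \<beta> a e *\<^sub>R e)" for a
  have lin: "linear L"
    unfolding L_def using assms(1)
    by (intro linearI) (simp_all add: bilinear_ladd bilinear_lmul scaleR_add_left sum.distrib
        scaleR_sum_right)
  have L: "L a \<bullet> e = \<beta> a e" if "e \<in> Basis" for a e
    using that by (simp add: L_def inner_sum_left inner_Basis if_distrib cong: if_cong)
  have linb: "linear (\<beta> a)" for a
    using assms(1) by (simp add: bilinear_def)
  have "inj L"
    unfolding linear_injective_0[OF lin]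
  proof (intro allI impI)
    fix a assume "L a = 0"
    then have "\<beta> a e = 0" if "e \<in> Basis" for e
      using L[OF that, of a] by simp
    then have "\<beta> a = (\<lambda>_. 0)"
      using linear_eq_stdbasis[OF linb linear_zero] by blast
    then show "a = 0" using assms(2)[of a] by simp
  qed
  with lin have "surj L" by (rule linear_inj_imp_surj)
  then obtain a where a: "(\<Sum>e\<in>Basis. \<phi> e *\<^sub>R e) = L a" by (rule surjE)
  have "\<beta> a e = \<phi> e" if "e \<in> Basis" for e
    unfolding L[OF that, symmetric] a[symmetric]
    using that by (simp add: inner_sum_left inner_Basis if_distrib cong: if_cong)
  then have "\<beta> a = \<phi>"
    using linear_eq_stdbasis[OF linb assms(3)] by blast
  then show ?thesis by blast
qed

lemma bform_nondegenerate:
  assumes "\<And>q. bform p q = 0"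
  shows "p = 0"
proof -
  have "cdot (fst p) (fst p) = 0" "cdot (snd p) (snd p) = 0"
    using assms[of "(0, fst p)"] assms[of "(snd p, 0)"] by (simp_all add: bform_alt)
  then show ?thesis by (simp add: cdot_eq_0_iff prod_eq_iff)
qed

section \<open>Classes modulo \<open>W\<close>-null sequences\<close>

context hamiltonian_system
begin

text \<open>Pointwise form of equality in the quotient space: a class determines exactly the vectors
  W(t) u(t+1).\<close>

definition W_sim :: "'n cseq \<Rightarrow> 'n cseq \<Rightarrow> bool" where
  "W_sim y z \<longleftrightarrow> (\<forall>t. W t *v fst (y (Suc t)) = W t *v fst (z (Suc t)))"

lemma cdot_W_commute: "cdot x (W t *v y) = cnj (cdot y (W t *v x))"
  by (simp add: cnj_cdot cdot_hermitian W_herm)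

lemma qW_cong: "W t *v x = W t *v y \<Longrightarrow> qW t x = qW t y"
  by (metis W_herm cdot_hermitian qW_def)

lemma seq_inner_summable:
  assumes "y \<in> l2W W" "z \<in> l2W W"
  shows "summable (\<lambda>t. cdot (fst (z (Suc t))) (W t *v fst (y (Suc t))))"
proof (rule summable_comparison_test')
  show "summable (\<lambda>t. (1 * qW t (fst (z (Suc t))) + qW t (fst (y (Suc t))) / 1) / 2)"
    using assms unfolding l2W_iff
    by (intro summable_divide summable_add summable_mult)
  show "norm (cdot (fst (z (Suc t))) (W t *v fst (y (Suc t))))
      \<le> (1 * qW t (fst (z (Suc t))) + qW t (fst (y (Suc t))) / 1) / 2" for t
    by (rule W_form_le) simp
qed

lemma seq_inner_alt: "seq_inner W y z = (\<Sum>t. cdot (fst (z (Suc t))) (W t *v fst (y (Suc t))))"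
  by (simp add: seq_inner_def)

lemma seq_inner_self:
  assumes "y \<in> l2W W"
  shows "seq_inner W y y = of_real (\<Sum>t. qW t (fst (y (Suc t))))"
  using suminf_of_real[OF assms[unfolded l2W_iff], where 'a = complex]
  by (simp add: seq_inner_alt of_real_qW)

lemma seq_inner_cong: "W_sim y y' \<Longrightarrow> W_sim z z' \<Longrightarrow> seq_inner W y z = seq_inner W y' z'"
proof -
  assume "W_sim y y'" "W_sim z z'"
  then have "cdot (fst (z (Suc t))) (W t *v fst (y (Suc t))) = cdot (fst (z' (Suc t))) (W t *v fst (y' (Suc t)))" for t
    unfolding W_sim_def by (metis cdot_W_commute)
  then show ?thesis by (simp add: seq_inner_alt)
qed

lemma l2W_cong: "W_sim y z \<Longrightarrow> y \<in> l2W W \<longleftrightarrow> z \<in> l2W W"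
proof -
  assume "W_sim y z"
  then have "qW t (fst (y (Suc t))) = qW t (fst (z (Suc t)))" for t
    by (intro qW_cong) (simp add: W_sim_def)
  then show ?thesis by (simp add: l2W_iff)
qed

lemma l2W_rel_iff: "(y, z) \<in> l2W_rel W \<longleftrightarrow> y \<in> l2W W \<and> z \<in> l2W W \<and> W_sim y z"
proof -
  have "seq_inner W (\<lambda>t. y t - z t) (\<lambda>t. y t - z t) = 0 \<longleftrightarrow> W_sim y z"
    if yz: "y \<in> l2W W" "z \<in> l2W W"
  proof -
    have d: "(\<lambda>t. y t - z t) \<in> l2W W" by (rule l2W_diff[OF yz])
    have "(\<Sum>t. qW t (fst (y (Suc t)) - fst (z (Suc t)))) = 0
        \<longleftrightarrow> (\<forall>t. qW t (fst (y (Suc t)) - fst (z (Suc t))) = 0)"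
      using d by (intro suminf_eq_zero_iff) (simp_all add: l2W_iff qW_nonneg)
    then show ?thesis
      unfolding seq_inner_self[OF d] by (simp add: qW_0_iff matrix_vector_mult_diff_distrib W_sim_def)
  qed
  then show ?thesis by (auto simp: l2W_rel_def)
qed

lemma W_sim_refl: "W_sim y y"
  and W_sim_sym: "W_sim y z \<Longrightarrow> W_sim z y"
  by (simp_all add: W_sim_def)

lemma W_sim_add: "W_sim y y' \<Longrightarrow> W_sim z z' \<Longrightarrow> W_sim (\<lambda>t. y t + z t) (\<lambda>t. y' t + z' t)"
  and W_sim_diff: "W_sim y y' \<Longrightarrow> W_sim z z' \<Longrightarrow> W_sim (\<lambda>t. y t - z t) (\<lambda>t. y' t - z' t)"
  and W_sim_pscale: "W_sim y y' \<Longrightarrow> W_sim (\<lambda>t. pscale c (y t)) (\<lambda>t. pscale c (y' t))"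
  by (simp_all add: W_sim_def matrix_vector_right_distrib matrix_vector_mult_diff_distrib
      vector_scalar_commute)

lemma W_sim_sum:
  "finite S \<Longrightarrow> (\<And>i. i \<in> S \<Longrightarrow> W_sim (y i) (z i)) \<Longrightarrow>
    W_sim (\<lambda>t. \<Sum>i\<in>S. pscale (c i) (y i t)) (\<lambda>t. \<Sum>i\<in>S. pscale (c i) (z i t))"
  by (induction S rule: finite_induct) (simp_all add: W_sim_refl W_sim_add W_sim_pscale)

lemma mem_cls: "z \<in> cls W y \<longleftrightarrow> y \<in> l2W W \<and> z \<in> l2W W \<and> W_sim y z"
  by (simp add: cls_def l2W_rel_iff)

lemma cls_eq_iff: "y \<in> l2W W \<Longrightarrow> z \<in> l2W W \<Longrightarrow> cls W y = cls W z \<longleftrightarrow> W_sim y z"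
proof
  assume "y \<in> l2W W" "z \<in> l2W W" "cls W y = cls W z"
  then show "W_sim y z" using mem_cls[of z y] mem_cls[of z z] by (simp add: W_sim_refl)
next
  assume "y \<in> l2W W" "z \<in> l2W W" "W_sim y z"
  then show "cls W y = cls W z" by (simp add: set_eq_iff mem_cls) (simp add: W_sim_def)
qed

lemma cls_in_L2W: "y \<in> l2W W \<Longrightarrow> cls W y \<in> L2W W"
  unfolding L2W_def cls_def by (rule quotientI)

lemma L2W_cases:
  assumes "X \<in> L2W W"
  obtains y where "y \<in> l2W W" "X = cls W y"
  using assms unfolding L2W_def cls_def by (rule quotientE)

lemma L2W_mem:
  assumes "X \<in> L2W W" "y \<in> X"
  shows "y \<in> l2W W" "cls W y = X"
proof -
  obtain z where z: "z \<in> l2W W" "X = cls W z" using assms(1) by (rule L2W_cases)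
  then have "y \<in> l2W W \<and> W_sim z y" using assms(2) by (simp add: mem_cls)
  then show "y \<in> l2W W" "cls W y = X" using z cls_eq_iff[of y z] W_sim_sym by auto
qed

lemma rep_mem: "X \<in> L2W W \<Longrightarrow> rep X \<in> X"
proof -
  assume "X \<in> L2W W"
  then obtain y where "y \<in> l2W W" "X = cls W y" by (rule L2W_cases)
  then have "y \<in> X" by (simp add: mem_cls W_sim_refl)
  then show ?thesis unfolding rep_def by (rule someI[where P = "\<lambda>y. y \<in> X"])
qed

lemma rep_sim:
  assumes "y \<in> l2W W"
  shows "W_sim y (rep (cls W y))" "rep (cls W y) \<in> l2W W"
  using rep_mem[OF cls_in_L2W[OF assms]] by (auto simp: mem_cls)

lemma L2_inner_cls: "y \<in> l2W W \<Longrightarrow> z \<in> l2W W \<Longrightarrow> L2_inner W (cls W y) (cls W z) = seq_inner W y z"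
  unfolding L2_inner_def by (intro seq_inner_cong W_sim_sym[OF rep_sim(1)])

lemma L2_diff_scale_cls:
  assumes "y \<in> l2W W" "z \<in> l2W W"
  shows "L2_diff_scale W (cls W y) c (cls W z) = cls W (\<lambda>t. y t - pscale c (z t))"
  unfolding L2_diff_scale_def using assms
  by (subst cls_eq_iff) (auto intro!: l2W_diff l2W_pscale rep_sim(2) W_sim_diff W_sim_pscale W_sim_sym[OF rep_sim(1)])

lemma L2_dist_cls:
  assumes "y \<in> l2W W" "z \<in> l2W W"
  shows "L2_dist W (cls W y) (cls W z) = sqrt (\<Sum>t. qW t (fst (y (Suc t)) - fst (z (Suc t))))"
  using l2W_diff[OF assms] assms
  by (simp add: L2_dist_def Let_def L2_diff_scale_cls L2_inner_cls seq_inner_self)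

section \<open>The relations expressed through representatives\<close>

lemma H_max_iff:
  "(X, X') \<in> H_max A B C W \<longleftrightarrow> (\<exists>y y'. y \<in> l2W W \<and> y' \<in> l2W W \<and> X = cls W y \<and> X' = cls W y' \<and>
     relation_eq A B C W y y')"
proof
  assume "(X, X') \<in> H_max A B C W"
  then show "\<exists>y y'. y \<in> l2W W \<and> y' \<in> l2W W \<and> X = cls W y \<and> X' = cls W y' \<and> relation_eq A B C W y y'"
    unfolding H_max_def using L2W_mem by blast
next
  assume "\<exists>y y'. y \<in> l2W W \<and> y' \<in> l2W W \<and> X = cls W y \<and> X' = cls W y' \<and> relation_eq A B C W y y'"
  then show "(X, X') \<in> H_max A B C W"
    unfolding H_max_def using cls_in_L2W mem_cls W_sim_refl by blast
qed

lemma H_00_iff: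
  "(X, X') \<in> H_00 A B C W \<longleftrightarrow> (\<exists>y y'. y \<in> l2W0 W \<and> y' \<in> l2W W \<and> X = cls W y \<and> X' = cls W y' \<and>
     relation_eq A B C W y y')"
proof
  assume "(X, X') \<in> H_00 A B C W"
  then show "\<exists>y y'. y \<in> l2W0 W \<and> y' \<in> l2W W \<and> X = cls W y \<and> X' = cls W y' \<and> relation_eq A B C W y y'"
    unfolding H_00_def H_max_def using L2W_mem by blast
next
  assume "\<exists>y y'. y \<in> l2W0 W \<and> y' \<in> l2W W \<and> X = cls W y \<and> X' = cls W y' \<and> relation_eq A B C W y y'"
  then obtain y y' where y: "y \<in> l2W0 W" "y' \<in> l2W W" "X = cls W y" "X' = cls W y'" "relation_eq A B C W y y'"
    by blast
  then have "y \<in> l2W W" by (simp add: l2W0_def)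
  then have "(X, X') \<in> H_max A B C W" "y \<in> X" "y' \<in> X'"
    using y mem_cls W_sim_refl H_max_iff by blast+
  then show "(X, X') \<in> H_00 A B C W"
    unfolding H_00_def using y by blast
qed

lemma H_00_subset_H_min: "H_00 A B C W \<subseteq> H_min A B C W"
proof clarify
  fix X X' assume XX: "(X, X') \<in> H_00 A B C W"
  then have L: "X \<in> L2W W" "X' \<in> L2W W" by (auto simp: H_00_def H_max_def)
  have "L2_dist W Y Y = 0" if "Y \<in> L2W W" for Y
    using that by (rule L2W_cases) (simp add: L2_dist_cls qW_def)
  then show "(X, X') \<in> H_min A B C W"
    using XX L unfolding H_min_def relation_closure_def by force
qed

section \<open>Green's formula and the range of the minimal relation\<close>

lemma bform_sum:
  assumes "\<forall>t. inhom \<mu> f y t" "\<forall>t. inhom \<nu> g z t" "\<mu> = cnj \<nu>"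
  shows "bform (y N) (z N) = bform (y 0) (z 0)
    + (\<Sum>t<N. cdot (fst (z (Suc t))) (W t *v f t) - cdot (g t) (W t *v fst (y (Suc t))))"
  by (induction N) (use bform_step[OF assms(1)[rule_format] assms(2)[rule_format]] assms(3) in auto)

lemma sol_at_surj: "\<exists>a. sol \<mu> a N = p"
proof -
  have lin: "linear (\<lambda>a. sol \<mu> a N)"
    by (intro linearI) (simp_all add: sol_add sol_pscale flip: pscale_of_real)
  have "inj (\<lambda>a. sol \<mu> a N)"
    unfolding linear_injective_0[OF lin]
  proof (intro allI impI)
    fix a assume "sol \<mu> a N = 0"
    then have "sol \<mu> a = (\<lambda>_. 0)"
      by (intro inhom_unique[where s = N and \<mu> = \<mu> and f = "\<lambda>_. 0"]) (simp_all add: sol_inhom inhom_zero)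
    then show "a = 0" using sol_1(1)[of \<mu> a] by simp
  qed
  with lin have "surj (\<lambda>a. sol \<mu> a N)" by (rule linear_inj_imp_surj)
  then obtain a where "p = sol \<mu> a N" by (rule surjE)
  then show ?thesis by blast
qed

text \<open>The tested sequence is the right-hand side of \<open>z\<close> at parameter
  \<open>cnj \<mu>\<close>; Green's formula has no boundary terms since \<open>z\<close> vanishes at
  0 and eventually.\<close>

lemma seq_inner_solution_H_00:
  assumes y: "\<forall>t. inhom \<mu> (\<lambda>_. 0) y t" and z: "z \<in> l2W0 W" "relation_eq A B C W z z'"
  shows "seq_inner W y (\<lambda>t. z' t - pscale (cnj \<mu>) (z t)) = 0"
proof -
  let ?h = "\<lambda>t. fst (z' (Suc t)) - cnj \<mu> *s fst (z (Suc t))"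
  obtain s where s: "\<And>t. t \<ge> s \<Longrightarrow> z t = 0" "z 0 = 0" using z(1) by (auto simp: l2W0_def)
  have "inhom 0 (\<lambda>t. ?h t + (cnj \<mu> - 0) *s fst (z (Suc t))) z t" for t
    using z(2) by (simp add: relation_eq_iff)
  then have "\<forall>t. inhom (cnj \<mu>) ?h z t"
    using inhom_shift[of "cnj \<mu>" ?h z _ 0] by blast
  note Green = bform_sum[OF this y refl]
  have 0: "(\<Sum>t<N. cdot (fst (y (Suc t))) (W t *v ?h t)) = 0" if "s \<le> N" for N
    using Green[of N] s(1)[OF that] s(2) by (simp add: bform_alt)
  have "(\<lambda>t. cdot (?h t) (W t *v fst (y (Suc t)))) sums 0"
    unfolding sums_def
  proof (rule Lim_transform_eventually[OF tendsto_const])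
    show "\<forall>\<^sub>F N in sequentially. 0 = (\<Sum>t<N. cdot (?h t) (W t *v fst (y (Suc t))))"
      using eventually_ge_at_top[of s]
    proof eventually_elim
      case (elim N)
      have "(\<Sum>t<N. cdot (?h t) (W t *v fst (y (Suc t)))) = cnj (\<Sum>t<N. cdot (fst (y (Suc t))) (W t *v ?h t))"
        unfolding cnj_sum by (intro sum.cong refl cdot_W_commute)
      then show ?case using 0[OF elim] by simp
    qed
  qed
  then show ?thesis by (simp add: seq_inner_alt sums_iff)
qed

text \<open>Orthogonality is immediate on the preminimal relation and passes to its closure by
  approximating both components.\<close>

lemma solution_orthogonal_range:
  assumes y: "\<forall>t. inhom \<mu> (\<lambda>_. 0) y t" "y \<in> l2W W"
  shows "cls W y \<in> L2_orth W (Range (relation_shift W (H_min A B C W) (cnj \<mu>)))"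
proof -
  have "L2_inner W (cls W y) Z = 0" if Z: "Z \<in> Range (relation_shift W (H_min A B C W) (cnj \<mu>))" for Z
  proof -
    obtain Q Q' where Q: "(Q, Q') \<in> H_min A B C W" "Z = L2_diff_scale W Q' (cnj \<mu>) Q"
      using Z by (auto simp: relation_shift_def)
    then have "Q \<in> L2W W" "Q' \<in> L2W W" by (auto simp: H_min_def relation_closure_def)
    then obtain q q' where q: "q \<in> l2W W" "Q = cls W q" "q' \<in> l2W W" "Q' = cls W q'"
      by (metis L2W_cases)
    define h where "h = (\<lambda>t. q' t - pscale (cnj \<mu>) (q t))"
    have h: "h \<in> l2W W" unfolding h_def using q by (intro l2W_diff l2W_pscale)
    have inner: "L2_inner W (cls W y) Z = seq_inner W y h"
      using y(2) h q by (simp add: Q(2) L2_diff_scale_cls h_def L2_inner_cls)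
    define Y where "Y = (\<Sum>t. qW t (fst (y (Suc t))))"
    have ysum: "summable (\<lambda>t. qW t (fst (y (Suc t))))" using y(2) by (simp add: l2W_iff)
    have Y: "0 \<le> Y" using suminf_nonneg[OF ysum] by (simp add: Y_def qW_nonneg)
    \<comment> \<open>\<open>c\<close> collects the factors of \<open>e\<close> in the estimate
      below: 2 from the second component, 2|\<mu>|^2 from the first, \<open>Y\<close> from
      \<open>y\<close>.\<close>
    define c where "c = 2 + 2 * (cmod \<mu>)\<^sup>2 + Y"
    have bound: "cmod (seq_inner W y h) \<le> e * c / 2" if "e > 0" for e
    proof -
      obtain R R' where R: "(R, R') \<in> H_00 A B C W" "L2_dist W Q R < e" "L2_dist W Q' R' < e"
        using Q(1) \<open>e > 0\<close> unfolding H_min_def relation_closure_def by blast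
      then obtain r r' where r: "r \<in> l2W0 W" "r' \<in> l2W W" "R = cls W r" "R' = cls W r'"
          "relation_eq A B C W r r'"
        by (auto simp: H_00_iff)
      have r2: "r \<in> l2W W" using r(1) by (simp add: l2W0_def)
      define g where "g = (\<lambda>t. r' t - pscale (cnj \<mu>) (r t))"
      have g: "g \<in> l2W W" unfolding g_def using r2 r by (intro l2W_diff l2W_pscale)
      have "seq_inner W y g = 0"
        unfolding g_def using seq_inner_solution_H_00[OF y(1) r(1,5)] .
      define D where "D t = qW t (fst (q' (Suc t)) - fst (r' (Suc t)))" for t
      define E where "E t = qW t (fst (q (Suc t)) - fst (r (Suc t)))" for t
      have DE: "summable D" "summable E"
        using l2W_diff[OF q(3) r(2)] l2W_diff[OF q(1) r2] by (simp_all add: l2W_iff D_def[abs_def] E_def[abs_def])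
      have "x < e\<^sup>2" if "sqrt x < e" for x
        using that real_le_rsqrt[of e x] by force
      then have DEe: "(\<Sum>t. E t) < e\<^sup>2" "(\<Sum>t. D t) < e\<^sup>2"
        using R(2,3) by (simp_all add: q r L2_dist_cls r2 D_def E_def)
      have hq: "qW t (fst (h (Suc t)) - fst (g (Suc t))) \<le> 2 * D t + 2 * (cmod \<mu>)\<^sup>2 * E t" for t
      proof -
        have "fst (h (Suc t)) - fst (g (Suc t)) = (fst (q' (Suc t)) - fst (r' (Suc t)))
            - cnj \<mu> *s (fst (q (Suc t)) - fst (r (Suc t)))"
          by (simp add: h_def g_def vector_ssub_ldistrib)
        then have "qW t (fst (h (Suc t)) - fst (g (Suc t)))
            \<le> 2 * D t + 2 * qW t (cnj \<mu> *s (fst (q (Suc t)) - fst (r (Suc t))))"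
          unfolding D_def by (simp only: qW_diff_le)
        then show ?thesis unfolding qW_scale E_def by (simp add: mult_ac)
      qed
      have "seq_inner W y h = (\<Sum>t. cdot (fst (h (Suc t)) - fst (g (Suc t))) (W t *v fst (y (Suc t))))"
        using \<open>seq_inner W y g = 0\<close> suminf_diff[OF seq_inner_summable[OF y(2) h] seq_inner_summable[OF y(2) g]]
        by (simp add: seq_inner_alt cdot_linear)
      \<comment> \<open>The squared errors are of order e^2, so the weight 1/e balances both halves
        to order e.\<close>
      also have "cmod \<dots> \<le> (\<Sum>t. (1 / e * (2 * D t + 2 * (cmod \<mu>)\<^sup>2 * E t) + qW t (fst (y (Suc t))) * e) / 2)"
      proof (rule norm_suminf_le)
        show "summable (\<lambda>t. (1 / e * (2 * D t + 2 * (cmod \<mu>)\<^sup>2 * E t) + qW t (fst (y (Suc t))) * e) / 2)"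
          by (intro summable_divide summable_add summable_mult summable_mult2 DE ysum)
        fix t
        have "1 / e * qW t (fst (h (Suc t)) - fst (g (Suc t))) \<le> 1 / e * (2 * D t + 2 * (cmod \<mu>)\<^sup>2 * E t)"
          using hq[of t] \<open>e > 0\<close> by (intro mult_left_mono) auto
        then show "cmod (cdot (fst (h (Suc t)) - fst (g (Suc t))) (W t *v fst (y (Suc t))))
            \<le> (1 / e * (2 * D t + 2 * (cmod \<mu>)\<^sup>2 * E t) + qW t (fst (y (Suc t))) * e) / 2"
          using W_form_le[of "1 / e" "fst (h (Suc t)) - fst (g (Suc t))" t "fst (y (Suc t))"] \<open>e > 0\<close>
          by simp
      qed
      also have "\<dots> = (1 / e * (2 * (\<Sum>t. D t) + 2 * (cmod \<mu>)\<^sup>2 * (\<Sum>t. E t)) + Y * e) / 2"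
        unfolding Y_def
        by (intro sums_unique[symmetric] sums_divide sums_add sums_mult sums_mult2 summable_sums DE ysum)
      also have "\<dots> \<le> (1 / e * (2 * e\<^sup>2 + 2 * (cmod \<mu>)\<^sup>2 * e\<^sup>2) + Y * e) / 2"
        using DEe \<open>e > 0\<close> Y
        by (intro divide_right_mono add_mono mult_left_mono) auto
      also have "\<dots> = e * c / 2"
        using \<open>e > 0\<close> by (simp add: c_def field_simps power2_eq_square)
      finally show ?thesis .
    qed
    have "c > 0"
      using Y by (simp add: c_def add_pos_nonneg)
    have "cmod (seq_inner W y h) \<le> 0"
    proof (rule field_le_epsilon)
      fix e :: real assume "0 < e"
      then show "cmod (seq_inner W y h) \<le> 0 + e"
        using bound[of "2 * e / c"] \<open>c > 0\<close> by simp
    qed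
    then show ?thesis by (simp add: inner)
  qed
  then show ?thesis
    using y(2) by (simp add: L2_orth_def cls_in_L2W)
qed

end

section \<open>The defect index\<close>

context disconjugate_system
begin

text \<open>Orthogonality of \<open>f\<close> to g - (conjugate of \<mu>) y contains a term in
  \<open>y\<close>; Green's formula for \<open>y\<close> and \<open>z\<close> replaces it by a
  pairing of \<open>z\<close> with \<open>g\<close>.\<close>

lemma orthogonal_test:
  assumes f: "f \<in> l2W W" "cls W f \<in> L2_orth W (Range (relation_shift W (H_min A B C W) (cnj \<mu>)))"
    and z: "\<forall>t. inhom 0 (\<lambda>t. \<mu> *s fst (f (Suc t))) z t" "z 0 = 0"
    and y: "\<forall>t. inhom 0 g y t" "y 0 = 0" "\<forall>t\<ge>N. y t = 0" and g: "\<forall>t\<ge>N. g t = 0"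
  shows "(\<Sum>t<N. cdot (fst (f (Suc t)) - fst (z (Suc t))) (W t *v g t)) = 0"
proof -
  \<comment> \<open>Index shift, as the relation reads u'(t+1). The value at 0 enters neither the
    equation nor the inner product.\<close>
  define y' :: "'n cseq" where "y' t = (g (t - 1), 0)" for t
  have y0: "y (Suc t) = 0" and g0: "g t = 0" if "t \<notin> {..<N}" for t
    using that y(3) g by simp_all
  have "y' \<in> l2W W"
    unfolding l2W_iff by (rule summable_finite[of "{..<N}"]) (simp_all add: y'_def g0 qW_def)
  moreover have "y \<in> l2W W"
    unfolding l2W_iff by (rule summable_finite[of "{..<N}"]) (simp_all add: y0 qW_def)
  ultimately have y'l: "y' \<in> l2W W" and yl: "y \<in> l2W W" .
  have "relation_eq A B C W y y'"
    using y(1) by (simp add: relation_eq_iff y'_def)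
  moreover have "y \<in> l2W0 W" using yl y by (auto simp: l2W0_def)
  ultimately have "(cls W y, cls W y') \<in> H_min A B C W"
    using y'l H_00_subset_H_min H_00_iff by blast
  then have "L2_diff_scale W (cls W y') (cnj \<mu>) (cls W y) \<in> Range (relation_shift W (H_min A B C W) (cnj \<mu>))"
    unfolding relation_shift_def by blast
  then have "L2_inner W (cls W f) (L2_diff_scale W (cls W y') (cnj \<mu>) (cls W y)) = 0"
    using f(2) unfolding L2_orth_def by blast
  then have "seq_inner W f (\<lambda>t. y' t - pscale (cnj \<mu>) (y t)) = 0"
    using f(1) yl y'l by (simp add: L2_diff_scale_cls L2_inner_cls l2W_diff l2W_pscale)
  then have "(\<Sum>t. cdot (g t - cnj \<mu> *s fst (y (Suc t))) (W t *v fst (f (Suc t)))) = 0"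
    by (simp add: seq_inner_alt y'_def)
  also have "(\<Sum>t. cdot (g t - cnj \<mu> *s fst (y (Suc t))) (W t *v fst (f (Suc t))))
      = (\<Sum>t<N. cdot (g t - cnj \<mu> *s fst (y (Suc t))) (W t *v fst (f (Suc t))))"
    by (intro suminf_finite) (simp_all add: y0 g0)
  finally have "cnj (\<Sum>t<N. cdot (g t - cnj \<mu> *s fst (y (Suc t))) (W t *v fst (f (Suc t)))) = 0"
    by simp
  then have "(\<Sum>t<N. cdot (fst (f (Suc t))) (W t *v (g t - cnj \<mu> *s fst (y (Suc t))))) = 0"
    unfolding cnj_sum by (subst (asm) cdot_W_commute) simp
  then have 1: "(\<Sum>t<N. cdot (fst (f (Suc t))) (W t *v g t))
      = cnj \<mu> * (\<Sum>t<N. cdot (fst (f (Suc t))) (W t *v fst (y (Suc t))))"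
    by (simp add: matrix_vector_mult_diff_distrib vector_scalar_commute cdot_linear sum_subtractf
        sum_distrib_left)
  have "(\<Sum>t<N. cdot (fst (z (Suc t))) (W t *v g t))
      = cnj \<mu> * (\<Sum>t<N. cdot (fst (f (Suc t))) (W t *v fst (y (Suc t))))"
    using bform_sum[OF y(1) z(1), of N] y(2,3) z(2)
    by (simp add: bform_alt sum_subtractf cdot_linear sum_distrib_left)
  with 1 show ?thesis by (simp add: cdot_linear sum_subtractf)
qed

text \<open>Least-squares projection onto the homogeneous solutions on a finite interval, where
  definiteness makes the \<open>W\<close>-form nondegenerate.\<close>

lemma projection_on_solutions:
  assumes "section_end \<le> N"
  shows "\<exists>a. \<forall>q. (\<Sum>t<N. cdot (fst (sol 0 q (Suc t))) (W t *v (h t - fst (sol 0 a (Suc t))))) = 0"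
proof -
  let ?u = "\<lambda>a t. fst (sol 0 a (Suc t))"
  define \<beta> where "\<beta> a q = (\<Sum>t<N. Re (cdot (?u q t) (W t *v ?u a t)))" for a q
  define \<phi> where "\<phi> q = (\<Sum>t<N. Re (cdot (?u q t) (W t *v h t)))" for q
  have scale: "sol 0 (r *\<^sub>R a) t = pscale (of_real r) (sol 0 a t)" for r a t
    by (simp add: sol_pscale flip: pscale_of_real)
  have "bilinear \<beta>"
    unfolding bilinear_def \<beta>_def
    by (intro conjI allI linearI) (simp_all add: sol_add scale matrix_vector_right_distrib
        vector_scalar_commute cdot_linear sum.distrib sum_distrib_left)
  moreover have "a = 0" if "\<beta> a a = 0" for a
  proof -
    have "sol 0 a = (\<lambda>_. 0)"
      using that assms sol_inhom by (intro definite_zero[of 0 _ N]) (simp_all add: \<beta>_def qW_def)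
    then show ?thesis by (rule sol_eq_0)
  qed
  moreover have "linear \<phi>"
    unfolding \<phi>_def
    by (intro linearI) (simp_all add: sol_add scale cdot_linear sum.distrib sum_distrib_left)
  ultimately obtain a where a: "\<And>q. \<beta> a q = \<phi> q" using Riesz_bilinear by blast
  define s where "s q = (\<Sum>t<N. cdot (?u q t) (W t *v (h t - ?u a t)))" for q
  have Re: "Re (s q) = 0" for q
    using a[of q] by (simp add: s_def \<beta>_def \<phi>_def matrix_vector_mult_diff_distrib cdot_linear
        sum_subtractf)
  \<comment> \<open>The Riesz argument is real; replacing q by \<i> q turns the imaginary part into
    a real part.\<close>
  have "s (pscale \<i> q) = - \<i> * s q" for q
    by (simp add: s_def sol_pscale cdot_linear sum_distrib_left)
  then have "Im (s q) = 0" for q using Re[of "pscale \<i> q"] by simp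
  then have "s q = 0" for q using Re[of q] by (simp add: complex_eq_iff)
  then show ?thesis unfolding s_def by blast
qed

text \<open>On each truncation, \<open>f\<close> minus a particular solution is orthogonal to every right-hand side
  that admits a compactly supported solution, hence agrees with a solution at \<open>\<lambda> = 0\<close>;
  definiteness makes that solution independent of the truncation.\<close>

lemma orthogonal_range_solution:
  assumes X: "X \<in> L2_orth W (Range (relation_shift W (H_min A B C W) (cnj \<mu>)))"
  shows "\<exists>a\<in>l2_solutions \<mu>. X = cls W (sol \<mu> a)"
proof -
  have "X \<in> L2W W" using X by (simp add: L2_orth_def)
  then obtain f where f: "f \<in> l2W W" "X = cls W f" by (rule L2W_cases)
  obtain z where z: "z 0 = 0" "\<forall>t. inhom 0 (\<lambda>t. \<mu> *s fst (f (Suc t))) z t"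
    using inhom_exists_0 by blast
  define k where "k t = fst (f (Suc t)) - fst (z (Suc t))" for t
  have ex: "\<exists>a. \<forall>t<N. W t *v (k t - fst (sol 0 a (Suc t))) = 0" if N: "section_end \<le> N" for N
  proof -
    obtain a where a: "\<And>q. (\<Sum>t<N. cdot (fst (sol 0 q (Suc t))) (W t *v (k t - fst (sol 0 a (Suc t))))) = 0"
      using projection_on_solutions[OF N, of k] by blast
    define g where "g t = (if t < N then k t - fst (sol 0 a (Suc t)) else 0)" for t
    obtain y where y: "y 0 = 0" "\<forall>t. inhom 0 g y t"
      using inhom_exists_0 by blast
    have g_orth: "(\<Sum>t<N. cdot (fst (sol 0 q (Suc t))) (W t *v g t)) = 0" for q
      using a[of q] by (simp add: g_def cong: sum.cong_simp)
    \<comment> \<open>Each p is the value at N of some homogeneous solution, so orthogonality of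
      \<open>g\<close> to these solutions makes \<open>y\<close> vanish from N on.\<close>
    have "bform (y N) p = 0" for p
    proof -
      obtain q where q: "sol 0 q N = p" using sol_at_surj by blast
      have "\<forall>t. inhom 0 (\<lambda>_. 0) (sol 0 q) t" by (simp add: sol_inhom)
      from bform_sum[OF y(2) this, of N] show ?thesis
        using g_orth[of q] by (simp add: q y(1) bform_alt)
    qed
    then have "y N = 0" by (rule bform_nondegenerate)
    then have "y (N + j) = 0" for j
    proof (induction j)
      case (Suc j)
      have "inhom 0 (\<lambda>_. 0) y (N + j)"
        using y(2)[rule_format, of "N + j"] by (simp add: inhom_def g_def)
      then show ?case
        using inhom_forward[of 0 "\<lambda>_. 0" y "N + j" "\<lambda>_. 0"] Suc by (simp add: inhom_zero)
    qed simp
    then have "\<forall>t\<ge>N. y t = 0" by (auto simp: le_iff_add)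
    moreover have "\<forall>t\<ge>N. g t = 0" by (simp add: g_def)
    ultimately have "(\<Sum>t<N. cdot (k t) (W t *v g t)) = 0"
      using orthogonal_test[OF f(1) X[unfolded f(2)] z(2,1) y(2,1)] unfolding k_def by blast
    then have "(\<Sum>t<N. cdot (k t - fst (sol 0 a (Suc t))) (W t *v g t)) = 0"
      using g_orth[of a] by (simp add: cdot_linear sum_subtractf)
    then have "(\<Sum>t<N. complex_of_real (qW t (g t))) = 0"
      unfolding of_real_qW by (simp add: g_def cong: sum.cong_simp)
    then have "(\<Sum>t<N. qW t (g t)) = 0"
      by (simp flip: of_real_sum)
    then have "\<forall>t<N. qW t (g t) = 0"
      by (subst (asm) sum_nonneg_eq_0_iff) (auto simp: qW_nonneg)
    then have "\<forall>t<N. W t *v (k t - fst (sol 0 a (Suc t))) = 0" by (simp add: qW_0_iff g_def)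
    then show ?thesis by blast
  qed
  obtain a where a: "\<forall>t<section_end. W t *v (k t - fst (sol 0 a (Suc t))) = 0"
    using ex[of section_end] by blast
  have all: "W t *v (k t - fst (sol 0 a (Suc t))) = 0" for t
  proof -
    \<comment> \<open>A longer truncation gives \<open>a'\<close>; both solutions agree modulo
      \<open>W\<close> up to \<open>section_end\<close>, hence coincide.\<close>
    obtain a' where a': "\<forall>s < max section_end (Suc t). W s *v (k s - fst (sol 0 a' (Suc s))) = 0"
      using ex[of "max section_end (Suc t)"] by auto
    have "\<forall>t. inhom 0 (\<lambda>t. 0 - 0) (\<lambda>t. sol 0 a t - sol 0 a' t) t"
      by (intro allI inhom_diff sol_inhom)
    moreover have "(\<Sum>t<section_end. qW t (fst (sol 0 a (Suc t) - sol 0 a' (Suc t)))) \<le> 0"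
    proof (intro sum_nonpos)
      fix s assume "s \<in> {..<section_end}"
      then have "W s *v (k s - fst (sol 0 a (Suc s))) = 0" "W s *v (k s - fst (sol 0 a' (Suc s))) = 0"
        using a a' by auto
      then have "W s *v fst (sol 0 a (Suc s) - sol 0 a' (Suc s)) = 0"
        by (simp add: matrix_vector_mult_diff_distrib)
      then have "qW s (fst (sol 0 a (Suc s) - sol 0 a' (Suc s))) = 0" by (simp only: qW_0_iff)
      then show "qW s (fst (sol 0 a (Suc s) - sol 0 a' (Suc s))) \<le> 0" by simp
    qed
    ultimately have "(\<lambda>t. sol 0 a t - sol 0 a' t) = (\<lambda>_. 0)"
      by (intro definite_zero[of 0 _ section_end]) simp_all
    from fun_cong[OF this, of "Suc t"] have "sol 0 a (Suc t) = sol 0 a' (Suc t)" by simp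
    then show ?thesis using a' by simp
  qed
  define F where "F t = z t + sol 0 a t" for t
  have sim: "W_sim f F"
    using all by (simp add: W_sim_def F_def k_def matrix_vector_right_distrib
        matrix_vector_mult_diff_distrib algebra_simps)
  have "inhom 0 (\<lambda>t. \<mu> *s fst (f (Suc t)) + 0) F t" for t
    unfolding F_def[abs_def] using z(2) by (intro inhom_add sol_inhom) simp
  \<comment> \<open>The right-hand side enters only through \<open>W\<close>, so \<open>f\<close>
    may be replaced by the equivalent sequence \<open>F\<close>.\<close>
  then have "inhom 0 (\<lambda>t. 0 + (\<mu> - 0) *s fst (F (Suc t))) F t" for t
    using sim unfolding inhom_def W_sim_def by (simp add: vector_scalar_commute)
  then have "\<forall>t. inhom \<mu> (\<lambda>_. 0) F t"
    using inhom_shift[of \<mu> "\<lambda>_. 0" F _ 0] by blast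
  from sol_unique[OF this] have F: "F = sol \<mu> (F 1)" .
  have "F \<in> l2W W" using sim f(1) l2W_cong by blast
  then have "F 1 \<in> l2_solutions \<mu>" "X = cls W (sol \<mu> (F 1))"
    using F f sim cls_eq_iff by (auto simp: l2_solutions_def)
  then show ?thesis by blast
qed

lemma orthogonal_range_eq:
  "L2_orth W (Range (relation_shift W (H_min A B C W) (cnj \<mu>)))
    = (\<lambda>a. cls W (sol \<mu> a)) ` l2_solutions \<mu>"
  using orthogonal_range_solution solution_orthogonal_range sol_inhom
  unfolding l2_solutions_def by fast

section \<open>Dimension of the defect space\<close>

lemma subspace_l2_solutions: "cpair.subspace (l2_solutions \<mu>)"
  unfolding cpair.subspace_def l2_solutions_def mem_Collect_eq
proof (intro conjI ballI allI impI)
  have [simp]: "sol \<mu> 0 = (\<lambda>t. 0)" by (simp add: fun_eq_iff sol_zero)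
  show "sol \<mu> 0 \<in> l2W W" by (simp add: l2W_zero)
  have "sol \<mu> (x + y) = (\<lambda>t. sol \<mu> x t + sol \<mu> y t)" for x y by (simp add: fun_eq_iff sol_add)
  then show "sol \<mu> (x + y) \<in> l2W W" if "x \<in> {a. sol \<mu> a \<in> l2W W}" "y \<in> {a. sol \<mu> a \<in> l2W W}" for x y
    using that by (simp add: l2W_add)
  have "sol \<mu> (pscale c x) = (\<lambda>t. pscale c (sol \<mu> x t))" for c x by (simp add: fun_eq_iff sol_pscale)
  then show "sol \<mu> (pscale c x) \<in> l2W W" if "x \<in> {a. sol \<mu> a \<in> l2W W}" for c x
    using that by (simp add: l2W_pscale)
qed

lemma sol_class_inj:
  assumes "a \<in> l2_solutions \<mu>" "b \<in> l2_solutions \<mu>" "cls W (sol \<mu> a) = cls W (sol \<mu> b)"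
  shows "a = b"
proof -
  have sim: "W_sim (sol \<mu> a) (sol \<mu> b)"
    using assms cls_eq_iff by (simp add: l2_solutions_def)
  have "(\<lambda>t. sol \<mu> a t - sol \<mu> b t) = (\<lambda>_. 0)"
  proof (rule definite_zero[where N = section_end and \<mu> = \<mu>])
    show "\<forall>t. inhom \<mu> (\<lambda>_. 0) (\<lambda>t. sol \<mu> a t - sol \<mu> b t) t"
      using inhom_diff[OF sol_inhom sol_inhom] by simp
    have "qW t (fst (sol \<mu> a (Suc t) - sol \<mu> b (Suc t))) = 0" for t
      using sim by (simp add: qW_0_iff W_sim_def matrix_vector_mult_diff_distrib)
    then show "(\<Sum>t<section_end. qW t (fst (sol \<mu> a (Suc t) - sol \<mu> b (Suc t)))) \<le> 0" by simp
  qed simp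
  from fun_cong[OF this, of 1] show ?thesis by simp
qed

lemma L2_lincomb_solutions:
  assumes "finite b" "b \<subseteq> l2_solutions \<mu>"
  shows "L2_lincomb W ((\<lambda>a. cls W (sol \<mu> a)) ` b) c
    = cls W (sol \<mu> (\<Sum>a\<in>b. pscale (c (cls W (sol \<mu> a))) a))"
proof -
  have inj: "inj_on (\<lambda>a. cls W (sol \<mu> a)) b"
    using sol_class_inj assms(2) by (intro inj_onI) blast
  have b: "sol \<mu> a \<in> l2W W" if "a \<in> b" for a
    using that assms(2) by (auto simp: l2_solutions_def)
  let ?c = "\<lambda>a. c (cls W (sol \<mu> a))"
  have "L2_lincomb W ((\<lambda>a. cls W (sol \<mu> a)) ` b) c
      = cls W (\<lambda>t. \<Sum>a\<in>b. pscale (?c a) (rep (cls W (sol \<mu> a)) t))"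
    unfolding L2_lincomb_def by (simp add: sum.reindex[OF inj])
  also have "\<dots> = cls W (\<lambda>t. \<Sum>a\<in>b. pscale (?c a) (sol \<mu> a t))"
    using assms(1) b
    by (subst cls_eq_iff) (auto intro!: l2W_sum W_sim_sum W_sim_sym[OF rep_sim(1)] rep_sim(2))
  also have "(\<lambda>t. \<Sum>a\<in>b. pscale (?c a) (sol \<mu> a t)) = sol \<mu> (\<Sum>a\<in>b. pscale (?c a) a)"
    by (simp add: fun_eq_iff sol_sum assms(1))
  finally show ?thesis .
qed

lemma L2_basis_iff:
  assumes "finite b" "b \<subseteq> l2_solutions \<mu>"
  shows "L2_basis W ((\<lambda>a. cls W (sol \<mu> a)) ` l2_solutions \<mu>) ((\<lambda>a. cls W (sol \<mu> a)) ` b)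
    \<longleftrightarrow> cpair.independent b \<and> l2_solutions \<mu> \<subseteq> cpair.span b"
proof -
  let ?cl = "\<lambda>a. cls W (sol \<mu> a)"
  have inj: "inj_on ?cl b"
    using sol_class_inj assms(2) by (intro inj_onI) blast
  \<comment> \<open>Coefficients in the quotient are indexed by classes; \<open>ic\<close> carries
    them back to initial values.\<close>
  define ic where "ic = inv_into b ?cl"
  have ic: "ic (?cl a) = a" if "a \<in> b" for a
    using inj that unfolding ic_def by (rule inv_into_f_f)
  have sum_in: "(\<Sum>a\<in>b. pscale (u a) a) \<in> l2_solutions \<mu>" for u
    using assms(2) by (intro cpair.subspace_sum cpair.subspace_scale subspace_l2_solutions) auto
  have cl_eq: "?cl a = ?cl a' \<longleftrightarrow> a = a'" if "a \<in> l2_solutions \<mu>" "a' \<in> l2_solutions \<mu>" for a a'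
    using sol_class_inj[OF that] by blast
  have z: "cls W (\<lambda>_. 0) = ?cl 0" "0 \<in> l2_solutions \<mu>"
    using cpair.subspace_0[OF subspace_l2_solutions] by (simp_all add: sol_zero[abs_def])
  have "(\<forall>c. L2_lincomb W (?cl ` b) c = cls W (\<lambda>_. 0) \<longrightarrow> (\<forall>X\<in>?cl ` b. c X = 0))
      \<longleftrightarrow> (\<forall>c. (\<Sum>a\<in>b. pscale (c (?cl a)) a) = 0 \<longrightarrow> (\<forall>a\<in>b. c (?cl a) = 0))"
    unfolding L2_lincomb_solutions[OF assms] z(1) cl_eq[OF sum_in z(2)] by simp
  also have "\<dots> \<longleftrightarrow> (\<forall>u. (\<Sum>a\<in>b. pscale (u a) a) = 0 \<longrightarrow> (\<forall>a\<in>b. u a = 0))"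
  proof (intro iffI allI impI)
    fix u assume *: "\<forall>c. (\<Sum>a\<in>b. pscale (c (?cl a)) a) = 0 \<longrightarrow> (\<forall>a\<in>b. c (?cl a) = 0)"
      and "(\<Sum>a\<in>b. pscale (u a) a) = 0"
    then have "(\<Sum>a\<in>b. pscale ((u \<circ> ic) (?cl a)) a) = 0" by (simp add: ic)
    with * have "\<forall>a\<in>b. (u \<circ> ic) (?cl a) = 0" by blast
    then show "\<forall>a\<in>b. u a = 0" by (simp add: ic)
  qed auto
  also have "\<dots> \<longleftrightarrow> cpair.independent b"
    unfolding cpair.dependent_finite[OF assms(1)] by blast
  finally have ind: "(\<forall>c. L2_lincomb W (?cl ` b) c = cls W (\<lambda>_. 0) \<longrightarrow> (\<forall>X\<in>?cl ` b. c X = 0))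
      \<longleftrightarrow> cpair.independent b" .
  have "(\<exists>c. ?cl a = L2_lincomb W (?cl ` b) c) \<longleftrightarrow> a \<in> cpair.span b" if a: "a \<in> l2_solutions \<mu>" for a
  proof -
    have "(\<exists>c. ?cl a = L2_lincomb W (?cl ` b) c) \<longleftrightarrow> (\<exists>c. a = (\<Sum>a\<in>b. pscale (c (?cl a)) a))"
      unfolding L2_lincomb_solutions[OF assms] cl_eq[OF a sum_in] ..
    also have "\<dots> \<longleftrightarrow> (\<exists>u. a = (\<Sum>a\<in>b. pscale (u a) a))"
    proof
      assume "\<exists>u. a = (\<Sum>a\<in>b. pscale (u a) a)"
      then obtain u where "a = (\<Sum>a\<in>b. pscale (u a) a)" by blast
      then have "a = (\<Sum>a\<in>b. pscale ((u \<circ> ic) (?cl a)) a)" by (simp add: ic)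
      then show "\<exists>c. a = (\<Sum>a\<in>b. pscale (c (?cl a)) a)" by blast
    qed auto
    also have "\<dots> \<longleftrightarrow> a \<in> cpair.span b"
      unfolding cpair.span_finite[OF assms(1)] by auto
    finally show ?thesis .
  qed
  then have "(\<forall>X\<in>?cl ` l2_solutions \<mu>. \<exists>c. X = L2_lincomb W (?cl ` b) c)
      \<longleftrightarrow> l2_solutions \<mu> \<subseteq> cpair.span b" by auto
  then show ?thesis
    unfolding L2_basis_def using ind assms by auto
qed

lemma defect_plus_eq: "defect_plus W (H_min A B C W) = cpair.dim (l2_solutions (- \<i>))"
proof -
  let ?N = "l2_solutions (- \<i>)" and ?cl = "\<lambda>a. cls W (sol (- \<i>) a)"
  have orth: "L2_orth W (Range (relation_shift W (H_min A B C W) \<i>)) = ?cl ` ?N"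
    using orthogonal_range_eq[of "- \<i>"] by simp
  obtain b where b: "b \<subseteq> ?N" "cpair.independent b" "?N \<subseteq> cpair.span b"
    by (rule cpair.basis_exists)
  then have ex: "\<exists>b. L2_basis W (?cl ` ?N) b"
    using L2_basis_iff cpair_independent_finite by blast
  \<comment> \<open>The dimension of the quotient refers to a chosen basis; it is pulled back to a
    basis of initial values to compare cardinalities.\<close>
  define b0 where "b0 = (SOME b. L2_basis W (?cl ` ?N) b)"
  have b0: "L2_basis W (?cl ` ?N) b0"
    unfolding b0_def using ex by (rule someI_ex)
  then have "b0 \<subseteq> ?cl ` ?N" "finite b0" by (auto simp: L2_basis_def)
  then obtain b1 where b1: "b1 \<subseteq> ?N" "finite b1" "b0 = ?cl ` b1"
    by (meson finite_subset_image)
  have "cpair.independent b1" "?N \<subseteq> cpair.span b1"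
    using b0 L2_basis_iff[OF b1(2,1)] b1(3) by auto
  then have "card b1 = cpair.dim ?N"
    using b1(1) by (intro cpair.basis_card_eq_dim)
  moreover have "card b0 = card b1"
    unfolding b1(3) using b1(1) sol_class_inj by (intro card_image inj_onI) blast
  ultimately show ?thesis
    unfolding defect_plus_def orth L2_dim_def using ex by (simp add: b0_def)
qed

end

section \<open>Initial values at \<open>t = 1\<close>\<close>

text \<open>Reduced row echelon form obtained by maximality: vectors with the largest possible
  number of unit pivots must span.\<close>

lemma subspace_echelon:
  fixes Z :: "('a::field ^ 'n) set"
  assumes Z: "vec.subspace Z"
  shows "\<exists>(m::nat) z idx. (\<forall>j<m. z j \<in> Z) \<and> (\<forall>k<m. \<forall>j<m. z j $ idx k = (if k = j then 1 else 0)) \<and>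
    (\<forall>w\<in>Z. w = (\<Sum>j<m. (w $ idx j) *s z j))"
proof -
  define Q where "Q m \<longleftrightarrow> (\<exists>z idx. (\<forall>j<m. z j \<in> Z) \<and>
    (\<forall>k<m. \<forall>j<m. z j $ idx k = (if k = j then 1 else 0)))" for m :: nat
  have Q0: "Q 0" by (simp add: Q_def)
  have bound: "m \<le> CARD('n)" if "Q m" for m
  proof -
    obtain z :: "nat \<Rightarrow> 'a ^ 'n" and idx :: "nat \<Rightarrow> 'n" where
      z: "\<forall>k<m. \<forall>j<m. z j $ idx k = (if k = j then 1 else 0)"
      using \<open>Q m\<close> unfolding Q_def by blast
    have "inj_on idx {..<m}"
    proof (intro inj_onI)
      fix k l assume "k \<in> {..<m}" "l \<in> {..<m}" "idx k = idx l"
      then have "(if l = k then 1 else (0::'a)) = 1" using z by (metis lessThan_iff)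
      then show "k = l" by (auto split: if_splits)
    qed
    then show ?thesis using card_inj_on_le[of idx "{..<m}" UNIV] by simp
  qed
  define m where "m = Greatest Q"
  have "Q m" unfolding m_def using Q0 bound by (rule GreatestI_nat)
  then obtain z :: "nat \<Rightarrow> 'a ^ 'n" and idx :: "nat \<Rightarrow> 'n" where
    zz: "\<forall>j<m. z j \<in> Z" "\<forall>k<m. \<forall>j<m. z j $ idx k = (if k = j then 1 else 0)"
    unfolding Q_def by blast
  then have zZ: "\<And>j. j < m \<Longrightarrow> z j \<in> Z"
    and z: "\<And>j k. k < m \<Longrightarrow> j < m \<Longrightarrow> z j $ idx k = (if k = j then 1 else 0)"
    by blast+
  have "\<not> Q (Suc m)"
    using Greatest_le_nat[of Q "Suc m" "CARD('n)"] bound by (auto simp: m_def)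
  have "\<forall>w\<in>Z. w = (\<Sum>j<m. (w $ idx j) *s z j)"
  proof (intro ballI, rule ccontr)
    fix w assume w: "w \<in> Z"
    \<comment> \<open>The remainder vanishes at every pivot. If nonzero it supplies a new one, and
      clearing that coordinate in the other vectors contradicts maximality.\<close>
    define w' where "w' = w - (\<Sum>j<m. (w $ idx j) *s z j)"
    assume "w \<noteq> (\<Sum>j<m. (w $ idx j) *s z j)"
    then have "w' \<noteq> 0" by (simp add: w'_def)
    then obtain i where i: "w' $ i \<noteq> 0" by (auto simp: vec_eq_iff)
    have w'Z: "w' \<in> Z"
      unfolding w'_def using zZ w
      by (intro vec.subspace_diff[OF Z] vec.subspace_sum[OF Z] vec.subspace_scale[OF Z]) auto
    have w'0: "w' $ idx k = 0" if "k < m" for k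
    proof -
      have "(\<Sum>j<m. w $ idx j * z j $ idx k) = (\<Sum>j<m. if j = k then w $ idx j else 0)"
        using that by (intro sum.cong refl) (simp add: z)
      then show ?thesis using that by (simp add: w'_def)
    qed
    define zm where "zm = (1 / w' $ i) *s w'"
    have zm: "zm \<in> Z" "zm $ i = 1" "\<And>k. k < m \<Longrightarrow> zm $ idx k = 0"
      using i w'Z w'0 by (simp_all add: zm_def vec.subspace_scale[OF Z])
    have "Q (Suc m)"
      unfolding Q_def
    proof (intro exI conjI allI impI)
      fix k j assume k: "k < Suc m"
      show "(if k < m then z k - (z k $ i) *s zm else zm) \<in> Z"
        using zZ[of k] zm(1) by (simp add: vec.subspace_diff[OF Z] vec.subspace_scale[OF Z])
      assume "j < Suc m"
      then show "(if j < m then z j - (z j $ i) *s zm else zm) $ (if k < m then idx k else i)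
          = (if k = j then 1 else 0)"
        using k zm z by (auto simp: less_Suc_eq)
    qed
    with \<open>\<not> Q (Suc m)\<close> show False ..
  qed
  with zz show ?thesis
    by (intro exI[of _ m] exI[of _ z] exI[of _ idx] conjI)
qed

context disconjugate_system
begin

section \<open>A basis of square-summable initial values\<close>

lemma initial_value_expansion:
  "(\<Sum>k\<in>UNIV. pscale (e $ k) (axis k 1, M_lim *v axis k 1)) = (e, M_lim *v e)"
  by (simp add: prod_eq_iff fst_sum snd_sum basis_expansion)
    (simp add: vec_eq_iff matrix_vector_axis matrix_vector_mult_def[of _ e] mult.commute)

lemma recessive_columns:
  fixes y :: "'n \<Rightarrow> 'n cseq"
  assumes y: "\<And>k. y k = sol Lam (axis k 1, M_lim *v axis k 1)"
  shows "recessive_solution A B C W Lam (col_upper y) (col_lower y)"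
proof (rule recessive)
  fix t c
  have "sol Lam (c, M_lim *v c) t = (\<Sum>k\<in>UNIV. pscale (c $ k) (y k t))"
    using sol_sum[of UNIV Lam "\<lambda>k. c $ k" "\<lambda>k. (axis k 1, M_lim *v axis k 1)" t]
    by (simp add: initial_value_expansion y)
  then show "(col_upper y t *v c, col_lower y t *v c) = sol Lam (c, M_lim *v c) t"
    by (simp add: prod_eq_iff fst_sum snd_sum vec_eq_iff matrix_vector_mult_def col_upper_def
        col_lower_def mult.commute)
qed

definition data :: "(nat \<Rightarrow> complex ^ 'n) \<Rightarrow> 'n + nat \<Rightarrow> 'n cpair" where
  "data z = case_sum (\<lambda>k. (axis k 1, M_lim *v axis k 1)) (\<lambda>j. (0, z j))"

lemma data_simps [simp]:
  "data z (Inl k) = (axis k 1, M_lim *v axis k 1)" "data z (Inr j) = (0, z j)"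
  by (simp_all add: data_def)

text \<open>The u-parts eliminate the left coefficients; the pivot coordinates of the v-parts then
  eliminate the right ones.\<close>

lemma data_independent:
  assumes z: "\<forall>k<m. \<forall>j<m. z j $ idx k = (if k = j then 1 else 0)"
    and sum: "(\<Sum>x\<in>UNIV <+> {..<m}. pscale (c x) (data z x)) = 0"
  shows "\<forall>x\<in>UNIV <+> {..<m}. c x = 0"
proof -
  have s: "(\<Sum>k\<in>UNIV. pscale (c (Inl k)) (data z (Inl k))) + (\<Sum>j<m. pscale (c (Inr j)) (data z (Inr j))) = 0"
    using sum by (simp add: sum.Plus comp_def)
  have "(\<Sum>k\<in>UNIV. c (Inl k) *s axis k (1::complex)) = 0"
    using arg_cong[OF s, of fst] by (simp add: fst_sum)
  then have "(\<Sum>k\<in>UNIV. (\<chi> k. c (Inl k)) $ k *s axis k (1::complex)) = 0" by simp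
  then have "(\<chi> k. c (Inl k)) = (0 :: complex ^ 'n)" unfolding basis_expansion .
  then have l: "c (Inl k) = 0" for k by (simp add: vec_eq_iff)
  have "(\<Sum>j<m. c (Inr j) *s z j) = 0"
    using arg_cong[OF s, of snd] by (simp add: snd_sum l)
  then have "(\<Sum>j<m. c (Inr j) * z j $ idx k) = 0" for k
    by (simp add: vec_eq_iff)
  moreover have "(\<Sum>j<m. c (Inr j) * z j $ idx k) = (\<Sum>j<m. if j = k then c (Inr j) else 0)" if "k < m" for k
    using that by (intro sum.cong refl) (simp add: z)
  ultimately have "c (Inr k) = 0" if "k < m" for k using that by simp
  with l show ?thesis by auto
qed

text \<open>Subtracting the recessive solution with the same u(1) leaves a square-summable solution
  with u(1) = 0, that is, a combination of the \<open>z j\<close>.\<close>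

lemma dim_l2_solutions_data:
  assumes zN: "\<And>j. j < m \<Longrightarrow> (0, z j) \<in> l2_solutions Lam"
    and z: "\<forall>k<m. \<forall>j<m. z j $ idx k = (if k = j then 1 else 0)"
    and span: "\<And>w. (0, w) \<in> l2_solutions Lam \<Longrightarrow> w = (\<Sum>j<m. (w $ idx j) *s z j)"
  shows "cpair.dim (l2_solutions Lam) = CARD('n) + m"
proof -
  let ?I = "(UNIV :: 'n set) <+> {..<m}" and ?N = "l2_solutions Lam"
  have fin: "finite ?I" by simp
  have rec: "(e, M_lim *v e) \<in> ?N" for e
    using recessive_l2W by (simp add: l2_solutions_def)
  have "inj_on (data z) ?I" "cpair.independent (data z ` ?I)"
    using cpair.family_independent[OF fin, of "data z"] data_independent[OF z] by blast+
  moreover have "data z ` ?I \<subseteq> ?N" using rec zN by auto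
  moreover have "?N \<subseteq> cpair.span (data z ` ?I)"
  proof
    fix p assume p: "p \<in> ?N"
    define w where "w = snd p - M_lim *v fst p"
    have "p - (fst p, M_lim *v fst p) \<in> ?N"
      by (intro cpair.subspace_diff subspace_l2_solutions p rec)
    then have "(0, w) \<in> ?N" by (simp add: w_def minus_prod_def)
    then have "w = (\<Sum>j<m. (w $ idx j) *s z j)" by (rule span)
    then have "(\<Sum>j<m. pscale (w $ idx j) (data z (Inr j))) = (0, w)"
      by (simp add: prod_eq_iff fst_sum snd_sum)
    moreover have "(\<Sum>k\<in>UNIV. pscale (fst p $ k) (data z (Inl k))) = (fst p, M_lim *v fst p)"
      by (simp add: initial_value_expansion)
    ultimately have "p = (\<Sum>k\<in>UNIV. pscale (fst p $ k) (data z (Inl k))) + (\<Sum>j<m. pscale (w $ idx j) (data z (Inr j)))"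
      by (simp only:) (simp add: prod_eq_iff w_def)
    also have "\<dots> \<in> cpair.span (data z ` ?I)"
      by (intro cpair.span_add cpair.span_sum cpair.span_scale cpair.span_base) (auto simp del: data_simps)
    finally show "p \<in> cpair.span (data z ` ?I)" .
  qed
  ultimately have "cpair.dim ?N = card ?I"
    using cpair.basis_card_eq_dim[of "data z ` ?I" ?N] by (simp add: card_image)
  then show ?thesis by (simp add: card_Plus)
qed

text \<open>Recessive columns are mutually isotropic by symmetry of \<open>M_lim\<close>, the other
  columns because u(1) = 0. A mixed pairing reads off a pivot coordinate.\<close>

lemma bform_data:
  assumes z: "\<forall>k<m. \<forall>j<m. z j $ idx k = (if k = j then 1 else 0)"
    and ij: "i < 2 * m" "j < 2 * m"
  defines "\<theta> \<equiv> \<lambda>i. if i < m then data z (Inl (idx i)) else data z (Inr (i - m))"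
  shows "bform (\<theta> i) (\<theta> j) = (if j = i + m then 1 else if i = j + m then - 1 else 0)"
proof -
  consider "i < m" "j < m" | "i < m" "m \<le> j" | "m \<le> i" "j < m" | "m \<le> i" "m \<le> j" by linarith
  then show ?thesis
  proof cases
    case 2
    then have "z (j - m) $ idx i = (if i = j - m then 1 else 0)" using z ij by simp
    with 2 show ?thesis by (auto simp: \<theta>_def bform_alt cdot_axis)
  next
    case 3
    then have "z (i - m) $ idx j = (if j = i - m then 1 else 0)" using z ij by simp
    with 3 show ?thesis by (auto simp: \<theta>_def bform_alt cdot_axis)
  qed (use ij in \<open>auto simp: \<theta>_def bform_alt M_lim_symmetric\<close>)
qed

end

theorem lemma4p3:
  fixes A B C W :: "nat \<Rightarrow> complex ^ 'n::finite ^ 'n"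
    and lam lam0 :: real and d :: nat
  assumes "hamiltonian_coeffs A B C W"
    and "disconjugate A B C W (complex_of_real lam0)"
    and "identically_normal A B"
    and "definiteness_condition A B C W"
    and "lam < lam0"
    and "d = defect_plus W (H_min A B C W)"
    and "d = defect_minus W (H_min A B C W)"
  shows "CARD('n) \<le> d \<and>
    (let m = d - CARD('n) in
     \<exists>(yt :: 'n \<Rightarrow> 'n cseq) (yh :: nat \<Rightarrow> 'n cseq) (idx :: nat \<Rightarrow> 'n).
       (\<forall>k. solution A B C W (complex_of_real lam) (yt k) \<and> yt k \<in> l2W W) \<and>
       (\<forall>j<m. solution A B C W (complex_of_real lam) (yh j) \<and> yh j \<in> l2W W) \<and>
       lin_indep (UNIV <+> {..<m}) (case_sum yt yh) \<and>
       recessive_solution A B C W (complex_of_real lam) (col_upper yt) (col_lower yt) \<and>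
       col_upper yt 1 = mat 1 \<and>
       (\<forall>j<m. fst (yh j 1) = 0) \<and>
       (\<forall>k<m. \<forall>j<m. snd (yh j 1) $ idx k = (if k = j then 1 else 0)) \<and>
       (let \<theta> = (\<lambda>i. if i < m then yt (idx i) else yh (i - m)) in
        \<forall>t. \<forall>i<2 * m. \<forall>j<2 * m.
          bform (\<theta> i t) (\<theta> j t) = (if j = i + m then 1 else if i = j + m then - 1 else 0)))"
proof -
  interpret disconjugate_system A B C W lam0 lam
    by unfold_locales (fact assms)+
  define Z where "Z = {w. (0, w) \<in> l2_solutions Lam}"
  have "vec.subspace Z"
    unfolding vec.subspace_def
  proof (intro conjI ballI allI)
    note N = subspace_l2_solutions[of Lam]
    show "0 \<in> Z" using cpair.subspace_0[OF N] by (simp add: Z_def zero_prod_def)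
    show "x + y \<in> Z" if "x \<in> Z" "y \<in> Z" for x y
      using that cpair.subspace_add[OF N, of "(0, x)" "(0, y)"] by (simp add: Z_def)
    show "c *s x \<in> Z" if "x \<in> Z" for c x
      using that cpair.subspace_scale[OF N, of "(0, x)" c] by (simp add: Z_def pscale_def)
  qed
  from subspace_echelon[OF this] obtain m and z :: "nat \<Rightarrow> complex ^ 'n" and idx :: "nat \<Rightarrow> 'n" where
    zz: "\<forall>j<m. z j \<in> Z" "\<forall>k<m. \<forall>j<m. z j $ idx k = (if k = j then 1 else 0)"
      "\<forall>w\<in>Z. w = (\<Sum>j<m. (w $ idx j) *s z j)"
    by blast
  then have zZ: "\<And>j. j < m \<Longrightarrow> z j \<in> Z"
    and span: "\<And>w. w \<in> Z \<Longrightarrow> w = (\<Sum>j<m. (w $ idx j) *s z j)"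
    by blast+
  have "cpair.dim (l2_solutions Lam) = CARD('n) + m"
    using zZ zz(2) span by (intro dim_l2_solutions_data[where z = z and idx = idx]) (auto simp: Z_def)
  \<comment> \<open>The defect index counts solutions at \<open>-\<i>\<close>; equality of
    dimensions transfers the count to \<open>lam\<close> and identifies m with d - n.\<close>
  then have d: "d = CARD('n) + m"
    using assms(6) defect_plus_eq dim_l2_solutions_eq by simp
  define yt where "yt k = sol Lam (data z (Inl k))" for k
  define yh where "yh j = sol Lam (data z (Inr j))" for j
  have y: "case_sum yt yh x = sol Lam (data z x)" for x
    by (cases x) (simp_all add: yt_def yh_def)
  have "lin_indep (UNIV <+> {..<m}) (case_sum yt yh)"
    unfolding lin_indep_def
  proof (intro allI impI)
    fix c assume "\<forall>t. (\<Sum>x\<in>UNIV <+> {..<m}. pscale (c x) (case_sum yt yh x t)) = 0"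
    from this[rule_format, of 1]
    have "(\<Sum>x\<in>UNIV <+> {..<m}. pscale (c x) (data z x)) = 0"
      unfolding y by simp
    with data_independent[OF zz(2)] show "\<forall>x\<in>UNIV <+> {..<m}. c x = 0" .
  qed
  moreover have "recessive_solution A B C W Lam (col_upper yt) (col_lower yt)"
    by (rule recessive_columns) (simp add: yt_def)
  moreover have "\<forall>t. \<forall>i<2 * m. \<forall>j<2 * m.
      bform ((if i < m then yt (idx i) else yh (i - m)) t) ((if j < m then yt (idx j) else yh (j - m)) t)
      = (if j = i + m then 1 else if i = j + m then - 1 else 0)"
  proof (intro allI impI)
    fix t i j assume ij: "i < 2 * m" "j < 2 * m"
    let ?th = "\<lambda>i. if i < m then data z (Inl (idx i)) else data z (Inr (i - m))"
    have th: "(if i < m then yt (idx i) else yh (i - m)) = sol Lam (?th i)" for i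
      by (simp add: yt_def yh_def)
    have "bform (sol Lam (?th i) t) (sol Lam (?th j) t) = bform (sol Lam (?th i) 1) (sol Lam (?th j) 1)"
      by (intro bform_const[of lam] allI sol_inhom)
    also have "\<dots> = bform (?th i) (?th j)" by simp
    also have "\<dots> = (if j = i + m then 1 else if i = j + m then - 1 else 0)"
      using bform_data[OF zz(2) ij] .
    finally show "bform ((if i < m then yt (idx i) else yh (i - m)) t)
        ((if j < m then yt (idx j) else yh (j - m)) t)
      = (if j = i + m then 1 else if i = j + m then - 1 else 0)" unfolding th .
  qed
  moreover have "col_upper yt 1 = mat 1"
    by (simp add: vec_eq_iff col_upper_def yt_def mat_def axis_def)
  moreover have "\<forall>k. solution A B C W Lam (yt k) \<and> yt k \<in> l2W W"
    by (simp add: yt_def solution_iff sol_inhom recessive_l2W)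
  moreover have "\<forall>j<m. solution A B C W Lam (yh j) \<and> yh j \<in> l2W W"
    using zZ by (simp add: yh_def solution_iff sol_inhom Z_def l2_solutions_def)
  moreover have "\<forall>j<m. fst (yh j 1) = 0" "\<forall>k<m. \<forall>j<m. snd (yh j 1) $ idx k = (if k = j then 1 else 0)"
    by (simp_all add: yh_def zz(2))
  moreover have "CARD('n) \<le> d" "d - CARD('n) = m"
    using d by simp_all
  ultimately show ?thesis
    unfolding Let_def by (simp only: simp_thms) (intro exI[of _ yt] exI[of _ yh] exI[of _ idx] conjI)
qed

end
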